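(* Suppose that $G$ is the complete graph with $k$ vertices $\{1,2,\dots,k\}$, and let $Q_k$ be the stationary distribution (with total mass $k$) for the meteor process $\mathcal{M}_t=(M^1_t,\dots,M^k_t)$ on $G$. (i) The distributions of $M^1_0$ under $Q_k$ converge to the exponential distribution with mean $1$, when $k\to\infty$. (ii) There is propagation of chaos; that is, for any finite $n\ge2$, the distributions of $\{M^j_t,t\ge0\}$, $j=1,\dots,n$, under $Q_k$, are asymptotically independent, when $k\to\infty$.
   Context: Meteor process on the complete graph with $k$ vertices: let $N^j$, $1\le j\le k$, be jointly independent rate 1 Poisson processes, independent of the nonnegative initial vector $\mathcal{M}_0$. At a jump time $t$ of $N^j$, $M^j_t=0$ and $M^x_t=M^x_{t-}+M^j_{t-}/(k-1)$ for every $x\ne j$; masses are constant between jumps. For total mass $k$ this Markov process has a unique stationary distribution $Q_k$; "under $Q_k$" means that $\mathcal{M}_0$ has distribution $Q_k$. *)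

theory Defs
  imports "HOL-Probability.Probability"
begin

definition jump_time :: "(real \<Rightarrow> nat) \<Rightarrow> real \<Rightarrow> bool" where
  "jump_time c t \<longleftrightarrow> t > 0 \<and> \<not> continuous (at_left t) c"

text \<open>The subtraction of counts is on type nat; almost every path is nondecreasing, so it does
  not truncate outside a null set.\<close>

definition unit_poisson_process :: "'a measure \<Rightarrow> (real \<Rightarrow> 'a \<Rightarrow> nat) \<Rightarrow> bool" where
  "unit_poisson_process P X \<longleftrightarrow>
    (\<forall>t\<ge>0. X t \<in> P \<rightarrow>\<^sub>M count_space UNIV) \<and>
    (AE \<omega> in P. X 0 \<omega> = 0 \<and> mono_on {0..} (\<lambda>t. X t \<omega>) \<and>
       (\<forall>t\<ge>0. continuous (at_right t) (\<lambda>s. X s \<omega>))) \<and>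
    (\<forall>s t. 0 \<le> s \<and> s < t \<longrightarrow>
       distr P (count_space UNIV) (\<lambda>\<omega>. X t \<omega> - X s \<omega>) = measure_pmf (poisson_pmf (t - s))) \<and>
    (\<forall>(m::nat) \<tau>. 0 \<le> \<tau> 0 \<and> mono \<tau> \<longrightarrow>
       prob_space.indep_vars P (\<lambda>_. count_space UNIV)
         (\<lambda>i \<omega>. X (\<tau> (Suc i)) \<omega> - X (\<tau> i) \<omega>) {..<m})"

definition state :: "nat \<Rightarrow> (nat \<Rightarrow> real \<Rightarrow> 'a \<Rightarrow> real) \<Rightarrow> real \<Rightarrow> 'a \<Rightarrow> (nat \<Rightarrow> real)" where
  "state k M t \<omega> = (\<lambda>j\<in>{1..k}. M j t \<omega>)"

abbreviation state_space :: "nat \<Rightarrow> (nat \<Rightarrow> real) measure" where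
  "state_space k \<equiv> \<Pi>\<^sub>M j\<in>{1..k}. borel"

definition sample_path :: "(real \<Rightarrow> 'a \<Rightarrow> 'b) \<Rightarrow> 'a \<Rightarrow> (real \<Rightarrow> 'b)" where
  "sample_path X \<omega> = (\<lambda>t\<in>{0..}. X t \<omega>)"

text \<open>Index \<open>0\<close> of the independent family below stands for the initial vector, index \<open>j \<ge> 1\<close>
  for the whole path of the \<open>j\<close>-th Poisson process. The limits \<open>l x\<close> in the jump rule are
  the left limits of the masses at the jump time.\<close>

definition meteor_process ::
    "nat \<Rightarrow> 'a measure \<Rightarrow> (nat \<Rightarrow> real \<Rightarrow> 'a \<Rightarrow> nat) \<Rightarrow> (nat \<Rightarrow> real \<Rightarrow> 'a \<Rightarrow> real) \<Rightarrow> bool" where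
  "meteor_process k P N M \<longleftrightarrow>
    prob_space P \<and>
    (\<forall>j\<in>{1..k}. unit_poisson_process P (N j)) \<and>
    (\<forall>j\<in>{1..k}. \<forall>t\<ge>0. M j t \<in> borel_measurable P) \<and>
    prob_space.indep_sets P
      (\<lambda>i. if i = 0
           then sets (vimage_algebra (space P) (state k M 0) (state_space k))
           else sets (vimage_algebra (space P) (sample_path (N i)) (\<Pi>\<^sub>M t\<in>{0..}. count_space UNIV)))
      {0..k} \<and>
    (AE \<omega> in P.
      (\<forall>j\<in>{1..k}. 0 \<le> M j 0 \<omega>) \<and>
      (\<forall>j\<in>{1..k}. \<forall>t. jump_time (\<lambda>s. N j s \<omega>) t \<longrightarrow>
         (\<exists>l. (\<forall>x\<in>{1..k}. ((\<lambda>s. M x s \<omega>) \<longlongrightarrow> l x) (at_left t)) \<and>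
              M j t \<omega> = 0 \<and>
              (\<forall>x\<in>{1..k} - {j}. M x t \<omega> = l x + l j / (real k - 1)))) \<and>
      (\<forall>s t. 0 \<le> s \<and> s < t \<and> (\<forall>j\<in>{1..k}. \<forall>u\<in>{s<..t}. \<not> jump_time (\<lambda>r. N j r \<omega>) u) \<longrightarrow>
         (\<forall>x\<in>{1..k}. M x t \<omega> = M x s \<omega>)))"

text \<open>The type argument only says on which type of sample points the realizations of the process
  live; the law of the process is determined by that of its initial vector.\<close>

definition stationary_distribution :: "'a itself \<Rightarrow> nat \<Rightarrow> (nat \<Rightarrow> real) measure \<Rightarrow> bool" where
  "stationary_distribution _ k Q \<longleftrightarrow>
    prob_space Q \<and> sets Q = sets (state_space k) \<and>
    (AE m in Q. \<forall>j\<in>{1..k}. 0 \<le> m j) \<and>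
    (\<forall>(P :: 'a measure) N M.
       meteor_process k P N M \<and> distr P (state_space k) (state k M 0) = Q \<longrightarrow>
       (\<forall>t\<ge>0. distr P (state_space k) (state k M t) = Q))"

definition total_mass :: "nat \<Rightarrow> (nat \<Rightarrow> real) measure \<Rightarrow> real \<Rightarrow> bool" where
  "total_mass k Q c \<longleftrightarrow> (AE m in Q. (\<Sum>j=1..k. m j) = c)"

definition cadlag :: "(real \<Rightarrow> real) set" where
  "cadlag = {x \<in> extensional {0..}.
     (\<forall>t\<ge>0. continuous (at_right t) x) \<and> (\<forall>t>0. \<exists>l. (x \<longlongrightarrow> l) (at_left t))}"

text \<open>Convergence in the Skorokhod J1 topology on the half-line. The topology is metrizable, so
  continuity of a functional is sequential continuity. A strictly increasing bijection of the
  half-line is automatically continuous.\<close>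

definition skorokhod_converges :: "(nat \<Rightarrow> real \<Rightarrow> real) \<Rightarrow> (real \<Rightarrow> real) \<Rightarrow> bool" where
  "skorokhod_converges x y \<longleftrightarrow>
    (\<exists>\<tau> :: nat \<Rightarrow> real \<Rightarrow> real.
      (\<forall>i. strict_mono_on {0..} (\<tau> i) \<and> bij_betw (\<tau> i) {0..} {0..}) \<and>
      uniform_limit {0..} \<tau> (\<lambda>t. t) sequentially \<and>
      (\<forall>T\<ge>0. uniform_limit {0..T} (\<lambda>i t. x i (\<tau> i t)) y sequentially))"

text \<open>Bounded Skorokhod-continuous functionals on the space of cadlag paths. The Skorokhod Borel
  sets are the trace of the product sigma-algebra, so measurability is no extra restriction on the
  space of cadlag paths. It is imposed on all paths (a real function measurable for the trace
  extends) because the processes have cadlag paths only almost surely.\<close>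

definition skorokhod_test_function :: "((real \<Rightarrow> real) \<Rightarrow> real) \<Rightarrow> bool" where
  "skorokhod_test_function F \<longleftrightarrow>
    F \<in> borel_measurable (\<Pi>\<^sub>M t\<in>{0..}. borel) \<and>
    bounded (F ` cadlag) \<and>
    (\<forall>x y. (\<forall>i. x i \<in> cadlag) \<and> y \<in> cadlag \<and> skorokhod_converges x y \<longrightarrow>
       (\<lambda>i. F (x i)) \<longlonglongrightarrow> F y)"

definition asymptotically_independent ::
    "(nat \<Rightarrow> 'a measure) \<Rightarrow> (nat \<Rightarrow> nat \<Rightarrow> real \<Rightarrow> 'a \<Rightarrow> real) \<Rightarrow> nat set \<Rightarrow> bool" where
  "asymptotically_independent P X J \<longleftrightarrow>
    (\<forall>F. (\<forall>j\<in>J. skorokhod_test_function (F j)) \<longrightarrow>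
      (\<lambda>k. (\<integral>\<omega>. (\<Prod>j\<in>J. F j (sample_path (X k j) \<omega>)) \<partial>P k) -
           (\<Prod>j\<in>J. \<integral>\<omega>. F j (sample_path (X k j) \<omega>) \<partial>P k)) \<longlonglongrightarrow> 0)"

end

theory Submission
  imports Defs "HOL-Complex_Analysis.Great_Picard"
begin

text \<open>
  Why the theorem holds. Between two jumps of its own clock, the mass of a vertex grows by the mass
  that all other vertices emit, divided by \<open>k - 1\<close>. There are many small emissions, and together they
  amount to mass \<open>k\<close> per unit of time. By a law of large numbers the mass of every vertex therefore
  grows almost linearly with slope one, and it is reset to zero when the clock of the vertex rings.
  In the limit the mass of vertex \<open>j\<close> is a renewal path: the time since the last jump of clock \<open>j\<close>
  if there was one, otherwise the initial mass plus the elapsed time. Different vertices use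
  independent clocks, so after a long time, when the initial masses are forgotten, the masses are
  almost independent, and each is almost exponentially distributed. By stationarity the same holds
  at time zero.

  The law of large numbers needs a bound on the emitted second moments. The generator of the process
  maps the sum of the squared masses to an affine function of itself (\<open>square_sum_generator\<close>), hence
  its stationary expectation is exactly \<open>2 k\<close> (\<open>expectation_square_sum_start\<close>), and the variance of
  the emitted mass is of order \<open>1 / k\<close> (\<open>emitted_second_moment\<close>). Stochastic calculus is avoided by
  observing the process on a fine grid of times: on the event that at most one clock rings in every
  cell, the masses at grid points form a Markov chain driven by independent variables
  (\<open>chain_eq_mass\<close>), and this event has probability close to one (\<open>prob_good\<close>). As the emitted mass
  is monotone, its control at finitely many times gives the uniform approximation by renewal paths
  (\<open>masses_close_to_renewal\<close>).

  For the one-vertex marginals, the approximation is applied at a fixed time \<open>T\<close>: the renewal path is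
  below \<open>a < T\<close> exactly if the clock rings in the last \<open>a\<close> time units
  (\<open>marginal_close_to_exponential\<close>).

  For the propagation of chaos, functionals that are continuous in the Skorokhod topology have to
  be compared along paths that are only uniformly close. Outside a small probability, a unit Poisson
  path lies in a compact set described by the gaps and the growth of its jump times
  (\<open>poisson_tight\<close>), and over such a set a test function is uniformly continuous along renewal paths
  (\<open>test_function_uniformly_continuous\<close>). Then, up to small errors, the expectation of a product of
  functionals of the masses is that of the same functionals of renewal paths; integrating out the
  clocks (\<open>expectation_prod_renewal\<close>) leaves a product of functions of the initial masses; by
  stationarity these may be taken at time \<open>T\<close>, where they are close to the ages of the independent
  clocks, and the expectation factorizes (\<open>expectation_prod_factorizes\<close>).
\<close>

section \<open>Counting paths and the time since the last jump\<close>

definition counting_path :: "(real \<Rightarrow> nat) \<Rightarrow> bool" where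
  "counting_path c \<longleftrightarrow>
    c 0 = 0 \<and> mono_on {0..} c \<and> (\<forall>t\<ge>0. continuous (at_right t) c)"

lemma counting_path_zero: "counting_path c \<Longrightarrow> c 0 = 0"
  by (simp add: counting_path_def)

lemma counting_path_mono: "counting_path c \<Longrightarrow> 0 \<le> s \<Longrightarrow> s \<le> t \<Longrightarrow> c s \<le> c t"
  by (auto simp: counting_path_def mono_on_def)

lemma counting_path_locally_constant_right:
  assumes "counting_path c" "0 \<le> t"
  obtains e where "e > 0" "\<And>s. t \<le> s \<Longrightarrow> s \<le> t + e \<Longrightarrow> c s = c t"
proof -
  have "(c \<longlongrightarrow> c t) (at_right t)"
    using assms by (auto simp: counting_path_def continuous_within)
  then have "eventually (\<lambda>s. c s = c t) (at_right t)"
    by (simp add: tendsto_discrete)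
  then obtain b where b: "b > t" "\<And>s. t < s \<Longrightarrow> s < b \<Longrightarrow> c s = c t"
    unfolding eventually_at_right_field by blast
  show thesis
    by (rule that[of "(b - t) / 2"]) (use b in \<open>auto simp: field_simps order_le_less\<close>)
qed

text \<open>The count takes finitely many values before \<open>t\<close>. It is constant from a point on at which it
  attains the largest of them.\<close>

lemma counting_path_locally_constant_left:
  assumes "counting_path c" "0 < t"
  obtains a where "0 \<le> a" "a < t" "\<And>s. a \<le> s \<Longrightarrow> s < t \<Longrightarrow> c s = c a"
proof -
  have fin: "finite (c ` {0..<t})"
    by (rule finite_subset[of _ "{..c t}"]) (use assms in \<open>auto intro!: counting_path_mono\<close>)
  have "Max (c ` {0..<t}) \<in> c ` {0..<t}"
    using fin assms by (intro Max_in) auto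
  then obtain a where a: "0 \<le> a" "a < t" "c a = Max (c ` {0..<t})" by auto
  show thesis
  proof (rule that[OF a(1,2)])
    fix s assume s: "a \<le> s" "s < t"
    have "c s \<le> c a" unfolding a(3) using s a fin by (intro Max_ge) auto
    moreover have "c a \<le> c s" using assms a s by (intro counting_path_mono) auto
    ultimately show "c s = c a" by simp
  qed
qed

lemma counting_path_no_jump:
  assumes "counting_path c" "0 \<le> s" "c s = c t" "s < u" "u \<le> t"
  shows "\<not> jump_time c u"
proof -
  have eq: "c r = c u" if "s \<le> r" "r \<le> u" for r
  proof -
    have "c s \<le> c r" "c r \<le> c u" "c u \<le> c t"
      by (rule counting_path_mono[OF assms(1)]; use assms that in linarith)+
    moreover have "c s \<le> c u" by (rule counting_path_mono[OF assms(1)]; use assms in linarith)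
    ultimately show ?thesis using assms(3) by simp
  qed
  have "eventually (\<lambda>r. c r = c u) (at_left u)"
    unfolding eventually_at_left_field using assms(4) eq by (meson order_less_imp_le)
  then have "continuous (at_left u) c"
    by (simp add: continuous_within tendsto_discrete)
  then show ?thesis by (simp add: jump_time_def)
qed

lemma counting_path_jump:
  assumes "counting_path c" "jump_time c u" "0 \<le> s" "s < u"
  shows "c s < c u"
  using counting_path_no_jump[OF assms(1,3) _ assms(4), of u]
    counting_path_mono[OF assms(1,3), of u] assms
  by (metis order_le_less order_refl)

text \<open>The first time after \<open>s\<close> at which the count differs from \<open>c s\<close> is attained by right
  continuity, and it is a jump time.\<close>

lemma counting_path_jump_exists:
  assumes c: "counting_path c" and st: "0 \<le> s" "s < t" "c s \<noteq> c t"
  obtains u where "s < u" "u \<le> t" "jump_time c u" "\<And>r. s \<le> r \<Longrightarrow> r < u \<Longrightarrow> c r = c s"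
proof -
  let ?A = "{r. s \<le> r \<and> r \<le> t \<and> c r \<noteq> c s}"
  define u where "u = Inf ?A"
  have ne: "?A \<noteq> {}" using st by auto
  have bdd: "bdd_below ?A" by (auto intro!: bdd_belowI[of _ s])
  have su: "s \<le> u" unfolding u_def using ne by (intro cInf_greatest) auto
  have ut: "u \<le> t" unfolding u_def using st bdd by (intro cInf_lower) auto
  have before: "c r = c s" if "s \<le> r" "r < u" for r
  proof (rule ccontr)
    assume "c r \<noteq> c s"
    then have "u \<le> r" unfolding u_def using that(1) \<open>r < u\<close> ut bdd by (intro cInf_lower) auto
    then show False using that by simp
  qed
  have cu: "c u \<noteq> c s"
  proof
    assume eq: "c u = c s"
    have "0 \<le> u" using su st by simp
    then obtain e where e: "e > 0" "\<And>r. u \<le> r \<Longrightarrow> r \<le> u + e \<Longrightarrow> c r = c u"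
      using counting_path_locally_constant_right[OF c] by metis
    have "u + e \<le> Inf ?A"
    proof (rule cInf_greatest[OF ne])
      fix r assume r: "r \<in> ?A"
      then have "u \<le> r" unfolding u_def using bdd by (intro cInf_lower) auto
      moreover have "c r \<noteq> c u" using r eq by simp
      ultimately show "u + e \<le> r" using e(2)[of r] by linarith
    qed
    then show False using e(1) by (simp add: u_def)
  qed
  then have su': "s < u" using su by (cases "s = u") auto
  have "\<not> continuous (at_left u) c"
  proof
    assume "continuous (at_left u) c"
    then have "eventually (\<lambda>r. c r = c u) (at_left u)"
      by (simp add: continuous_within tendsto_discrete)
    then obtain a where a: "a < u" "\<And>r. a < r \<Longrightarrow> r < u \<Longrightarrow> c r = c u"
      unfolding eventually_at_left_field by metis
    have "max a s < u" using a(1) su' by simp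
    then obtain r where "max a s < r" "r < u" using dense by blast
    then have "c r = c u" "c r = c s" using a(2)[of r] before[of r] by simp_all
    then show False using cu by simp
  qed
  then have "jump_time c u" using su' st by (simp add: jump_time_def)
  then show thesis using that su' ut before by blast
qed

text \<open>The time since the last jump before \<open>t\<close>, or \<open>t\<close> itself if there was none. Restricting the
  supremum to rational arguments makes it a measurable function of the path.\<close>

definition age :: "(real \<Rightarrow> 'b) \<Rightarrow> real \<Rightarrow> real" where
  "age c t = (SUP q\<in>{q \<in> \<rat>. 0 \<le> q \<and> q \<le> t}. if c (t - q) = c t then q else 0)"

lemma age_bdd: "bdd_above ((\<lambda>q. if c (t - q) = c t then q else 0) ` {q \<in> \<rat>. 0 \<le> q \<and> q \<le> (t::real)})"
  by (intro bdd_aboveI2[of _ _ "\<bar>t\<bar>"]) auto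

lemma age_nonneg: "0 \<le> t \<Longrightarrow> 0 \<le> age c t"
  unfolding age_def by (rule cSUP_upper2[OF age_bdd, of 0]) auto

lemma age_leI:
  assumes "0 \<le> t" "0 \<le> B" "\<And>r. 0 \<le> r \<Longrightarrow> r \<le> t \<Longrightarrow> c r = c t \<Longrightarrow> t - r \<le> B"
  shows "age c t \<le> B"
  unfolding age_def
proof (rule cSUP_least)
  show "{q \<in> \<rat>. 0 \<le> q \<and> q \<le> t} \<noteq> {}" using assms(1) by (auto intro!: exI[of _ 0])
  show "(if c (t - q) = c t then q else 0) \<le> B" if "q \<in> {q \<in> \<rat>. 0 \<le> q \<and> q \<le> t}" for q
    using assms(2) assms(3)[of "t - q"] that by auto
qed

lemma age_le: "0 \<le> t \<Longrightarrow> age c t \<le> t"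
  by (rule age_leI) auto

lemma age_geI:
  assumes c: "counting_path c" and r: "0 \<le> r" "r \<le> t" "c r = c t"
  shows "t - r \<le> age c t"
proof (rule ccontr)
  assume "\<not> t - r \<le> age c t"
  then obtain q where q: "q \<in> \<rat>" "age c t < q" "q < t - r"
    using Rats_dense_in_real[of "age c t" "t - r"] by auto
  have q0: "0 \<le> q" using age_nonneg[of t c] q r by linarith
  have "c r \<le> c (t - q)" "c (t - q) \<le> c t"
    by (rule counting_path_mono[OF c]; use q q0 r in linarith)+
  then have "c (t - q) = c t" using r by simp
  then have "q \<le> age c t"
    unfolding age_def by (intro cSUP_upper2[OF age_bdd, of q]) (use q q0 r \<open>c (t - q) = c t\<close> in auto)
  then show False using q by simp
qed

text \<open>Between two times with the same count, the same jump is the last one, so that the age grows at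
  unit speed.\<close>

lemma age_shift:
  assumes c: "counting_path c" and ab: "0 \<le> a" "a \<le> b" "c a = c b"
  shows "age c b = age c a + (b - a)"
proof (rule antisym)
  show "age c b \<le> age c a + (b - a)"
  proof (rule age_leI)
    fix r assume r: "0 \<le> r" "r \<le> b" "c r = c b"
    show "b - r \<le> age c a + (b - a)"
      using age_geI[OF c r(1), of a] age_nonneg[OF ab(1), of c] r ab by (cases "r \<le> a") auto
  qed (use ab age_nonneg[OF ab(1), of c] in auto)
  have "age c a \<le> age c b - (b - a)"
  proof (rule age_leI[OF ab(1)])
    show "0 \<le> age c b - (b - a)" using age_geI[OF c ab] by simp
    show "a - r \<le> age c b - (b - a)" if "0 \<le> r" "r \<le> a" "c r = c a" for r
      using age_geI[OF c, of r b] that ab by auto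
  qed
  then show "age c a + (b - a) \<le> age c b" by simp
qed

lemma age_after_jump:
  assumes c: "counting_path c" and ab: "0 \<le> a" "a \<le> b" "c a \<noteq> c b"
  shows "age c b \<le> b - a"
proof (rule age_leI)
  fix r assume r: "0 \<le> r" "r \<le> b" "c r = c b"
  show "b - r \<le> b - a"
    using counting_path_mono[OF c r(1), of a] counting_path_mono[OF c ab(1,2)] r ab
    by (cases "r \<le> a") auto
qed (use ab in auto)

text \<open>The mass at a vertex in the limit \<open>k \<rightarrow> \<infinity>\<close>: it grows at unit speed and is reset to zero at
  the jumps of the clock \<open>c\<close>.\<close>

definition renewal_path :: "real \<Rightarrow> (real \<Rightarrow> 'b) \<Rightarrow> real \<Rightarrow> real" where
  "renewal_path m c t = (if c t = c 0 then m else 0) + age c t"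

lemma renewal_path_shift:
  assumes c: "counting_path c" and ab: "0 \<le> a" "a \<le> b" "c a = c b"
  shows "renewal_path m c b = renewal_path m c a + (b - a)"
  using age_shift[OF assms] ab by (simp add: renewal_path_def)

lemma renewal_path_after_jump:
  assumes c: "counting_path c" and ab: "0 \<le> a" "a \<le> b" "c a \<noteq> c b"
  shows "0 \<le> renewal_path m c b" "renewal_path m c b \<le> b - a"
proof -
  have "c b \<noteq> c 0"
    using counting_path_mono[OF c _ ab(1)] counting_path_mono[OF c ab(1,2)] ab(3) by force
  then show "0 \<le> renewal_path m c b" "renewal_path m c b \<le> b - a"
    using age_after_jump[OF assms] age_nonneg[of b c] ab by (auto simp: renewal_path_def)
qed

lemma renewal_path_0: "renewal_path m c 0 = m"
  using age_nonneg[of 0 c] age_le[of 0 c] by (simp add: renewal_path_def)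

lemma renewal_path_start: "\<bar>renewal_path m c t - renewal_path m' c t\<bar> \<le> \<bar>m - m'\<bar>"
  by (simp add: renewal_path_def)

section \<open>Paths of the meteor process\<close>

definition meteor_jump :: "nat \<Rightarrow> nat \<Rightarrow> (nat \<Rightarrow> real) \<Rightarrow> nat \<Rightarrow> real" where
  "meteor_jump k j m x =
    (if j = 0 then m x else if x = j then 0 else m x + m j / (real k - 1))"

text \<open>The properties that almost all sample paths of clocks and masses have in common. Everything
  below that concerns a single sample point is deduced from them.\<close>

definition meteor_path :: "nat \<Rightarrow> (nat \<Rightarrow> real \<Rightarrow> nat) \<Rightarrow> (nat \<Rightarrow> real \<Rightarrow> real) \<Rightarrow> bool" where
  "meteor_path k c m \<longleftrightarrow> (\<forall>j\<in>{1..k}. counting_path (c j)) \<and>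
      (\<forall>j\<in>{1..k}. \<forall>t. jump_time (c j) t \<longrightarrow>
         (\<exists>l. (\<forall>x\<in>{1..k}. (m x \<longlongrightarrow> l x) (at_left t)) \<and>
              m j t = 0 \<and> (\<forall>x\<in>{1..k} - {j}. m x t = l x + l j / (real k - 1)))) \<and>
      (\<forall>s t. 0 \<le> s \<and> s < t \<and> (\<forall>j\<in>{1..k}. \<forall>u\<in>{s<..t}. \<not> jump_time (c j) u) \<longrightarrow>
         (\<forall>x\<in>{1..k}. m x t = m x s))"

lemma meteor_path_counting: "meteor_path k c m \<Longrightarrow> j \<in> {1..k} \<Longrightarrow> counting_path (c j)"
  by (simp add: meteor_path_def)

lemma meteor_path_constant:
  assumes mp: "meteor_path k c m" and st: "0 \<le> s" "s \<le> t"
    and eq: "\<And>j. j \<in> {1..k} \<Longrightarrow> c j s = c j t" and x: "x \<in> {1..k}"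
  shows "m x t = m x s"
proof (cases "s = t")
  case False
  then have "s < t" using st by simp
  moreover have "\<forall>j\<in>{1..k}. \<forall>u\<in>{s<..t}. \<not> jump_time (c j) u"
    using counting_path_no_jump[OF meteor_path_counting[OF mp] st(1) eq] by auto
  ultimately show ?thesis using mp st x unfolding meteor_path_def by blast
qed simp

text \<open>Nothing happens before the only jump time \<open>u\<close> in the interval and nothing after it, so that
  the left limits at \<open>u\<close> are the masses at the beginning and the masses at \<open>u\<close> are those at the end.\<close>

lemma meteor_path_single_jump:
  assumes mp: "meteor_path k c m" and st: "0 \<le> s" "s < t" and j: "j \<in> {1..k}"
    and cj: "c j t = Suc (c j s)"
    and eq: "\<And>i. i \<in> {1..k} \<Longrightarrow> i \<noteq> j \<Longrightarrow> c i s = c i t" and x: "x \<in> {1..k}"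
  shows "m x t = meteor_jump k j (\<lambda>x. m x s) x"
proof -
  have cp: "counting_path (c i)" if "i \<in> {1..k}" for i using meteor_path_counting[OF mp that] .
  obtain u where u: "s < u" "u \<le> t" "jump_time (c j) u" "\<And>r. s \<le> r \<Longrightarrow> r < u \<Longrightarrow> c j r = c j s"
    using counting_path_jump_exists[OF cp[OF j] st] cj by (metis n_not_Suc_n)
  have other: "c i r = c i s" if "i \<in> {1..k}" "i \<noteq> j" "s \<le> r" "r \<le> t" for i r
    using counting_path_mono[OF cp[OF that(1)], of s r] counting_path_mono[OF cp[OF that(1)], of r t]
      eq[OF that(1,2)] that st by auto
  have cju: "c j u = c j t"
  proof -
    have "c j s < c j u" using counting_path_jump[OF cp[OF j] u(3) st(1) u(1)] .
    moreover have "c j u \<le> c j t" using counting_path_mono[OF cp[OF j], of u t] u st by simp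
    ultimately show ?thesis using cj by simp
  qed
  have before: "m y r = m y s" if "y \<in> {1..k}" "s \<le> r" "r < u" for y r
  proof (rule meteor_path_constant[OF mp st(1) that(2) _ that(1)])
    show "c i s = c i r" if i: "i \<in> {1..k}" for i
      using other[OF i, of r] u(4)[of r] \<open>s \<le> r\<close> \<open>r < u\<close> u(2) by (cases "i = j") auto
  qed
  have after: "m y t = m y u" if "y \<in> {1..k}" for y
  proof (rule meteor_path_constant[OF mp _ u(2) _ that])
    show "c i u = c i t" if i: "i \<in> {1..k}" for i
      using other[OF i, of u] eq[OF i] u(1,2) cju by (cases "i = j") auto
  qed (use u(1) st in auto)
  obtain l where l: "\<forall>x\<in>{1..k}. (m x \<longlongrightarrow> l x) (at_left u)"
      "m j u = 0" "\<forall>x\<in>{1..k} - {j}. m x u = l x + l j / (real k - 1)"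
    using mp j u(3) unfolding meteor_path_def by blast
  have ll: "l y = m y s" if y: "y \<in> {1..k}" for y
  proof -
    have "eventually (\<lambda>r. m y r = m y s) (at_left u)"
      unfolding eventually_at_left_field using before[OF y] u(1) by (meson order_less_imp_le)
    then have "(m y \<longlongrightarrow> m y s) (at_left u)" by (rule tendsto_eventually)
    moreover have "(m y \<longlongrightarrow> l y) (at_left u)" using l(1) y by blast
    ultimately show ?thesis by (intro tendsto_unique[of "at_left u"]) auto
  qed
  show ?thesis
  proof (cases "x = j")
    case True
    then show ?thesis using after[OF x] l(2) j by (simp add: meteor_jump_def)
  next
    case False
    then have "m x u = l x + l j / (real k - 1)" using l(3) x by blast
    then show ?thesis using after[OF x] ll[OF x] ll[OF j] j False by (simp add: meteor_jump_def)
  qed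
qed

text \<open>Each clock is constant on some interval to the right and on some interval to the left of a given
  time. As there are finitely many clocks, so are all masses.\<close>

lemma meteor_path_cadlag:
  assumes mp: "meteor_path k c m" and x: "x \<in> {1..k}"
  shows "restrict (m x) {0..} \<in> cadlag"
proof -
  have cp: "counting_path (c i)" if "i \<in> {1..k}" for i using meteor_path_counting[OF mp that] .
  have right: "continuous (at_right t) (restrict (m x) {0..})" if t: "0 \<le> t" for t
  proof -
    have "\<forall>i\<in>{1..k}. eventually (\<lambda>s. c i t = c i s) (at_right t)"
    proof
      fix i assume "i \<in> {1..k}"
      then obtain e where e: "e > 0" "\<And>s. t \<le> s \<Longrightarrow> s \<le> t + e \<Longrightarrow> c i s = c i t"
        using counting_path_locally_constant_right[OF cp t] by metis
      have "c i t = c i s" if "t < s" "s < t + e" for s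
        using e(2)[of s] that by simp
      then show "eventually (\<lambda>s. c i t = c i s) (at_right t)"
        unfolding eventually_at_right_field using e(1) by (metis less_add_same_cancel1)
    qed
    then have "eventually (\<lambda>s. \<forall>i\<in>{1..k}. c i t = c i s) (at_right t)"
      by (simp add: eventually_ball_finite)
    moreover have "eventually (\<lambda>s. s > t) (at_right t)" by (rule eventually_at_right_less)
    ultimately have "eventually (\<lambda>s. restrict (m x) {0..} s = restrict (m x) {0..} t) (at_right t)"
    proof eventually_elim
      case (elim s)
      then show ?case using meteor_path_constant[OF mp t _ _ x, of s] t by auto
    qed
    then show ?thesis
      unfolding continuous_within by (rule tendsto_eventually)
  qed
  have left: "\<exists>l. (restrict (m x) {0..} \<longlongrightarrow> l) (at_left t)" if t: "0 < t" for t
  proof -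
    have "\<forall>i\<in>{1..k}. \<exists>a. 0 \<le> a \<and> a < t \<and> (\<forall>s. a \<le> s \<and> s < t \<longrightarrow> c i s = c i a)"
    proof
      fix i assume i: "i \<in> {1..k}"
      show "\<exists>a. 0 \<le> a \<and> a < t \<and> (\<forall>s. a \<le> s \<and> s < t \<longrightarrow> c i s = c i a)"
        by (rule counting_path_locally_constant_left[OF cp[OF i] t]) blast
    qed
    from bchoice[OF this] obtain a where
      a: "\<And>i. i \<in> {1..k} \<Longrightarrow> 0 \<le> a i \<and> a i < t \<and> (\<forall>s. a i \<le> s \<and> s < t \<longrightarrow> c i s = c i (a i))"
      by blast
    define b where "b = Max (a ` {1..k})"
    have ne: "{1..k} \<noteq> {}" using x by auto
    have b: "0 \<le> b" "b < t" "\<And>i. i \<in> {1..k} \<Longrightarrow> a i \<le> b"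
    proof -
      have "b \<in> a ` {1..k}" unfolding b_def using ne by (intro Max_in) auto
      then show "0 \<le> b" "b < t" using a by auto
      show "a i \<le> b" if "i \<in> {1..k}" for i unfolding b_def using that by (intro Max_ge) auto
    qed
    have "restrict (m x) {0..} s = m x b" if "b < s" "s < t" for s
    proof -
      have "m x s = m x b"
      proof (rule meteor_path_constant[OF mp b(1) _ _ x])
        show "c i b = c i s" if i: "i \<in> {1..k}" for i
        proof -
          have w: "\<forall>s. a i \<le> s \<and> s < t \<longrightarrow> c i s = c i (a i)" using a[OF i] by blast
          have "c i b = c i (a i)" "c i s = c i (a i)"
            using w[rule_format, of b] w[rule_format, of s] b(2) b(3)[OF i] \<open>b < s\<close> \<open>s < t\<close>
            by linarith+
          then show ?thesis by simp
        qed
      qed (use \<open>b < s\<close> in simp)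
      then show ?thesis using \<open>b < s\<close> b(1) by simp
    qed
    then have "eventually (\<lambda>s. restrict (m x) {0..} s = m x b) (at_left t)"
      unfolding eventually_at_left_field using b(2) by blast
    then show ?thesis using tendsto_eventually by blast
  qed
  show ?thesis using right left by (simp add: cadlag_def)
qed

section \<open>Time changes and sawtooth paths\<close>

text \<open>The piecewise linear map through the nodes \<open>(\<theta> n, \<sigma> n)\<close>, \<open>n \<le> N\<close>, continued with slope one.
  Its largest distance to the identity is attained at a node. The slope one behind the last node bounds
  this distance on the whole half-line, as Skorokhod convergence requires, and is what makes the
  induction on the number of nodes work.\<close>

lemma time_change_exists:
  fixes \<theta> \<sigma> :: "nat \<Rightarrow> real"
  assumes \<theta>: "\<theta> 0 = 0" "strict_mono \<theta>" and \<sigma>: "\<sigma> 0 = 0" "strict_mono \<sigma>"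
    and close: "\<And>n. n \<le> N \<Longrightarrow> \<bar>\<sigma> n - \<theta> n\<bar> \<le> e"
  shows "\<exists>\<tau>. strict_mono_on {0..} \<tau> \<and> bij_betw \<tau> {0..} {0..} \<and>
    (\<forall>n\<le>N. \<tau> (\<theta> n) = \<sigma> n) \<and> (\<forall>t\<ge>\<theta> N. \<tau> t = \<sigma> N + (t - \<theta> N)) \<and>
    (\<forall>t\<ge>0. \<bar>\<tau> t - t\<bar> \<le> e)"
  using close
proof (induction N)
  case 0
  have "0 \<le> e" using 0[of 0] by simp
  then show ?case
    by (intro exI[of _ "\<lambda>t. t"])
      (use \<theta> \<sigma> in \<open>auto simp: strict_mono_on_def bij_betw_def\<close>)
next
  case (Suc N)
  then obtain \<tau> where mono: "strict_mono_on {0..} \<tau>" and bij: "bij_betw \<tau> {0..} {0..}"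
    and node: "\<And>n. n \<le> N \<Longrightarrow> \<tau> (\<theta> n) = \<sigma> n" and dist: "\<And>t. t \<ge> 0 \<Longrightarrow> \<bar>\<tau> t - t\<bar> \<le> e"
    by fastforce
  have \<theta>less: "\<theta> N < \<theta> (Suc N)" and \<sigma>less: "\<sigma> N < \<sigma> (Suc N)"
    using \<theta> \<sigma> by (simp_all add: strict_mono_Suc_iff)
  have nonneg: "0 \<le> \<theta> N" "0 \<le> \<sigma> N"
    using \<theta> \<sigma> strict_mono_mono monoD[of \<theta> 0 N] monoD[of \<sigma> 0 N] by auto
  define r where "r = (\<sigma> (Suc N) - \<sigma> N) / (\<theta> (Suc N) - \<theta> N)"
  have r: "r > 0" using \<theta>less \<sigma>less by (simp add: r_def)
  have rN: "\<sigma> N + (\<theta> (Suc N) - \<theta> N) * r = \<sigma> (Suc N)" using \<theta>less by (simp add: r_def)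
  define \<tau>' where "\<tau>' t = (if t \<le> \<theta> N then \<tau> t else if t \<le> \<theta> (Suc N) then \<sigma> N + (t - \<theta> N) * r
      else \<sigma> (Suc N) + (t - \<theta> (Suc N)))" for t
  have low: "\<tau> t \<le> \<sigma> N" if "0 \<le> t" "t \<le> \<theta> N" for t
    using mono_onD[OF strict_mono_on_imp_mono_on[OF mono], of t "\<theta> N"] node[of N] that nonneg by auto
  have mid: "\<sigma> N < \<sigma> N + (t - \<theta> N) * r" if "\<theta> N < t" for t using that r by simp
  have mid2: "\<sigma> N + (t - \<theta> N) * r \<le> \<sigma> (Suc N)" if "t \<le> \<theta> (Suc N)" for t
  proof -
    have "(t - \<theta> N) * r \<le> (\<theta> (Suc N) - \<theta> N) * r"
      using that r by (intro mult_right_mono) auto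
    then show ?thesis using rN by linarith
  qed
  have mono': "strict_mono_on {0..} \<tau>'"
  proof (rule strict_mono_onI)
    fix s t :: real assume st: "s \<in> {0..}" "t \<in> {0..}" "s < t"
    consider "t \<le> \<theta> N" | "s \<le> \<theta> N" "\<theta> N < t" "t \<le> \<theta> (Suc N)" | "\<theta> N < s" "t \<le> \<theta> (Suc N)"
      | "s \<le> \<theta> N" "\<theta> (Suc N) < t" | "\<theta> N < s" "s \<le> \<theta> (Suc N)" "\<theta> (Suc N) < t" | "\<theta> (Suc N) < s"
      using st by linarith
    then show "\<tau>' s < \<tau>' t"
    proof cases
      case 1 then show ?thesis using strict_mono_onD[OF mono, of s t] st by (simp add: \<tau>'_def)
    next
      case 2 then show ?thesis using low[of s] mid[of t] st by (simp add: \<tau>'_def)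
    next
      case 3 then show ?thesis using st r by (simp add: \<tau>'_def)
    next
      case 4 then show ?thesis using low[of s] st \<sigma>less \<theta>less by (simp add: \<tau>'_def)
    next
      case 5 then show ?thesis using mid2[of s] st \<sigma>less \<theta>less by (simp add: \<tau>'_def)
    next
      case 6 then show ?thesis using st \<theta>less by (simp add: \<tau>'_def)
    qed
  qed
  have "\<tau>' ` {0..} = {0..}"
  proof (intro equalityI subsetI)
    fix y assume "y \<in> \<tau>' ` {0..}"
    then obtain t where t: "t \<ge> 0" "y = \<tau>' t" by auto
    have "\<tau>' 0 = 0"
      using node[of 0] \<theta> \<sigma> nonneg by (simp add: \<tau>'_def)
    then show "y \<in> {0..}" using mono_onD[OF strict_mono_on_imp_mono_on[OF mono'], of 0 t] t by simp
  next
    fix y :: real assume y: "y \<in> {0..}"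
    consider "y \<le> \<sigma> N" | "\<sigma> N < y" "y \<le> \<sigma> (Suc N)" | "\<sigma> (Suc N) < y" by linarith
    then show "y \<in> \<tau>' ` {0..}"
    proof cases
      case 1
      have "y \<in> \<tau> ` {0..}" using bij y by (simp add: bij_betw_def)
      then obtain t where t: "t \<ge> 0" "\<tau> t = y" by auto
      have "t \<le> \<theta> N"
        using strict_mono_onD[OF mono, of "\<theta> N" t] node[of N] nonneg t 1 by force
      then show ?thesis using t by (intro image_eqI[of _ _ t]) (auto simp: \<tau>'_def)
    next
      case 2
      let ?t = "\<theta> N + (y - \<sigma> N) / r"
      have "(y - \<sigma> N) / r \<le> \<theta> (Suc N) - \<theta> N"
        using 2 r rN by (simp add: pos_divide_le_eq)
      moreover have "(y - \<sigma> N) / r > 0" using 2 r by simp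
      ultimately show ?thesis using nonneg r
        by (intro image_eqI[of _ _ ?t]) (auto simp: \<tau>'_def)
    next
      case 3
      then show ?thesis using nonneg \<theta>less
        by (intro image_eqI[of _ _ "\<theta> (Suc N) + (y - \<sigma> (Suc N))"]) (auto simp: \<tau>'_def)
    qed
  qed
  then have bij': "bij_betw \<tau>' {0..} {0..}"
    using strict_mono_on_imp_inj_on[OF mono'] by (simp add: bij_betw_def)
  have node': "\<tau>' (\<theta> n) = \<sigma> n" if "n \<le> Suc N" for n
  proof (cases "n = Suc N")
    case True
    then show ?thesis using \<theta>less rN by (simp add: \<tau>'_def)
  next
    case False
    then have "\<theta> n \<le> \<theta> N" "n \<le> N"
      using that \<theta>(2) by (simp_all add: strict_mono_less_eq)
    then show ?thesis using node[of n] by (simp add: \<tau>'_def)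
  qed
  have last': "\<tau>' t = \<sigma> (Suc N) + (t - \<theta> (Suc N))" if "t \<ge> \<theta> (Suc N)" for t
    using that \<theta>less rN by (cases "t = \<theta> (Suc N)") (auto simp: \<tau>'_def)
  have dist': "\<bar>\<tau>' t - t\<bar> \<le> e" if t: "t \<ge> 0" for t
  proof -
    consider "t \<le> \<theta> N" | "\<theta> N < t" "t \<le> \<theta> (Suc N)" | "\<theta> (Suc N) < t" by linarith
    then show ?thesis
    proof cases
      case 1 then show ?thesis using dist[OF t] by (simp add: \<tau>'_def)
    next
      case 3 then show ?thesis using Suc.prems[of "Suc N"] \<theta>less by (simp add: \<tau>'_def)
    next
      case 2
      \<comment> \<open>The deviation from the identity on a linear piece is a convex combination of those at its ends.\<close>
      define l where "l = (t - \<theta> N) / (\<theta> (Suc N) - \<theta> N)"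
      have l: "0 \<le> l" "l \<le> 1" using 2 \<theta>less by (auto simp: l_def field_simps)
      have tl: "t = \<theta> N + l * (\<theta> (Suc N) - \<theta> N)" using \<theta>less by (simp add: l_def)
      have "\<tau>' t = \<sigma> N + l * (\<sigma> (Suc N) - \<sigma> N)"
        using 2 by (simp add: \<tau>'_def l_def r_def)
      then have "\<tau>' t - t = \<sigma> N + l * (\<sigma> (Suc N) - \<sigma> N) - (\<theta> N + l * (\<theta> (Suc N) - \<theta> N))"
        using tl by linarith
      also have "\<dots> = (1 - l) * (\<sigma> N - \<theta> N) + l * (\<sigma> (Suc N) - \<theta> (Suc N))"
        by (simp add: algebra_simps)
      finally have "\<bar>\<tau>' t - t\<bar> \<le> \<bar>(1 - l) * (\<sigma> N - \<theta> N)\<bar> + \<bar>l * (\<sigma> (Suc N) - \<theta> (Suc N))\<bar>"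
        by (metis abs_triangle_ineq)
      also have "\<dots> = (1 - l) * \<bar>\<sigma> N - \<theta> N\<bar> + l * \<bar>\<sigma> (Suc N) - \<theta> (Suc N)\<bar>"
        using l by (simp add: abs_mult)
      also have "\<dots> \<le> (1 - l) * e + l * e"
        using Suc.prems[of N] Suc.prems[of "Suc N"] l by (intro add_mono mult_left_mono) auto
      finally show ?thesis by (simp add: algebra_simps)
    qed
  qed
  show ?case using mono' bij' node' last' dist' by blast
qed

text \<open>The renewal path as a function of the start value and the sequence of jump times, where
  \<open>\<theta> 0 = 0\<close> stands for the start. Compactness arguments are carried out on these data.\<close>

definition sawtooth :: "real \<Rightarrow> (nat \<Rightarrow> real) \<Rightarrow> real \<Rightarrow> real" where
  "sawtooth m \<theta> t =
    (let n = (GREATEST n. \<theta> n \<le> t) in (if n = 0 then m else 0) + (t - \<theta> n))"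

lemma sawtooth_eq:
  assumes "strict_mono \<theta>" "\<theta> n \<le> t" "t < \<theta> (Suc n)"
  shows "sawtooth m \<theta> t = (if n = 0 then m else 0) + (t - \<theta> n)"
proof -
  have "(GREATEST n. \<theta> n \<le> t) = n"
  proof (rule Greatest_equality)
    show "\<theta> n \<le> t" by fact
    fix i assume "\<theta> i \<le> t"
    then have "\<theta> i < \<theta> (Suc n)" using assms(3) by simp
    then show "i \<le> n" using assms(1) by (simp add: strict_mono_less)
  qed
  then show ?thesis by (simp add: sawtooth_def)
qed

lemma interval_of_time:
  fixes \<theta> :: "nat \<Rightarrow> real"
  assumes "\<theta> 0 = 0" "\<And>T. \<exists>n. T < \<theta> n" "0 \<le> t"
  obtains n where "\<theta> n \<le> t" "t < \<theta> (Suc n)"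
proof -
  define n where "n = (LEAST n. t < \<theta> n)"
  have n: "t < \<theta> n" unfolding n_def using assms(2) by (rule LeastI_ex)
  then have "n \<noteq> 0" using assms by (intro notI) simp
  then obtain i where i: "n = Suc i" using not0_implies_Suc by blast
  have "\<not> t < \<theta> i" using not_less_Least[of i "\<lambda>n. t < \<theta> n"] i n_def by simp
  then show thesis using that[of i] n i by simp
qed

lemma sawtooth_cadlag:
  assumes \<theta>: "\<theta> 0 = 0" "strict_mono \<theta>" "\<And>T. \<exists>n. T < \<theta> n"
  shows "restrict (sawtooth m \<theta>) {0..} \<in> cadlag"
proof -
  let ?x = "restrict (sawtooth m \<theta>) {0..}"
  have nonneg: "0 \<le> \<theta> n" for n
    using \<theta>(1) monoD[OF strict_mono_mono[OF \<theta>(2)], of 0 n] by simp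
  have right: "continuous (at_right t) ?x" if t: "0 \<le> t" for t
  proof -
    obtain n where n: "\<theta> n \<le> t" "t < \<theta> (Suc n)" using interval_of_time[OF \<theta>(1,3) t] .
    let ?f = "\<lambda>s. (if n = 0 then m else 0) + (s - \<theta> n)"
    have lim: "(?f \<longlongrightarrow> ?f t) (at_right t)" by (intro tendsto_intros)
    have eq: "?x s = ?f s" if "t \<le> s" "s < \<theta> (Suc n)" for s
      using sawtooth_eq[OF \<theta>(2), of n s m] that n t by simp
    have "eventually (\<lambda>s. ?f s = ?x s) (at_right t)"
      unfolding eventually_at_right_field using n(2) eq by (metis order_less_imp_le)
    then have "(?x \<longlongrightarrow> ?f t) (at_right t)"
      using lim by (rule Lim_transform_eventually[rotated])
    then show ?thesis using eq[of t] n by (simp add: continuous_within)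
  qed
  have left: "\<exists>l. (?x \<longlongrightarrow> l) (at_left t)" if t: "0 < t" for t
  proof -
    have "\<exists>n. \<theta> n < t \<and> t \<le> \<theta> (Suc n)"
    proof -
      obtain n where n: "\<theta> n \<le> t" "t < \<theta> (Suc n)" using interval_of_time[OF \<theta>(1,3), of t] t by auto
      show ?thesis
      proof (cases "\<theta> n = t")
        case True
        then have "n \<noteq> 0" using t \<theta>(1) by (intro notI) simp
        then obtain i where "n = Suc i" using not0_implies_Suc by blast
        then show ?thesis using True \<theta>(2) by (intro exI[of _ i]) (auto simp: strict_mono_Suc_iff)
      next
        case False
        then show ?thesis using n by (intro exI[of _ n]) auto
      qed
    qed
    then obtain n where n: "\<theta> n < t" "t \<le> \<theta> (Suc n)" by blast
    let ?f = "\<lambda>s. (if n = 0 then m else 0) + (s - \<theta> n)"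
    have lim: "(?f \<longlongrightarrow> ?f t) (at_left t)" by (intro tendsto_intros)
    have eq: "?x s = ?f s" if "\<theta> n < s" "s < t" for s
      using sawtooth_eq[OF \<theta>(2), of n s m] that n nonneg[of n] by simp
    have "eventually (\<lambda>s. ?f s = ?x s) (at_left t)"
      unfolding eventually_at_left_field using n(1) eq by metis
    then have "(?x \<longlongrightarrow> ?f t) (at_left t)"
      using lim by (rule Lim_transform_eventually[rotated])
    then show ?thesis by blast
  qed
  show ?thesis using right left by (simp add: cadlag_def)
qed

text \<open>Convergence of the jump times, with the corresponding start values, gives convergence of
  sawtooth paths: the time change carries the first \<open>i\<close> jump times of the limit to those of the
  \<open>i\<close>-th path, so that both paths have the same number of jumps behind them. The paths \<open>z\<close> allow
  an additional error that vanishes locally uniformly.\<close>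

lemma sawtooth_skorokhod_converges:
  fixes \<theta> :: "nat \<Rightarrow> real" and \<sigma> :: "nat \<Rightarrow> nat \<Rightarrow> real"
  assumes \<theta>: "\<theta> 0 = 0" "strict_mono \<theta>" "\<And>T. \<exists>n. T < \<theta> n"
    and \<sigma>: "\<And>i. \<sigma> i 0 = 0" "\<And>i. strict_mono (\<sigma> i)"
    and close: "\<And>i n. n \<le> i \<Longrightarrow> \<bar>\<sigma> i n - \<theta> n\<bar> \<le> inverse (real (Suc i))"
    and m: "\<And>i. \<bar>m i - \<mu>\<bar> \<le> inverse (real (Suc i))"
    and z: "\<And>i t. 0 \<le> t \<Longrightarrow> t \<le> real i \<Longrightarrow>
      \<bar>z i t - sawtooth (m i) (\<sigma> i) t\<bar> \<le> inverse (real (Suc i))"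
  shows "skorokhod_converges z (restrict (sawtooth \<mu> \<theta>) {0..})"
proof -
  have "\<exists>\<tau>. strict_mono_on {0..} \<tau> \<and> bij_betw \<tau> {0..} {0..} \<and>
    (\<forall>n\<le>i. \<tau> (\<theta> n) = \<sigma> i n) \<and> (\<forall>t\<ge>\<theta> i. \<tau> t = \<sigma> i i + (t - \<theta> i)) \<and>
    (\<forall>t\<ge>0. \<bar>\<tau> t - t\<bar> \<le> inverse (real (Suc i)))" for i
    by (rule time_change_exists[OF \<theta>(1,2) \<sigma>]) (rule close)
  then obtain \<tau> where \<tau>: "\<And>i. strict_mono_on {0..} (\<tau> i)" "\<And>i. bij_betw (\<tau> i) {0..} {0..}"
    "\<And>i n. n \<le> i \<Longrightarrow> \<tau> i (\<theta> n) = \<sigma> i n" "\<And>i t. t \<ge> 0 \<Longrightarrow> \<bar>\<tau> i t - t\<bar> \<le> inverse (real (Suc i))"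
    by metis
  have nonneg: "0 \<le> \<theta> n" for n
    using \<theta>(1) monoD[OF strict_mono_mono[OF \<theta>(2)], of 0 n] by simp
  have small: "\<forall>\<^sub>F i in sequentially. inverse (real (Suc i)) < e" if "e > 0" for e
    using LIMSEQ_inverse_real_of_nat that by (rule order_tendstoD(2))
  have lim_id: "uniform_limit {0..} \<tau> (\<lambda>t. t) sequentially"
  proof (rule uniform_limitI)
    fix e :: real assume "e > 0"
    from small[OF this] show "\<forall>\<^sub>F i in sequentially. \<forall>t\<in>{0..}. dist (\<tau> i t) t < e"
    proof eventually_elim
      case (elim i)
      show ?case using \<tau>(4)[of _ i] elim by (auto simp: dist_real_def intro: le_less_trans)
    qed
  qed
  have lim: "uniform_limit {0..T} (\<lambda>i t. z i (\<tau> i t)) (restrict (sawtooth \<mu> \<theta>) {0..}) sequentially"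
    if T: "T \<ge> 0" for T
  proof (rule uniform_limitI)
    fix e :: real assume e: "e > 0"
    obtain n0 where n0: "T < \<theta> n0" using \<theta>(3) by blast
    obtain i0 :: nat where i0: "T + 1 \<le> real i0" using real_arch_simple by blast
    have "\<forall>\<^sub>F i in sequentially. n0 \<le> i" "\<forall>\<^sub>F i in sequentially. i0 \<le> i"
      by (auto simp: eventually_ge_at_top)
    moreover have "\<forall>\<^sub>F i in sequentially. inverse (real (Suc i)) < e / 4" using small[of "e/4"] e by simp
    ultimately show "\<forall>\<^sub>F i in sequentially.
      \<forall>t\<in>{0..T}. dist (z i (\<tau> i t)) (restrict (sawtooth \<mu> \<theta>) {0..} t) < e"
    proof eventually_elim
      case (elim i)
      show ?case
      proof
        fix t assume "t \<in> {0..T}"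
        then have t: "0 \<le> t" "t \<le> T" by auto
        obtain n where n: "\<theta> n \<le> t" "t < \<theta> (Suc n)" using interval_of_time[OF \<theta>(1,3) t(1)] .
        have "\<theta> n < \<theta> n0" using n t n0 by simp
        then have "n < n0" using \<theta>(2) by (simp add: strict_mono_less)
        then have ni: "Suc n \<le> i" using elim by simp
        have "\<tau> i (\<theta> n) \<le> \<tau> i t"
          using mono_onD[OF strict_mono_on_imp_mono_on[OF \<tau>(1)], of "\<theta> n" t] n t nonneg by simp
        then have lo: "\<sigma> i n \<le> \<tau> i t" using \<tau>(3)[of n i] ni by simp
        have "\<tau> i t < \<tau> i (\<theta> (Suc n))"
          using strict_mono_onD[OF \<tau>(1), of t "\<theta> (Suc n)"] n t nonneg by simp
        then have hi: "\<tau> i t < \<sigma> i (Suc n)" using \<tau>(3)[of "Suc n" i] ni by simp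
        have inv1: "inverse (real (Suc i)) \<le> 1" by (simp add: inverse_le_1_iff)
        have "\<tau> i t \<le> real i" using \<tau>(4)[OF t(1), of i] t i0 elim(2) inv1 by linarith
        moreover have "0 \<le> \<tau> i t" using bij_betwE[OF \<tau>(2)] t by auto
        ultimately have a: "\<bar>z i (\<tau> i t) - sawtooth (m i) (\<sigma> i) (\<tau> i t)\<bar> \<le> inverse (real (Suc i))"
          using z by blast
        have b: "sawtooth (m i) (\<sigma> i) (\<tau> i t) = (if n = 0 then m i else 0) + (\<tau> i t - \<sigma> i n)"
          using sawtooth_eq[OF \<sigma>(2) lo hi] .
        have c: "sawtooth \<mu> \<theta> t = (if n = 0 then \<mu> else 0) + (t - \<theta> n)"
          using sawtooth_eq[OF \<theta>(2) n] .
        have d: "\<bar>\<sigma> i n - \<theta> n\<bar> \<le> inverse (real (Suc i))" using close[of n i] ni by simp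
        have "\<bar>(if n = 0 then m i else 0) - (if n = 0 then \<mu> else 0)\<bar> \<le> inverse (real (Suc i))"
          using m[of i] by simp
        then have "\<bar>z i (\<tau> i t) - sawtooth \<mu> \<theta> t\<bar> < e"
          using a[unfolded b] d \<tau>(4)[OF t(1), of i] elim(3) unfolding c by linarith
        then show "dist (z i (\<tau> i t)) (restrict (sawtooth \<mu> \<theta>) {0..} t) < e"
          using t by (simp add: dist_real_def)
      qed
    qed
  qed
  show ?thesis
    unfolding skorokhod_converges_def using \<tau>(1,2) lim_id lim by blast
qed

section \<open>Compact sets of counting paths\<close>

text \<open>The paths with at most one jump in any two neighbouring cells of a grid on \<open>[0, T]\<close> with
  \<open>q T\<close> cells and none in the first cell, for every \<open>T\<close>, and with at least \<open>n\<close> jumps up to time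
  \<open>b n\<close>. On such a set the jump times range over compact intervals, and neither can two of them
  merge in the limit nor can infinitely many of them accumulate.\<close>

definition tight_paths :: "(nat \<Rightarrow> nat) \<Rightarrow> (nat \<Rightarrow> nat) \<Rightarrow> (real \<Rightarrow> nat) set" where
  "tight_paths b q = {c. counting_path c \<and> (\<forall>n. n \<le> c (real (b n))) \<and>
     (\<forall>T. c (real T / real (q T)) = 0 \<and>
        (\<forall>l<q T. c (real (l + 2) * (real T / real (q T))) \<le> Suc (c (real l * (real T / real (q T))))))}"

definition nth_jump_time :: "(real \<Rightarrow> nat) \<Rightarrow> nat \<Rightarrow> real" where
  "nth_jump_time c n = Inf {t. 0 \<le> t \<and> n \<le> c t}"

lemma nth_jump_time_le_iff:
  assumes c: "counting_path c" and ex: "0 \<le> s" "n \<le> c s" and t: "0 \<le> t"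
  shows "nth_jump_time c n \<le> t \<longleftrightarrow> n \<le> c t"
proof
  let ?A = "{t. 0 \<le> t \<and> n \<le> c t}"
  have ne: "?A \<noteq> {}" using ex by auto
  have bdd: "bdd_below ?A" by (auto intro!: bdd_belowI[of _ 0])
  show "nth_jump_time c n \<le> t" if "n \<le> c t"
    unfolding nth_jump_time_def using that t bdd by (intro cInf_lower) auto
  assume le: "nth_jump_time c n \<le> t"
  obtain e where e: "e > 0" "\<And>s. t \<le> s \<Longrightarrow> s \<le> t + e \<Longrightarrow> c s = c t"
    using counting_path_locally_constant_right[OF c t] by metis
  have "Inf ?A < t + e" using le e(1) by (simp add: nth_jump_time_def)
  then obtain s where s: "s \<in> ?A" "s < t + e" using cInf_lessD[OF ne] by blast
  show "n \<le> c t"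
  proof (cases "s \<le> t")
    case True then show ?thesis using counting_path_mono[OF c, of s t] s by simp
  next
    case False then show ?thesis using e(2)[of s] s by simp
  qed
qed

lemma nth_jump_time_nonneg:
  assumes "0 \<le> s" "n \<le> c s"
  shows "0 \<le> nth_jump_time c n"
  unfolding nth_jump_time_def using assms by (intro cInf_greatest) auto

lemma tight_pathsD:
  assumes "c \<in> tight_paths b q"
  shows "counting_path c" "n \<le> c (real (b n))" "c (real T / real (q T)) = 0"
    "l < q T \<Longrightarrow> c (real (l + 2) * (real T / real (q T))) \<le> Suc (c (real l * (real T / real (q T))))"
  using assms unfolding tight_paths_def by blast+

context
  fixes b q :: "nat \<Rightarrow> nat" and c :: "real \<Rightarrow> nat"
  assumes c: "c \<in> tight_paths b q" and q: "\<And>T. 0 < q T"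
begin

private lemma cp: "counting_path c"
  using tight_pathsD(1)[OF c] .

lemma tight_jump_le_iff: "0 \<le> t \<Longrightarrow> nth_jump_time c n \<le> t \<longleftrightarrow> n \<le> c t"
  by (rule nth_jump_time_le_iff[OF cp _ tight_pathsD(2)[OF c]]) auto

lemma tight_jump_nonneg: "0 \<le> nth_jump_time c n"
  by (rule nth_jump_time_nonneg[of "real (b n)"]) (use tight_pathsD(2)[OF c] in auto)

lemma tight_jump_0: "nth_jump_time c 0 = 0"
  using tight_jump_le_iff[of 0 0] tight_jump_nonneg[of 0] by simp

lemma tight_jump_le: "nth_jump_time c n \<le> real (b n)"
  using tight_jump_le_iff[of "real (b n)" n] tight_pathsD(2)[OF c] by simp

lemma tight_jump_attained: "n \<le> c (nth_jump_time c n)"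
  using tight_jump_le_iff[OF tight_jump_nonneg, of n n] by simp

lemma tight_bound_pos: "0 < b (Suc n)"
proof (rule ccontr)
  assume "\<not> 0 < b (Suc n)"
  then show False using tight_pathsD(2)[OF c, of "Suc n"] counting_path_zero[OF cp] by simp
qed

text \<open>If two successive jumps were closer than one cell, they would lie in two neighbouring cells, or
  the first jump would lie in the first cell.\<close>

lemma tight_jump_gap:
  "nth_jump_time c n + real (b (Suc n)) / real (q (b (Suc n))) \<le> nth_jump_time c (Suc n)"
proof (rule ccontr)
  define T where "T = b (Suc n)"
  define h where "h = real T / real (q T)"
  let ?s = "nth_jump_time c n" and ?t = "nth_jump_time c (Suc n)"
  assume "\<not> ?thesis"
  then have lt: "?t < ?s + h" by (simp add: T_def h_def)
  have h: "h > 0" using q[of T] tight_bound_pos[of n] by (simp add: h_def T_def)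
  have st: "?s \<le> ?t" using tight_jump_le_iff[OF tight_jump_nonneg, of n "Suc n"]
      tight_jump_attained[of "Suc n"] by simp
  show False
  proof (cases "n = 0")
    case True
    then have "?t \<le> h" using lt tight_jump_0 by simp
    then have "Suc n \<le> c h" using tight_jump_le_iff[of h "Suc n"] h by simp
    then show False using tight_pathsD(3)[OF c, of T] by (simp add: h_def)
  next
    case False
    have s0: "0 < ?s"
    proof (rule ccontr)
      assume "\<not> 0 < ?s"
      then have "n \<le> c 0" using tight_jump_le_iff[of 0 n] by simp
      then show False using False counting_path_zero[OF cp] by simp
    qed
    \<comment> \<open>\<open>l\<close> is the cell of the grid, open at the left end, that contains the \<open>n\<close>-th jump.\<close>
    define l where "l = nat (\<lceil>?s / h\<rceil> - 1)"
    have "0 < ?s / h" using s0 h by simp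
    then have l: "real l < ?s / h" "?s / h \<le> real l + 1"
      unfolding l_def by linarith+
    have l1: "real l * h < ?s" and l2: "?s \<le> (real l + 1) * h"
      using l h by (simp_all add: field_simps)
    have "?s \<le> real T" using st tight_jump_le[of "Suc n"] by (simp add: T_def)
    then have "real l * h < real (q T) * h" using l1 q[of T] by (simp add: h_def)
    then have "l < q T" using h by simp
    then have step: "c (real (l + 2) * h) \<le> Suc (c (real l * h))"
      using tight_pathsD(4)[OF c] by (simp add: h_def)
    have "?t \<le> real (l + 2) * h" using lt l2 by (simp add: algebra_simps)
    then have "Suc n \<le> c (real (l + 2) * h)" using tight_jump_le_iff[of "real (l + 2) * h" "Suc n"] h by simp
    moreover have "c (real l * h) < n"
      using tight_jump_le_iff[of "real l * h" n] l1 h by simp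
    ultimately show False using step by simp
  qed
qed

lemma tight_jump_strict_mono: "strict_mono (nth_jump_time c)"
proof (rule strict_mono_Suc_iff[THEN iffD2], rule allI)
  fix n
  have "0 < real (b (Suc n)) / real (q (b (Suc n)))"
    using q[of "b (Suc n)"] tight_bound_pos[of n] by simp
  then show "nth_jump_time c n < nth_jump_time c (Suc n)"
    using tight_jump_gap[of n] by linarith
qed

lemma tight_jump_unbounded:
  assumes "q T < n"
  shows "real T < nth_jump_time c n"
proof -
  define h where "h = real T / real (q T)"
  have h: "0 \<le> h" by (simp add: h_def)
  have "c (real l * h) \<le> l" if "l \<le> q T" for l
    using that
  proof (induction l)
    case 0
    then show ?case using counting_path_zero[OF cp] by simp
  next
    case (Suc l)
    have "c (real (Suc l) * h) \<le> c (real (l + 2) * h)"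
      using h by (intro counting_path_mono[OF cp]) (auto intro!: mult_right_mono)
    also have "\<dots> \<le> Suc (c (real l * h))" using tight_pathsD(4)[OF c, of l T] Suc by (simp add: h_def)
    finally show ?case using Suc by simp
  qed
  from this[of "q T"] have "c (real T) \<le> q T" using q[of T] by (simp add: h_def)
  then have "\<not> n \<le> c (real T)" using assms by simp
  then show ?thesis using tight_jump_le_iff[of "real T" n] by simp
qed

lemma tight_jump_exceeds: "\<exists>n. T < nth_jump_time c n"
proof -
  obtain k :: nat where "T \<le> real k" using real_arch_simple by blast
  then show ?thesis using tight_jump_unbounded[of k "Suc (q k)"] by (intro exI[of _ "Suc (q k)"]) simp
qed

text \<open>At its jump time \<open>\<theta> n\<close>, \<open>n \<ge> 1\<close>, the renewal path is zero, because it is at most \<open>\<theta> n - a\<close> for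
  every earlier time \<open>a\<close>. Until the next jump it grows at unit speed.\<close>

lemma renewal_path_sawtooth:
  assumes t: "0 \<le> t"
  shows "renewal_path m c t = sawtooth m (nth_jump_time c) t"
proof -
  let ?\<theta> = "nth_jump_time c"
  obtain n where n: "?\<theta> n \<le> t" "t < ?\<theta> (Suc n)"
    using interval_of_time[OF tight_jump_0 tight_jump_exceeds t] .
  have cs: "c s = n" if "?\<theta> n \<le> s" "s < ?\<theta> (Suc n)" for s
  proof -
    have "0 \<le> s" using that tight_jump_nonneg[of n] by simp
    then show ?thesis using that tight_jump_le_iff[of s n] tight_jump_le_iff[of s "Suc n"] by simp
  qed
  have "c (?\<theta> n) = c t" using cs[of t] cs[of "?\<theta> n"] n by simp
  then have shift: "renewal_path m c t = renewal_path m c (?\<theta> n) + (t - ?\<theta> n)"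
    by (intro renewal_path_shift[OF cp tight_jump_nonneg n(1)])
  have "renewal_path m c (?\<theta> n) = (if n = 0 then m else 0)"
  proof (cases "n = 0")
    case True then show ?thesis by (simp add: tight_jump_0 renewal_path_0)
  next
    case False
    have c0: "0 < ?\<theta> n"
      using strict_monoD[OF tight_jump_strict_mono, of 0 n] False tight_jump_0 by simp
    have bnd: "0 \<le> renewal_path m c (?\<theta> n) \<and> renewal_path m c (?\<theta> n) \<le> ?\<theta> n - a"
      if a: "0 \<le> a" "a < ?\<theta> n" for a
    proof -
      have "c a < n" using tight_jump_le_iff[OF a(1), of n] a by simp
      then have "c a \<noteq> c (?\<theta> n)" using tight_jump_attained[of n] by simp
      then show ?thesis using renewal_path_after_jump[OF cp a(1), of "?\<theta> n" m] a by simp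
    qed
    have "renewal_path m c (?\<theta> n) \<le> 0"
    proof (rule ccontr)
      assume p: "\<not> ?thesis"
      define x where "x = renewal_path m c (?\<theta> n)"
      have "x \<le> ?\<theta> n" "0 < x" using bnd[of 0] c0 p by (auto simp: x_def)
      then have "x \<le> ?\<theta> n - (?\<theta> n - x / 2)"
        unfolding x_def[symmetric] using bnd[of "?\<theta> n - x / 2"] by (simp add: x_def[symmetric])
      then show False using \<open>0 < x\<close> by simp
    qed
    then show ?thesis using bnd[of 0] c0 False by simp
  qed
  then show ?thesis using shift sawtooth_eq[OF tight_jump_strict_mono n, of m] by simp
qed

lemma renewal_path_restrict_sawtooth:
  "restrict (renewal_path m c) {0..} = restrict (sawtooth m (nth_jump_time c)) {0..}"
  by (rule restrict_ext) (simp add: renewal_path_sawtooth)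

lemma renewal_path_cadlag: "restrict (renewal_path m c) {0..} \<in> cadlag"
  unfolding renewal_path_restrict_sawtooth
  by (rule sawtooth_cadlag[OF tight_jump_0 tight_jump_strict_mono tight_jump_exceeds])

end

text \<open>The closeness of the paths is only required up to time \<open>T\<close>, because Skorokhod convergence compares
  the values of paths on bounded time intervals only.\<close>

definition uniform_modulus ::
    "((real \<Rightarrow> real) \<Rightarrow> real) \<Rightarrow> (real \<Rightarrow> nat) set \<Rightarrow> real \<Rightarrow> real \<Rightarrow> real \<Rightarrow> real \<Rightarrow> bool" where
  "uniform_modulus F C K \<delta> T \<epsilon> \<longleftrightarrow> (\<forall>c\<in>C. \<forall>m\<in>{0..K}. \<forall>y\<in>cadlag.
    (\<forall>t. 0 \<le> t \<and> t \<le> T \<longrightarrow> \<bar>y t - renewal_path m c t\<bar> \<le> \<delta>) \<longrightarrow>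
    \<bar>F y - F (restrict (renewal_path m c) {0..})\<bar> \<le> \<epsilon>)"

text \<open>A test function is continuous, uniformly over the renewal paths driven by a compact set of
  counting paths. The oscillation of a test function need not be measurable, so that compactness
  takes the place of dominated convergence. If uniformity fails, there are renewal paths and ever closer paths at which it differs by
  \<open>\<epsilon>\<close>. Along a subsequence the start values and all jump times converge, hence both sequences of
  paths converge to the same limit.\<close>

lemma test_function_uniformly_continuous:
  assumes F: "skorokhod_test_function F" and q: "\<And>T. 0 < q T" and \<epsilon>: "0 < \<epsilon>"
  shows "\<exists>\<delta>>0. \<exists>T\<ge>0. uniform_modulus F (tight_paths b q) K \<delta> T \<epsilon>"
proof (rule ccontr)
  assume contra: "\<not> ?thesis"
  have "\<exists>c m y. c \<in> tight_paths b q \<and> m \<in> {0..K} \<and> y \<in> cadlag \<and>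
      (\<forall>t. 0 \<le> t \<and> t \<le> real i \<longrightarrow> \<bar>y t - renewal_path m c t\<bar> \<le> inverse (real (Suc i))) \<and>
      \<not> \<bar>F y - F (restrict (renewal_path m c) {0..})\<bar> \<le> \<epsilon>" for i
  proof -
    have "inverse (real (Suc i)) > 0" "real i \<ge> 0" by auto
    then show ?thesis using contra unfolding uniform_modulus_def by blast
  qed
  then obtain c m y where c: "\<And>i. c i \<in> tight_paths b q" and m: "\<And>i. m i \<in> {0..K}"
    and y: "\<And>i. y i \<in> cadlag"
    and yr: "\<And>i t. 0 \<le> t \<Longrightarrow> t \<le> real i \<Longrightarrow> \<bar>y i t - renewal_path (m i) (c i) t\<bar> \<le> inverse (real (Suc i))"
    and far: "\<And>i. \<not> \<bar>F (y i) - F (restrict (renewal_path (m i) (c i)) {0..})\<bar> \<le> \<epsilon>"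
    by metis
  define \<sigma> where "\<sigma> i = nth_jump_time (c i)" for i
  \<comment> \<open>The start value takes the free place of the jump time with index zero. The scaling puts all
    coordinates into the unit interval.\<close>
  define f where "f i n = (if n = 0 then m i / (1 + K) else \<sigma> i n / (1 + real (b n)))" for i n
  have K: "0 \<le> K" using m[of 0] by simp
  have f1: "norm (f i n) \<le> 1" for i n
    using m[of i] K tight_jump_le[OF c q, of i n] tight_jump_nonneg[OF c q, of i n]
    by (auto simp: f_def \<sigma>_def divide_le_eq_1)
  obtain r where r: "strict_mono (r :: nat \<Rightarrow> nat)" "\<And>n. n \<in> UNIV \<Longrightarrow> \<exists>l. (\<lambda>i. f (r i) n) \<longlonglongrightarrow> l"
    by (rule function_convergent_subsequence[of UNIV f 1]) (use f1 in auto)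
  then obtain L where L: "\<And>n. (\<lambda>i. f (r i) n) \<longlonglongrightarrow> L n" by auto metis
  define \<mu> where "\<mu> = L 0 * (1 + K)"
  define \<theta> where "\<theta> n = (if n = 0 then 0 else L n * (1 + real (b n)))" for n
  have lim_m: "(\<lambda>i. m (r i)) \<longlonglongrightarrow> \<mu>"
  proof -
    have "(\<lambda>i. f (r i) 0 * (1 + K)) \<longlonglongrightarrow> \<mu>" unfolding \<mu>_def by (intro tendsto_intros L)
    then show ?thesis using K by (simp add: f_def)
  qed
  have lim_\<sigma>: "(\<lambda>i. \<sigma> (r i) n) \<longlonglongrightarrow> \<theta> n" for n
  proof (cases "n = 0")
    case True
    then show ?thesis using tight_jump_0[OF c q] by (simp add: \<sigma>_def \<theta>_def)
  next
    case False
    have "(\<lambda>i. f (r i) n * (1 + real (b n))) \<longlonglongrightarrow> L n * (1 + real (b n))" by (intro tendsto_intros L)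
    moreover have "1 + real (b n) \<noteq> 0" by linarith
    ultimately show ?thesis using False by (simp add: f_def \<theta>_def)
  qed
  have \<theta>0: "\<theta> 0 = 0" by (simp add: \<theta>_def)
  have \<theta>_mono: "strict_mono \<theta>"
  proof (rule strict_mono_Suc_iff[THEN iffD2], rule allI)
    fix n
    have "\<theta> n + real (b (Suc n)) / real (q (b (Suc n))) \<le> \<theta> (Suc n)"
    proof (rule LIMSEQ_le)
      show "(\<lambda>i. \<sigma> (r i) n + real (b (Suc n)) / real (q (b (Suc n)))) \<longlonglongrightarrow>
          \<theta> n + real (b (Suc n)) / real (q (b (Suc n)))"
        by (intro tendsto_intros lim_\<sigma>)
      show "(\<lambda>i. \<sigma> (r i) (Suc n)) \<longlonglongrightarrow> \<theta> (Suc n)" by (rule lim_\<sigma>)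
      show "\<exists>N. \<forall>i\<ge>N. \<sigma> (r i) n + real (b (Suc n)) / real (q (b (Suc n))) \<le> \<sigma> (r i) (Suc n)"
        using tight_jump_gap[OF c q] by (auto simp: \<sigma>_def)
    qed
    moreover have "0 < real (b (Suc n)) / real (q (b (Suc n)))"
      using q tight_bound_pos[OF c q] by simp
    ultimately show "\<theta> n < \<theta> (Suc n)" by linarith
  qed
  have \<theta>_unb: "\<exists>n. T < \<theta> n" for T
  proof -
    obtain k :: nat where k: "T < real k" using reals_Archimedean2 by blast
    have "real k \<le> \<theta> (Suc (q k))"
    proof (rule LIMSEQ_le_const[OF lim_\<sigma>])
      show "\<exists>N. \<forall>i\<ge>N. real k \<le> \<sigma> (r i) (Suc (q k))"
        using tight_jump_unbounded[OF c q, of k "Suc (q k)"] by (auto simp: \<sigma>_def less_imp_le)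
    qed
    then show ?thesis using k by (intro exI[of _ "Suc (q k)"]) simp
  qed
  have "\<exists>j\<ge>i. \<bar>m (r j) - \<mu>\<bar> \<le> inverse (real (Suc i)) \<and>
      (\<forall>n\<le>i. \<bar>\<sigma> (r j) n - \<theta> n\<bar> \<le> inverse (real (Suc i)))" for i
  proof -
    have e: "inverse (real (Suc i)) > 0" by simp
    have a: "\<forall>\<^sub>F j in sequentially. \<bar>m (r j) - \<mu>\<bar> < inverse (real (Suc i))"
      using tendstoD[OF lim_m e] by (simp add: dist_real_def)
    have "\<forall>n\<in>{..i}. \<forall>\<^sub>F j in sequentially. \<bar>\<sigma> (r j) n - \<theta> n\<bar> < inverse (real (Suc i))"
      using tendstoD[OF lim_\<sigma> e] by (simp add: dist_real_def)
    then have d: "\<forall>\<^sub>F j in sequentially. \<forall>n\<in>{..i}. \<bar>\<sigma> (r j) n - \<theta> n\<bar> < inverse (real (Suc i))"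
      by (simp add: eventually_ball_finite)
    have "\<forall>\<^sub>F j in sequentially. j \<ge> i \<and> \<bar>m (r j) - \<mu>\<bar> < inverse (real (Suc i)) \<and>
        (\<forall>n\<in>{..i}. \<bar>\<sigma> (r j) n - \<theta> n\<bar> < inverse (real (Suc i)))"
      using a d eventually_ge_at_top[of i] by eventually_elim blast
    then obtain j where "j \<ge> i \<and> \<bar>m (r j) - \<mu>\<bar> < inverse (real (Suc i)) \<and>
        (\<forall>n\<in>{..i}. \<bar>\<sigma> (r j) n - \<theta> n\<bar> < inverse (real (Suc i)))"
      using eventually_happens'[OF sequentially_bot] by blast
    then show ?thesis by (intro exI[of _ j]) (auto intro: less_imp_le)
  qed
  then obtain j where j: "\<And>i. j i \<ge> i" "\<And>i. \<bar>m (r (j i)) - \<mu>\<bar> \<le> inverse (real (Suc i))"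
      "\<And>i n. n \<le> i \<Longrightarrow> \<bar>\<sigma> (r (j i)) n - \<theta> n\<bar> \<le> inverse (real (Suc i))"
    by metis
  define p where "p i = r (j i)" for i
  have pi: "i \<le> p i" for i
    using seq_suble[OF r(1), of "j i"] j(1)[of i] unfolding p_def by (rule order_trans[rotated])
  let ?x = "restrict (sawtooth \<mu> \<theta>) {0..}"
  let ?w = "\<lambda>i. restrict (renewal_path (m (p i)) (c (p i))) {0..}"
  have conv: "skorokhod_converges z ?x"
    if z: "\<And>i t. 0 \<le> t \<Longrightarrow> t \<le> real i \<Longrightarrow>
      \<bar>z i t - renewal_path (m (p i)) (c (p i)) t\<bar> \<le> inverse (real (Suc i))" for z
  proof (rule sawtooth_skorokhod_converges[OF \<theta>0 \<theta>_mono \<theta>_unb, where \<sigma> = "\<lambda>i. \<sigma> (p i)" and m = "\<lambda>i. m (p i)"])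
    show "\<sigma> (p i) 0 = 0" for i unfolding \<sigma>_def by (rule tight_jump_0[OF c q])
    show "strict_mono (\<sigma> (p i))" for i unfolding \<sigma>_def by (rule tight_jump_strict_mono[OF c q])
    show "\<bar>\<sigma> (p i) n - \<theta> n\<bar> \<le> inverse (real (Suc i))" if "n \<le> i" for i n
      unfolding p_def by (rule j(3)[OF that])
    show "\<bar>m (p i) - \<mu>\<bar> \<le> inverse (real (Suc i))" for i unfolding p_def by (rule j(2))
    show "\<bar>z i t - sawtooth (m (p i)) (\<sigma> (p i)) t\<bar> \<le> inverse (real (Suc i))"
      if "0 \<le> t" "t \<le> real i" for i t
      using z[OF that] renewal_path_sawtooth[OF c q that(1)] by (simp add: \<sigma>_def)
  qed
  have x: "?x \<in> cadlag" by (rule sawtooth_cadlag[OF \<theta>0 \<theta>_mono \<theta>_unb])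
  have cont: "(\<lambda>i. F (z i)) \<longlonglongrightarrow> F ?x"
    if "\<And>i. z i \<in> cadlag" "skorokhod_converges z ?x" for z
    using F that x unfolding skorokhod_test_function_def by blast
  have "skorokhod_converges (\<lambda>i. y (p i)) ?x"
  proof (rule conv)
    fix i :: nat and t :: real assume t: "0 \<le> t" "t \<le> real i"
    have "\<bar>y (p i) t - renewal_path (m (p i)) (c (p i)) t\<bar> \<le> inverse (real (Suc (p i)))"
      using t pi[of i] by (intro yr) auto
    also have "\<dots> \<le> inverse (real (Suc i))" using pi[of i] by (intro le_imp_inverse_le) auto
    finally show "\<bar>y (p i) t - renewal_path (m (p i)) (c (p i)) t\<bar> \<le> inverse (real (Suc i))" .
  qed
  then have l1: "(\<lambda>i. F (y (p i))) \<longlonglongrightarrow> F ?x" using y by (intro cont) auto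
  have "skorokhod_converges ?w ?x" by (rule conv) simp
  then have l2: "(\<lambda>i. F (?w i)) \<longlonglongrightarrow> F ?x"
    using renewal_path_cadlag[OF c q] by (intro cont) auto
  have "(\<lambda>i. \<bar>F (y (p i)) - F (?w i)\<bar>) \<longlonglongrightarrow> 0"
    using tendsto_rabs[OF tendsto_diff[OF l1 l2]] by simp
  then have "\<forall>\<^sub>F i in sequentially. \<bar>F (y (p i)) - F (?w i)\<bar> < \<epsilon>" using \<epsilon> by (rule order_tendstoD(2))
  then obtain i where "\<bar>F (y (p i)) - F (?w i)\<bar> < \<epsilon>"
    using eventually_happens'[OF sequentially_bot] by blast
  then show False using far[of "p i"] by simp
qed

section \<open>Increments of unit Poisson processes\<close>

context prob_space
begin

lemma poisson_AE_counting_path: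
  assumes "unit_poisson_process M X"
  shows "AE \<omega> in M. counting_path (\<lambda>t. X t \<omega>)"
  using assms unfolding unit_poisson_process_def counting_path_def by fast

lemma poisson_measurable:
  "unit_poisson_process M X \<Longrightarrow> 0 \<le> t \<Longrightarrow> X t \<in> M \<rightarrow>\<^sub>M count_space UNIV"
  unfolding unit_poisson_process_def by blast

lemma poisson_increment_measurable:
  "unit_poisson_process M X \<Longrightarrow> 0 \<le> s \<Longrightarrow> 0 \<le> t \<Longrightarrow>
    (\<lambda>\<omega>. X t \<omega> - X s \<omega>) \<in> M \<rightarrow>\<^sub>M count_space UNIV"
  using poisson_measurable[of X s] poisson_measurable[of X t] by measurable

lemma poisson_increment_event:
  assumes "unit_poisson_process M X" "0 \<le> s" "0 \<le> t"
  shows "{\<omega> \<in> space M. X t \<omega> - X s \<omega> \<in> A} \<in> events"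
  using measurable_sets[OF poisson_increment_measurable[OF assms], of A]
  by (simp add: vimage_def Int_def conj_commute)

lemma poisson_increment_prob:
  assumes X: "unit_poisson_process M X" and st: "0 \<le> s" "s < t"
  shows "prob {\<omega> \<in> space M. X t \<omega> - X s \<omega> \<in> A} = measure (measure_pmf (poisson_pmf (t - s))) A"
proof -
  have d: "distr M (count_space UNIV) (\<lambda>\<omega>. X t \<omega> - X s \<omega>) = measure_pmf (poisson_pmf (t - s))"
    using X st unfolding unit_poisson_process_def by blast
  have m: "(\<lambda>\<omega>. X t \<omega> - X s \<omega>) \<in> M \<rightarrow>\<^sub>M count_space UNIV"
    using poisson_increment_measurable[OF X, of s t] st by simp
  show ?thesis
    unfolding d[symmetric] using measure_distr[OF m, of A] by (simp add: vimage_def Int_def conj_commute)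
qed

lemma poisson_increment_eq:
  assumes X: "unit_poisson_process M X" and st: "0 \<le> s" "s < t"
  shows "prob {\<omega> \<in> space M. X t \<omega> - X s \<omega> = n} = (t - s) ^ n / fact n * exp (- (t - s))"
  using poisson_increment_prob[OF assms, of "{n}"] st by (simp add: measure_pmf_single)

lemma poisson_increment_ge_1:
  assumes X: "unit_poisson_process M X" and st: "0 \<le> s" "s \<le> t"
  shows "prob {\<omega> \<in> space M. 1 \<le> X t \<omega> - X s \<omega>} \<le> t - s"
proof (cases "s = t")
  case False
  then have lt: "s < t" using st by simp
  have "prob {\<omega> \<in> space M. 1 \<le> X t \<omega> - X s \<omega>} = prob (space M - {\<omega> \<in> space M. X t \<omega> - X s \<omega> = 0})"
    by (intro arg_cong[where f = prob]) auto
  also have "\<dots> = 1 - exp (- (t - s))"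
    using poisson_increment_event[OF X, of s t "{0}"] poisson_increment_eq[OF X st(1) lt, of 0] st
    by (subst prob_compl) auto
  finally show ?thesis using exp_ge_add_one_self[of "- (t - s)"] by linarith
qed simp

text \<open>The probability is \<open>1 - (1 + x) exp (- x)\<close> for \<open>x = t - s\<close>, and \<open>exp (- x) \<ge> 1 - x\<close>.\<close>

lemma poisson_increment_ge_2:
  assumes X: "unit_poisson_process M X" and st: "0 \<le> s" "s \<le> t"
  shows "prob {\<omega> \<in> space M. 2 \<le> X t \<omega> - X s \<omega>} \<le> (t - s)\<^sup>2"
proof (cases "s = t")
  case False
  define x where "x = t - s"
  then have lt: "s < t" "0 < x" using st False by auto
  let ?A = "\<lambda>n. {\<omega> \<in> space M. X t \<omega> - X s \<omega> = n}"
  have ev: "?A n \<in> events" for n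
    using poisson_increment_event[OF X, of s t "{n}"] st by simp
  have "prob {\<omega> \<in> space M. 2 \<le> X t \<omega> - X s \<omega>} = prob (space M - (?A 0 \<union> ?A 1))"
    by (intro arg_cong[where f = prob]) auto
  also have "\<dots> = 1 - prob (?A 0 \<union> ?A 1)"
    by (intro prob_compl sets.Un ev)
  also have "prob (?A 0 \<union> ?A 1) = prob (?A 0) + prob (?A 1)"
    by (intro finite_measure_Union ev) auto
  also have "\<dots> = (1 + x) * exp (- x)"
    using poisson_increment_eq[OF X st(1) lt(1), of 0] poisson_increment_eq[OF X st(1) lt(1), of 1]
    by (simp add: x_def algebra_simps)
  finally have eq: "prob {\<omega> \<in> space M. 2 \<le> X t \<omega> - X s \<omega>} = 1 - (1 + x) * exp (- x)" .
  have "(1 + x) * (1 - x) \<le> (1 + x) * exp (- x)"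
    using exp_ge_add_one_self[of "- x"] lt by (intro mult_left_mono) auto
  then show ?thesis unfolding eq by (simp add: x_def power2_eq_square algebra_simps)
qed simp

end

lemma poisson_lower_tail:
  assumes "0 < e"
  shows "\<exists>b\<ge>1::nat. \<forall>(P :: 'a measure) X. prob_space P \<and> unit_poisson_process P X \<longrightarrow>
    measure P {\<omega> \<in> space P. X (real b) \<omega> - X 0 \<omega> < n} \<le> e"
proof -
  have "((\<lambda>x::real. \<Sum>l<n. (x ^ l / exp x) / fact l) \<longlongrightarrow> (\<Sum>l<n. 0 / fact l)) at_top"
    by (intro tendsto_intros tendsto_power_div_exp_0) simp
  then have "((\<lambda>x::real. \<Sum>l<n. (x ^ l / exp x) / fact l) \<longlongrightarrow> 0) at_top" by simp
  from filterlim_compose[OF this filterlim_real_sequentially]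
  have "\<forall>\<^sub>F b in sequentially. (\<Sum>l<n. (real b ^ l / exp (real b)) / fact l) < e"
    using assms by (rule order_tendstoD(2))
  then have "\<forall>\<^sub>F b in sequentially. 1 \<le> b \<and> (\<Sum>l<n. (real b ^ l / exp (real b)) / fact l) < e"
    using eventually_ge_at_top[of "1::nat"] by eventually_elim blast
  then obtain b :: nat where b: "1 \<le> b" "(\<Sum>l<n. (real b ^ l / exp (real b)) / fact l) < e"
    using eventually_happens'[OF sequentially_bot] by blast
  have "measure P {\<omega> \<in> space P. X (real b) \<omega> - X 0 \<omega> < n} \<le> e"
    if "prob_space P" "unit_poisson_process P X" for P :: "'a measure" and X
  proof -
    interpret prob_space P by fact
    have "prob {\<omega> \<in> space P. X (real b) \<omega> - X 0 \<omega> < n} = measure (measure_pmf (poisson_pmf (real b))) {..<n}"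
      using poisson_increment_prob[OF that(2), of 0 "real b" "{..<n}"] b by simp
    also have "\<dots> = (\<Sum>l<n. pmf (poisson_pmf (real b)) l)" by (simp add: measure_measure_pmf_finite)
    also have "\<dots> = (\<Sum>l<n. (real b ^ l / exp (real b)) / fact l)"
      using b by (intro sum.cong) (simp_all add: exp_minus divide_inverse mult_ac)
    finally show ?thesis using b by simp
  qed
  then show ?thesis using b by blast
qed

text \<open>Two rings in neighbouring cells of length \<open>h\<close> have probability of order \<open>h\<^sup>2\<close>, hence of order
  \<open>1 / q\<close> over a grid with \<open>q\<close> cells, and the number of rings tends to infinity. The bounds \<open>b\<close> and
  \<open>q\<close> serve all realizations at once, because the clocks change with the number of vertices.\<close>

lemma poisson_tight:
  assumes \<eta>: "0 < \<eta>"
  shows "\<exists>b q. (\<forall>T. 0 < q T) \<and> (\<forall>(P :: 'a measure) X. prob_space P \<and> unit_poisson_process P X \<longrightarrow>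
    (\<exists>E\<in>sets P. 1 - \<eta> \<le> measure P E \<and> (AE \<omega> in P. \<omega> \<in> E \<longrightarrow> (\<lambda>t. X t \<omega>) \<in> tight_paths b q)))"
proof -
  \<comment> \<open>The exceptional probabilities of the two families of conditions, each summing to \<open>\<eta> / 2\<close>.\<close>
  define e where "e n = \<eta> / 4 * (1/2) ^ n" for n :: nat
  have e: "0 < e n" for n using \<eta> by (simp add: e_def)
  have e_sums: "e sums (\<eta> / 2)"
    using sums_mult[OF geometric_sums[of "1/2::real"], of "\<eta> / 4"] by (simp add: e_def[abs_def])
  have "\<forall>n. \<exists>b\<ge>1::nat. \<forall>(P :: 'a measure) X. prob_space P \<and> unit_poisson_process P X \<longrightarrow>
      measure P {\<omega> \<in> space P. X (real b) \<omega> - X 0 \<omega> < n} \<le> e n"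
    using poisson_lower_tail[OF e] by (intro allI)
  from choice[OF this] obtain b :: "nat \<Rightarrow> nat" where b: "\<And>n. 1 \<le> b n"
    "\<And>n (P :: 'a measure) X. prob_space P \<Longrightarrow> unit_poisson_process P X \<Longrightarrow>
      measure P {\<omega> \<in> space P. X (real (b n)) \<omega> - X 0 \<omega> < n} \<le> e n"
    by blast
  have "\<exists>q>0. real T + 4 * (real T)\<^sup>2 \<le> e T * real q" for T
  proof -
    obtain q :: nat where "(real T + 4 * (real T)\<^sup>2) / e T < real q" using reals_Archimedean2 by blast
    then show ?thesis using e[of T]
      by (intro exI[of _ "Suc q"]) (auto simp: field_simps)
  qed
  then obtain q where q: "\<And>T. 0 < q T" "\<And>T. real T + 4 * (real T)\<^sup>2 \<le> e T * real (q T)" by metis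
  have "\<exists>E\<in>sets P. 1 - \<eta> \<le> measure P E \<and> (AE \<omega> in P. \<omega> \<in> E \<longrightarrow> (\<lambda>t. X t \<omega>) \<in> tight_paths b q)"
    if P: "prob_space P" and X: "unit_poisson_process P X" for P :: "'a measure" and X
  proof -
    interpret prob_space P by fact
    define B where "B n = {\<omega> \<in> space P. X (real (b n)) \<omega> - X 0 \<omega> < n}" for n
    define h where "h T = real T / real (q T)" for T
    have h: "0 \<le> h T" for T by (simp add: h_def)
    define D where "D T l = {\<omega> \<in> space P. 2 \<le> X (real (l + 2) * h T) \<omega> - X (real l * h T) \<omega>}" for T l
    define C where "C T = {\<omega> \<in> space P. 1 \<le> X (h T) \<omega> - X 0 \<omega>} \<union> (\<Union>l<q T. D T l)" for T
    have Bev: "B n \<in> events" for n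
      using poisson_increment_event[OF X, of 0 "real (b n)" "{..<n}"] by (simp add: B_def)
    have Dev: "D T l \<in> events" for T l
      using poisson_increment_event[OF X, of "real l * h T" "real (l + 2) * h T" "{2..}"] h by (simp add: D_def)
    have Cev: "C T \<in> events" for T
      using poisson_increment_event[OF X, of 0 "h T" "{1..}"] h Dev by (auto simp: C_def)
    have Ble: "prob (B n) \<le> e n" for n using b(2)[OF P X] by (simp add: B_def)
    have Cle: "prob (C T) \<le> e T" for T
    proof -
      have "prob (C T) \<le> prob {\<omega> \<in> space P. 1 \<le> X (h T) \<omega> - X 0 \<omega>} + prob (\<Union>l<q T. D T l)"
        unfolding C_def using poisson_increment_event[OF X, of 0 "h T" "{1..}"] h Dev
        by (intro measure_Un_le) auto
      also have "\<dots> \<le> h T + (\<Sum>l<q T. prob (D T l))"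
        using poisson_increment_ge_1[OF X, of 0 "h T"] h Dev
        by (intro add_mono measure_UNION_le) auto
      also have "\<dots> \<le> h T + (\<Sum>l<q T. (2 * h T)\<^sup>2)"
      proof (intro add_mono order_refl sum_mono)
        fix l
        have "prob (D T l) \<le> (real (l + 2) * h T - real l * h T)\<^sup>2"
          unfolding D_def using h by (intro poisson_increment_ge_2[OF X]) (auto intro!: mult_right_mono)
        then show "prob (D T l) \<le> (2 * h T)\<^sup>2" by (simp add: algebra_simps)
      qed
      also have "\<dots> = (real T + 4 * (real T)\<^sup>2) / real (q T)"
        using q(1)[of T] by (simp add: h_def power2_eq_square field_simps)
      also have "\<dots> \<le> e T" using q[of T] by (simp add: pos_divide_le_eq)
      finally show ?thesis .
    qed
    have union: "prob (\<Union>n. A n) \<le> \<eta> / 2"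
      if "\<And>n. A n \<in> events" "\<And>n. prob (A n) \<le> e n" for A :: "nat \<Rightarrow> 'a set"
    proof -
      have s: "summable (\<lambda>n. prob (A n))"
        using sums_summable[OF e_sums] by (rule summable_comparison_test') (use that in auto)
      have "prob (\<Union>n. A n) \<le> (\<Sum>n. prob (A n))"
        using that s by (intro finite_measure_subadditive_countably) auto
      also have "\<dots> \<le> (\<Sum>n. e n)" using that s sums_summable[OF e_sums] by (intro suminf_le) auto
      finally show ?thesis using sums_unique[OF e_sums] by simp
    qed
    let ?bad = "(\<Union>n. B n) \<union> (\<Union>T. C T)"
    have bad: "?bad \<in> events" using Bev Cev by auto
    have "prob ?bad \<le> prob (\<Union>n. B n) + prob (\<Union>T. C T)"
      using Bev Cev by (intro measure_Un_le) auto
    also have "\<dots> \<le> \<eta>" using union[OF Bev Ble] union[OF Cev Cle] by simp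
    finally have 1: "1 - \<eta> \<le> prob (space P - ?bad)" using prob_compl[OF bad] by simp
    have 2: "AE \<omega> in P. \<omega> \<in> space P - ?bad \<longrightarrow> (\<lambda>t. X t \<omega>) \<in> tight_paths b q"
      using poisson_AE_counting_path[OF X]
    proof (eventually_elim, intro impI)
      fix \<omega> assume cp: "counting_path (\<lambda>t. X t \<omega>)" and \<omega>: "\<omega> \<in> space P - ?bad"
      have "n \<le> X (real (b n)) \<omega>" for n
        using \<omega> counting_path_zero[OF cp] by (auto simp: B_def not_less)
      moreover have "X (h T) \<omega> = 0" for T
      proof -
        have "\<omega> \<notin> C T" using \<omega> by blast
        then have "\<not> 1 \<le> X (h T) \<omega> - X 0 \<omega>" using \<omega> unfolding C_def by blast
        then show ?thesis using counting_path_zero[OF cp] by simp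
      qed
      moreover have "X (real (l + 2) * h T) \<omega> \<le> Suc (X (real l * h T) \<omega>)" if "l < q T" for T l
      proof -
        have "\<omega> \<notin> C T" using \<omega> by blast
        then have "\<omega> \<notin> D T l" using that by (auto simp: C_def)
        then show ?thesis using \<omega> by (simp add: D_def)
      qed
      ultimately show "(\<lambda>t. X t \<omega>) \<in> tight_paths b q"
        using cp unfolding tight_paths_def h_def by blast
    qed
    show ?thesis using 1 2 bad by blast
  qed
  then show ?thesis using q(1) by blast
qed

section \<open>The skeleton chain of the meteor process\<close>

lemma measurable_larger_source:
  assumes "f \<in> A \<rightarrow>\<^sub>M C" "sets A \<subseteq> sets B" "space A = space B"
  shows "f \<in> B \<rightarrow>\<^sub>M C"
  using assms by (auto simp: measurable_def)

definition mass_simplex :: "nat \<Rightarrow> (nat \<Rightarrow> real) set" where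
  "mass_simplex k = {m. (\<forall>x\<in>{1..k}. 0 \<le> m x) \<and> (\<Sum>x=1..k. m x) = real k}"

definition square_sum :: "nat \<Rightarrow> (nat \<Rightarrow> real) \<Rightarrow> real" where
  "square_sum k m = (\<Sum>x=1..k. (m x)\<^sup>2)"

lemma mass_simplex_le:
  assumes "m \<in> mass_simplex k" "x \<in> {1..k}"
  shows "0 \<le> m x" "m x \<le> real k"
proof -
  show "0 \<le> m x" using assms by (simp add: mass_simplex_def)
  have "m x \<le> (\<Sum>x=1..k. m x)"
    using assms by (intro member_le_sum) (auto simp: mass_simplex_def)
  then show "m x \<le> real k" using assms by (simp add: mass_simplex_def)
qed

lemma square_sum_bounds:
  assumes m: "m \<in> mass_simplex k"
  shows "0 \<le> square_sum k m" "square_sum k m \<le> (real k)\<^sup>2"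
proof -
  show "0 \<le> square_sum k m" unfolding square_sum_def by (intro sum_nonneg) simp
  have "square_sum k m \<le> (\<Sum>x=1..k. real k * m x)"
    unfolding square_sum_def power2_eq_square
    using mass_simplex_le[OF m] by (intro sum_mono mult_right_mono) auto
  also have "\<dots> = (real k)\<^sup>2"
    using m by (simp add: sum_distrib_left[symmetric] mass_simplex_def power2_eq_square)
  finally show "square_sum k m \<le> (real k)\<^sup>2" .
qed

text \<open>Isolating the vertex \<open>j\<close>, which becomes empty, in a sum over all vertices after a jump.\<close>

lemma sum_meteor_jump:
  assumes j: "j \<in> {1..k}"
  shows "(\<Sum>x=1..k. f (meteor_jump k j m x)) =
    f 0 + (\<Sum>x\<in>{1..k} - {j}. f (m x + m j / (real k - 1)))"
proof -
  have "(\<Sum>x=1..k. f (meteor_jump k j m x)) =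
      f (meteor_jump k j m j) + (\<Sum>x\<in>{1..k} - {j}. f (meteor_jump k j m x))"
    using j by (subst sum.remove[of _ j]) auto
  also have "(\<Sum>x\<in>{1..k} - {j}. f (meteor_jump k j m x)) =
      (\<Sum>x\<in>{1..k} - {j}. f (m x + m j / (real k - 1)))"
    using j by (intro sum.cong) (auto simp: meteor_jump_def)
  finally show ?thesis using j by (simp add: meteor_jump_def)
qed

lemma sum_others:
  assumes "m \<in> mass_simplex k" "j \<in> {1..k}"
  shows "(\<Sum>x\<in>{1..k} - {j}. m x) = real k - m j"
proof -
  have "(\<Sum>x=1..k. m x) = m j + (\<Sum>x\<in>{1..k} - {j}. m x)"
    using assms(2) by (intro sum.remove) auto
  then show ?thesis using assms(1) by (simp add: mass_simplex_def)
qed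

lemma meteor_jump_simplex:
  assumes k: "2 \<le> k" and m: "m \<in> mass_simplex k" and j: "j \<in> {1..k}"
  shows "meteor_jump k j m \<in> mass_simplex k"
proof -
  have "(\<Sum>x=1..k. meteor_jump k j m x) = (\<Sum>x\<in>{1..k} - {j}. m x + m j / (real k - 1))"
    using sum_meteor_jump[OF j, of "\<lambda>x. x" m] by simp
  also have "\<dots> = real k"
    using j k by (simp add: sum.distrib sum_others[OF m j] of_nat_diff del: One_nat_def)
  finally show ?thesis
    using mass_simplex_le[OF m] j k by (auto simp: mass_simplex_def meteor_jump_def)
qed

text \<open>The generator of the process maps the sum of squares to an affine function of the sum of
  squares. This closed equation determines its stationary expectation.\<close>

lemma square_sum_generator:
  assumes k: "2 \<le> k" and m: "m \<in> mass_simplex k"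
  shows "(\<Sum>j=1..k. square_sum k (meteor_jump k j m) - square_sum k m) =
    2 * (real k)\<^sup>2 / (real k - 1) - real k / (real k - 1) * square_sum k m"
proof -
  let ?d = "real k - 1"
  have d: "?d \<noteq> 0" using k by simp
  have "square_sum k (meteor_jump k j m) - square_sum k m =
      2 * real k / ?d * m j + (- 1 - 1 / ?d) * (m j)\<^sup>2" if j: "j \<in> {1..k}" for j
  proof -
    have "square_sum k (meteor_jump k j m) = (\<Sum>x\<in>{1..k} - {j}. (m x + m j / ?d)\<^sup>2)"
      unfolding square_sum_def using sum_meteor_jump[OF j, of "\<lambda>x. x\<^sup>2" m] by simp
    also have "\<dots> = (\<Sum>x\<in>{1..k} - {j}. (m x)\<^sup>2 + 2 * (m j / ?d) * m x + (m j / ?d)\<^sup>2)"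
      by (intro sum.cong) (auto simp: power2_eq_square algebra_simps)
    also have "\<dots> = (\<Sum>x\<in>{1..k} - {j}. (m x)\<^sup>2) + 2 * (m j / ?d) * (real k - m j) + ?d * (m j / ?d)\<^sup>2"
      by (simp only: sum.distrib sum_distrib_left[symmetric] sum_others[OF m j])
        (use j k in \<open>simp add: of_nat_diff del: One_nat_def\<close>)
    also have "(\<Sum>x\<in>{1..k} - {j}. (m x)\<^sup>2) = square_sum k m - (m j)\<^sup>2"
      using j unfolding square_sum_def by (subst (2) sum.remove[of _ j]) auto
    finally have "square_sum k (meteor_jump k j m) - square_sum k m =
        - (m j)\<^sup>2 + 2 * (m j / ?d) * (real k - m j) + ?d * (m j / ?d)\<^sup>2" by simp
    moreover have "?d * (m j / ?d)\<^sup>2 = (m j)\<^sup>2 / ?d" using d by (simp add: power2_eq_square)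
    moreover have "2 * (m j / ?d) * (real k - m j) = 2 * real k / ?d * m j - 2 * ((m j)\<^sup>2 / ?d)"
      by (simp add: power2_eq_square algebra_simps diff_divide_distrib)
    moreover have "(- 1 - 1 / ?d) * (m j)\<^sup>2 = - (m j)\<^sup>2 - (m j)\<^sup>2 / ?d" by (simp add: left_diff_distrib)
    ultimately show ?thesis by linarith
  qed
  then have "(\<Sum>j=1..k. square_sum k (meteor_jump k j m) - square_sum k m) =
      (\<Sum>j=1..k. 2 * real k / ?d * m j + (- 1 - 1 / ?d) * (m j)\<^sup>2)"
    by (intro sum.cong refl)
  also have "\<dots> = 2 * real k / ?d * real k + (- 1 - 1 / ?d) * square_sum k m"
    using m by (simp only: sum.distrib sum_distrib_left[symmetric] square_sum_def) (simp add: mass_simplex_def)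
  also have "- 1 - 1 / ?d = - (real k / ?d)" using d by (simp add: field_simps)
  finally show ?thesis by (simp add: power2_eq_square)
qed

locale stationary_meteor = prob_space P for P :: "'a measure" +
  fixes k :: nat and N :: "nat \<Rightarrow> real \<Rightarrow> 'a \<Rightarrow> nat" and M :: "nat \<Rightarrow> real \<Rightarrow> 'a \<Rightarrow> real"
  assumes k: "2 \<le> k" and process: "meteor_process k P N M"
    and mass: "AE \<omega> in P. (\<Sum>j=1..k. M j 0 \<omega>) = real k"
    and stationary: "\<And>t. 0 \<le> t \<Longrightarrow>
      distr P (state_space k) (state k M t) = distr P (state_space k) (state k M 0)"
begin

lemma clock: "j \<in> {1..k} \<Longrightarrow> unit_poisson_process P (N j)"
  using process unfolding meteor_process_def by blast

lemma mass_measurable: "j \<in> {1..k} \<Longrightarrow> 0 \<le> t \<Longrightarrow> M j t \<in> borel_measurable P"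
  using process unfolding meteor_process_def by blast

lemma independence:
  "indep_sets (\<lambda>i. if i = 0
      then sets (vimage_algebra (space P) (state k M 0) (state_space k))
      else sets (vimage_algebra (space P) (sample_path (N i)) (\<Pi>\<^sub>M t\<in>{0..}. count_space UNIV))) {0..k}"
  using process unfolding meteor_process_def by blast

lemma AE_meteor_path: "AE \<omega> in P. meteor_path k (\<lambda>j t. N j t \<omega>) (\<lambda>j t. M j t \<omega>)"
proof -
  have "AE \<omega> in P. \<forall>j\<in>{1..k}. counting_path (\<lambda>t. N j t \<omega>)"
    by (intro AE_finite_allI poisson_AE_counting_path clock) auto
  moreover have "AE \<omega> in P.
      (\<forall>j\<in>{1..k}. 0 \<le> M j 0 \<omega>) \<and>
      (\<forall>j\<in>{1..k}. \<forall>t. jump_time (\<lambda>s. N j s \<omega>) t \<longrightarrow>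
         (\<exists>l. (\<forall>x\<in>{1..k}. ((\<lambda>s. M x s \<omega>) \<longlongrightarrow> l x) (at_left t)) \<and>
              M j t \<omega> = 0 \<and>
              (\<forall>x\<in>{1..k} - {j}. M x t \<omega> = l x + l j / (real k - 1)))) \<and>
      (\<forall>s t. 0 \<le> s \<and> s < t \<and> (\<forall>j\<in>{1..k}. \<forall>u\<in>{s<..t}. \<not> jump_time (\<lambda>r. N j r \<omega>) u) \<longrightarrow>
         (\<forall>x\<in>{1..k}. M x t \<omega> = M x s \<omega>))"
    using process unfolding meteor_process_def by blast
  ultimately show ?thesis
    unfolding meteor_path_def by eventually_elim blast
qed

lemma AE_start: "AE \<omega> in P. (\<lambda>x. M x 0 \<omega>) \<in> mass_simplex k"
proof -
  have "AE \<omega> in P. \<forall>j\<in>{1..k}. 0 \<le> M j 0 \<omega>"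
    using process unfolding meteor_process_def by (auto elim: eventually_mono)
  then show ?thesis using mass unfolding mass_simplex_def by eventually_elim simp
qed

lemma state_measurable: "0 \<le> t \<Longrightarrow> state k M t \<in> P \<rightarrow>\<^sub>M state_space k"
  unfolding state_def[abs_def] by (intro measurable_restrict mass_measurable) auto

definition increment :: "real \<Rightarrow> nat \<Rightarrow> nat \<Rightarrow> 'a \<Rightarrow> nat" where
  "increment h i j \<omega> = N j (real (Suc i) * h) \<omega> - N j (real i * h) \<omega>"

text \<open>The generators of the independent sigma-algebras of the skeleton chain: the pair \<open>(0, 0)\<close>
  stands for the initial state, \<open>(i, j)\<close> with \<open>j \<ge> 1\<close> for the increment of clock \<open>j\<close> over cell \<open>i\<close>.\<close>

definition cell_sets :: "real \<Rightarrow> nat \<times> nat \<Rightarrow> 'a set set" where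
  "cell_sets h x = (if snd x = 0
     then sets (vimage_algebra (space P) (state k M 0) (state_space k))
     else {increment h (fst x) (snd x) -` A \<inter> space P | A. A \<in> sets (count_space UNIV)})"

lemma increment_measurable:
  "0 \<le> h \<Longrightarrow> j \<in> {1..k} \<Longrightarrow> increment h i j \<in> P \<rightarrow>\<^sub>M count_space UNIV"
  unfolding increment_def[abs_def] by (intro poisson_increment_measurable clock) auto

lemma increment_path_measurable:
  assumes "0 \<le> h" "j \<in> {1..k}"
  shows "increment h i j \<in> vimage_algebra (space P) (sample_path (N j)) (\<Pi>\<^sub>M t\<in>{0..}. count_space UNIV)
    \<rightarrow>\<^sub>M count_space UNIV"
proof -
  let ?V = "vimage_algebra (space P) (sample_path (N j)) (\<Pi>\<^sub>M t\<in>{0..}. count_space (UNIV :: nat set))"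
  have sp: "sample_path (N j) \<in> ?V \<rightarrow>\<^sub>M (\<Pi>\<^sub>M t\<in>{0..}. count_space UNIV)"
    by (rule measurable_vimage_algebra1) (auto simp: sample_path_def space_PiM)
  have "N j t \<in> ?V \<rightarrow>\<^sub>M count_space UNIV" if "0 \<le> t" for t
  proof -
    have "(\<lambda>\<omega>. sample_path (N j) \<omega> t) \<in> ?V \<rightarrow>\<^sub>M count_space UNIV"
      by (rule measurable_compose[OF sp measurable_component_singleton]) (use that in simp)
    then show ?thesis using that by (simp add: sample_path_def)
  qed
  then have [measurable]: "N j (real (Suc i) * h) \<in> ?V \<rightarrow>\<^sub>M count_space UNIV"
      "N j (real i * h) \<in> ?V \<rightarrow>\<^sub>M count_space UNIV"
    using assms(1) by simp_all
  show ?thesis unfolding increment_def[abs_def] by measurable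
qed

lemma cell_sets_events:
  assumes "0 \<le> h" "snd x \<in> {0..k}"
  shows "cell_sets h x \<subseteq> events"
proof (cases "snd x = 0")
  case True
  have "sets (vimage_algebra (space P) (state k M 0) (state_space k)) \<subseteq> events"
    using measurable_sets[OF state_measurable[of 0]] state_measurable[of 0, THEN measurable_space]
    by (subst sets_vimage_algebra2) auto
  then show ?thesis using True by (simp add: cell_sets_def)
next
  case False
  then show ?thesis using assms measurable_sets[OF increment_measurable[OF assms(1)], of "snd x"]
    by (auto simp: cell_sets_def)
qed

lemma increments_indep:
  assumes h: "0 \<le> h" and j: "j \<in> {1..k}"
  shows "indep_vars (\<lambda>_. count_space UNIV) (\<lambda>i. increment h i j) {..<n}"
proof -
  have "mono (\<lambda>i. real i * h)" using h by (auto intro!: monoI mult_right_mono)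
  then have mono: "0 \<le> (\<lambda>i. real i * h) 0 \<and> mono (\<lambda>i. real i * h)" by simp
  have "\<forall>(m::nat) \<tau>. 0 \<le> \<tau> 0 \<and> mono \<tau> \<longrightarrow>
      indep_vars (\<lambda>_. count_space UNIV) (\<lambda>i \<omega>. N j (\<tau> (Suc i)) \<omega> - N j (\<tau> i) \<omega>) {..<m}"
    using clock[OF j] unfolding unit_poisson_process_def by (elim conjE)
  from this[rule_format, OF mono, of n] show ?thesis unfolding increment_def[abs_def] .
qed

text \<open>Independence of the paths of different clocks and of the increments of one clock combine to the
  joint independence of all increments and the initial state: sets outside \<open>J\<close> are replaced by the
  whole space, the product over the clocks is split off first, and then the product over the cells.\<close>

lemma cell_sets_indep:
  assumes h: "0 \<le> h"
  shows "indep_sets (cell_sets h) (insert (0, 0) ({..<n} \<times> {1..k}))"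
proof (rule indep_sets_mono_index)
  let ?I = "insert (0, 0) ({..<Suc n} \<times> {1..k})"
  show "insert (0, 0) ({..<n} \<times> {1..k}) \<subseteq> ?I" by auto
  show "indep_sets (cell_sets h) ?I"
  proof (rule indep_setsI)
    fix x assume "x \<in> ?I"
    then show "cell_sets h x \<subseteq> events" by (intro cell_sets_events[OF h]) auto
  next
    fix A J assume J: "J \<noteq> {}" "J \<subseteq> ?I" "finite J" and A: "\<forall>x\<in>J. A x \<in> cell_sets h x"
    define A' where "A' x = (if x \<in> J then A x else space P)" for x
    have top: "space P \<in> cell_sets h x" for x
    proof (cases "snd x = 0")
      case True
      then show ?thesis using sets.top[of "vimage_algebra (space P) (state k M 0) (state_space k)"]
        by (simp add: cell_sets_def)
    qed (auto simp: cell_sets_def intro!: exI[of _ UNIV])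
    have A': "A' x \<in> cell_sets h x" for x using A top by (simp add: A'_def)
    have A'_sub: "A' x \<subseteq> space P" if "x \<in> ?I" for x
    proof (rule sets.sets_into_space)
      have "snd x \<in> {0..k}" using that by auto
      then show "A' x \<in> events" using A'[of x] cell_sets_events[OF h] by blast
    qed
    define B where "B j = (if j = 0 then A' (0, 0) else (\<Inter>i<Suc n. A' (i, j)))" for j
    let ?G = "\<lambda>i. if i = 0 then sets (vimage_algebra (space P) (state k M 0) (state_space k))
      else sets (vimage_algebra (space P) (sample_path (N i)) (\<Pi>\<^sub>M t\<in>{0..}. count_space UNIV))"
    have B: "B j \<in> ?G j" if "j \<in> {0..k}" for j
    proof (cases "j = 0")
      case True
      then show ?thesis using A'[of "(0, 0)"] by (simp only: B_def cell_sets_def snd_conv simp_thms if_True)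
    next
      case False
      have "A' (i, j) \<in> sets (vimage_algebra (space P) (sample_path (N j)) (\<Pi>\<^sub>M t\<in>{0..}. count_space UNIV))" for i
      proof -
        obtain S where "A' (i, j) = increment h i j -` S \<inter> space P"
          using A'[of "(i, j)"] False unfolding cell_sets_def by auto
        moreover have "increment h i j -` S \<inter> space (vimage_algebra (space P) (sample_path (N j))
            (\<Pi>\<^sub>M t\<in>{0..}. count_space UNIV)) \<in>
            sets (vimage_algebra (space P) (sample_path (N j)) (\<Pi>\<^sub>M t\<in>{0..}. count_space UNIV))"
          by (rule measurable_sets[OF increment_path_measurable[OF h]]) (use that False in auto)
        ultimately show ?thesis by (simp only: space_vimage_algebra)
      qed
      then have "(\<Inter>i<Suc n. A' (i, j)) \<in>
          sets (vimage_algebra (space P) (sample_path (N j)) (\<Pi>\<^sub>M t\<in>{0..}. count_space UNIV))"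
        by (intro sets.finite_INT) auto
      then show ?thesis using False by (simp only: B_def if_False)
    qed
    have probB: "prob (B j) = (\<Prod>i<Suc n. prob (A' (i, j)))" if j: "j \<in> {1..k}" for j
    proof -
      have "\<exists>S. \<forall>i. A' (i, j) = increment h i j -` S i \<inter> space P"
      proof (rule choice, rule allI)
        fix i :: nat
        have "snd (i, j) \<noteq> 0" using j by simp
        then show "\<exists>S. A' (i, j) = increment h i j -` S \<inter> space P"
          using A'[of "(i, j)"] unfolding cell_sets_def by auto
      qed
      then obtain S where S: "\<And>i. A' (i, j) = increment h i j -` S i \<inter> space P" by blast
      have "prob (\<Inter>i<Suc n. increment h i j -` S i \<inter> space P) =
          (\<Prod>i<Suc n. prob (increment h i j -` S i \<inter> space P))"
        by (rule indep_varsD[OF increments_indep[OF h j]]) auto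
      then show ?thesis using j by (simp add: B_def S)
    qed
    have "(\<Inter>x\<in>J. A x) = (\<Inter>x\<in>?I. A' x)"
    proof (intro equalityI subsetI)
      fix \<omega> assume \<omega>: "\<omega> \<in> (\<Inter>x\<in>J. A x)"
      obtain x where x: "x \<in> J" using J by blast
      then have "\<omega> \<in> space P" using \<omega> A'_sub[of x] J by (auto simp: A'_def)
      then show "\<omega> \<in> (\<Inter>x\<in>?I. A' x)" using \<omega> by (auto simp: A'_def)
    next
      fix \<omega> assume \<omega>: "\<omega> \<in> (\<Inter>x\<in>?I. A' x)"
      then show "\<omega> \<in> (\<Inter>x\<in>J. A x)" using J(2) by (fastforce simp: A'_def)
    qed
    also have "\<dots> = (\<Inter>j\<in>{0..k}. B j)"
    proof -
      have "(\<Inter>j\<in>{0..k}. B j) = B 0 \<inter> (\<Inter>j\<in>{1..k}. B j)"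
      proof -
        have "{0..k} = insert 0 {1..k}" by auto
        then show ?thesis by simp
      qed
      then show ?thesis by (auto simp: B_def)
    qed
    finally have "prob (\<Inter>x\<in>J. A x) = prob (\<Inter>j\<in>{0..k}. B j)" by simp
    also have "\<dots> = (\<Prod>j\<in>{0..k}. prob (B j))"
      by (rule indep_setsD[OF independence]) (use B in auto)
    also have "\<dots> = prob (B 0) * (\<Prod>j\<in>{1..k}. prob (B j))"
      by (simp add: prod.atLeast_Suc_atMost)
    also have "\<dots> = prob (A' (0, 0)) * (\<Prod>j\<in>{1..k}. \<Prod>i<Suc n. prob (A' (i, j)))"
      using probB by (simp add: B_def)
    also have "(\<Prod>j\<in>{1..k}. \<Prod>i<Suc n. prob (A' (i, j))) = (\<Prod>x\<in>{..<Suc n} \<times> {1..k}. prob (A' x))"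
      by (subst prod.swap) (simp add: prod.cartesian_product)
    also have "prob (A' (0, 0)) * \<dots> = (\<Prod>x\<in>?I. prob (A' x))"
      by (subst prod.insert) auto
    also have "\<dots> = (\<Prod>x\<in>J. prob (A' x))"
      using J by (intro prod.mono_neutral_right) (auto simp: A'_def prob_space)
    also have "\<dots> = (\<Prod>x\<in>J. prob (A x))" by (simp add: A'_def)
    finally show "prob (\<Inter>x\<in>J. A x) = (\<Prod>x\<in>J. prob (A x))" .
  qed
qed

end

context stationary_meteor
begin

text \<open>Vertices are numbered from one, which leaves the site zero for cells that have no ring or several
  rings. The chain ignores such cells.\<close>

definition single :: "real \<Rightarrow> nat \<Rightarrow> nat \<Rightarrow> 'a \<Rightarrow> bool" where
  "single h i j \<omega> \<longleftrightarrow> (\<forall>x\<in>{1..k}. increment h i x \<omega> = (if x = j then 1 else 0))"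

definition site :: "real \<Rightarrow> nat \<Rightarrow> 'a \<Rightarrow> nat" where
  "site h i \<omega> = (if \<exists>j\<in>{1..k}. single h i j \<omega> then THE j. j \<in> {1..k} \<and> single h i j \<omega> else 0)"

lemma single_unique:
  assumes "j \<in> {1..k}" "single h i j \<omega>" "single h i j' \<omega>"
  shows "j' = j"
  using assms unfolding single_def by (metis zero_neq_one)

lemma site_eq:
  assumes "j \<in> {1..k}" "single h i j \<omega>"
  shows "site h i \<omega> = j"
proof -
  have "(THE j. j \<in> {1..k} \<and> single h i j \<omega>) = j"
    by (rule the_equality) (use assms single_unique in blast)+
  then show ?thesis unfolding site_def using assms by auto
qed

lemma site_none: "(\<And>j. j \<in> {1..k} \<Longrightarrow> \<not> single h i j \<omega>) \<Longrightarrow> site h i \<omega> = 0"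
  unfolding site_def by auto

lemma site_sum:
  fixes G :: "nat \<Rightarrow> real"
  shows "G (site h i \<omega>) = G 0 + (\<Sum>j=1..k. if single h i j \<omega> then G j - G 0 else 0)"
proof (cases "\<exists>j\<in>{1..k}. single h i j \<omega>")
  case True
  then obtain j where j: "j \<in> {1..k}" "single h i j \<omega>" by blast
  have "single h i x \<omega> \<longleftrightarrow> x = j" for x
    using j single_unique[OF j, of x] by blast
  then have "(\<Sum>x=1..k. if single h i x \<omega> then G x - G 0 else 0) = (\<Sum>x=1..k. if x = j then G x - G 0 else 0)"
    by (simp only:)
  also have "\<dots> = G j - G 0" using j by simp
  finally show ?thesis using site_eq[OF j] by simp
next
  case False
  then show ?thesis using site_none[of h i \<omega>] by (simp add: sum.neutral)
qed

text \<open>Replacing the masses by \<open>1\<close> outside the simplex changes the start only on a null set and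
  keeps the chain in the simplex for every sample point.\<close>

definition start :: "'a \<Rightarrow> nat \<Rightarrow> real" where
  "start \<omega> = (if (\<lambda>x. M x 0 \<omega>) \<in> mass_simplex k then (\<lambda>x. M x 0 \<omega>) else (\<lambda>x. 1))"

primrec chain :: "real \<Rightarrow> nat \<Rightarrow> 'a \<Rightarrow> nat \<Rightarrow> real" where
  "chain h 0 \<omega> = start \<omega>"
| "chain h (Suc i) \<omega> = meteor_jump k (site h i \<omega>) (chain h i \<omega>)"

text \<open>The mass that each other vertex receives during a cell. Summed over the cells, it measures by how
  much any vertex grows as long as it is not hit itself; a hit vertex starts again from zero, so that
  it does no harm that its own emission is counted as well.\<close>

definition emission :: "real \<Rightarrow> nat \<Rightarrow> 'a \<Rightarrow> real" where
  "emission h i \<omega> =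
    (if site h i \<omega> = 0 then 0 else chain h i \<omega> (site h i \<omega>) / (real k - 1))"

definition emitted :: "real \<Rightarrow> nat \<Rightarrow> 'a \<Rightarrow> real" where
  "emitted h i \<omega> = (\<Sum>l<i. emission h l \<omega>)"

lemma site_range: "site h i \<omega> = 0 \<or> site h i \<omega> \<in> {1..k}"
  using site_eq[of _ h i \<omega>] site_none[of h i \<omega>] by metis

lemma chain_simplex: "chain h i \<omega> \<in> mass_simplex k"
proof (induction i)
  case 0
  then show ?case by (auto simp: start_def mass_simplex_def)
next
  case (Suc i)
  show ?case
  proof (cases "site h i \<omega> = 0")
    case True
    then have "meteor_jump k (site h i \<omega>) (chain h i \<omega>) = chain h i \<omega>"
      by (simp add: meteor_jump_def fun_eq_iff)
    then show ?thesis using Suc by simp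
  next
    case False
    then have "site h i \<omega> \<in> {1..k}" using site_range[of h i \<omega>] by simp
    then show ?thesis using meteor_jump_simplex[OF k Suc] by simp
  qed
qed

lemma emission_bounds: "0 \<le> emission h i \<omega>" "emission h i \<omega> \<le> real k"
proof -
  show "0 \<le> emission h i \<omega>"
    using mass_simplex_le(1)[OF chain_simplex] site_range[of h i \<omega>] k
    by (auto simp: emission_def intro!: divide_nonneg_nonneg)
  show "emission h i \<omega> \<le> real k"
  proof (cases "site h i \<omega> = 0")
    case False
    then have "site h i \<omega> \<in> {1..k}" using site_range[of h i \<omega>] by simp
    from mass_simplex_le[OF chain_simplex this, of h i \<omega>]
    have "chain h i \<omega> (site h i \<omega>) / (real k - 1) \<le> real k / 1"
      using k by (intro frac_le) auto
    then show ?thesis by (simp add: emission_def)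
  qed (simp add: emission_def)
qed

lemma emitted_bounds: "0 \<le> emitted h i \<omega>" "emitted h i \<omega> \<le> real i * real k"
  unfolding emitted_def using emission_bounds
  by (auto intro!: sum_nonneg sum_bounded_above[of "{..<i}", simplified])

lemma emitted_mono: "i \<le> j \<Longrightarrow> emitted h i \<omega> \<le> emitted h j \<omega>"
  unfolding emitted_def using emission_bounds by (intro sum_mono2) auto

lemma bounded_integrable:
  assumes "f \<in> borel_measurable P" "\<And>\<omega>. \<omega> \<in> space P \<Longrightarrow> \<bar>f \<omega>\<bar> \<le> (B::real)"
  shows "integrable P f"
  by (rule integrable_const_bound[where B = B]) (use assms in auto)

text \<open>The history of the chain before cell \<open>i\<close>, and the increments during cell \<open>i\<close>. Their independence
  is the Markov property of the chain.\<close>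

definition past :: "real \<Rightarrow> nat \<Rightarrow> 'a measure" where
  "past h i = sigma (space P) (\<Union>x\<in>insert (0, 0) ({..<i} \<times> {1..k}). cell_sets h x)"

definition cell :: "real \<Rightarrow> nat \<Rightarrow> 'a measure" where
  "cell h i = sigma (space P) (\<Union>x\<in>{i} \<times> {1..k}. cell_sets h x)"

context
  fixes h :: real
  assumes h: "0 < h"
begin

private lemma h0: "0 \<le> h" using h by simp

lemma cell_sets_Pow: "snd x \<in> {0..k} \<Longrightarrow> cell_sets h x \<subseteq> Pow (space P)"
  using cell_sets_events[OF h0, of x] sets.space_closed by blast

lemma past_Pow: "(\<Union>x\<in>insert (0, 0) ({..<i} \<times> {1..k}). cell_sets h x) \<subseteq> Pow (space P)"
  by (intro UN_least cell_sets_Pow) auto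

lemma cell_Pow: "(\<Union>x\<in>{i} \<times> {1..k}. cell_sets h x) \<subseteq> Pow (space P)"
  by (intro UN_least cell_sets_Pow) auto

lemma space_past: "space (past h i) = space P" and space_cell: "space (cell h i) = space P"
  by (simp_all add: past_def cell_def space_measure_of_conv)

lemma sets_past: "sets (past h i) = sigma_sets (space P) (\<Union>x\<in>insert (0, 0) ({..<i} \<times> {1..k}). cell_sets h x)"
  unfolding past_def by (rule sets_measure_of[OF past_Pow])

lemma sets_cell: "sets (cell h i) = sigma_sets (space P) (\<Union>x\<in>{i} \<times> {1..k}. cell_sets h x)"
  unfolding cell_def by (rule sets_measure_of[OF cell_Pow])

lemma past_sub_events: "sets (past h i) \<subseteq> events"
  unfolding sets_past
proof (rule sets.sigma_sets_subset, rule UN_least)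
  fix x assume "x \<in> insert (0, 0) ({..<i} \<times> {1..k})"
  then show "cell_sets h x \<subseteq> events" by (intro cell_sets_events[OF h0]) auto
qed

lemma cell_sub_events: "sets (cell h i) \<subseteq> events"
  unfolding sets_cell
proof (rule sets.sigma_sets_subset, rule UN_least)
  fix x assume "x \<in> {i} \<times> {1..k}"
  then show "cell_sets h x \<subseteq> events" by (intro cell_sets_events[OF h0]) auto
qed

lemma past_measurable: "f \<in> past h i \<rightarrow>\<^sub>M C \<Longrightarrow> f \<in> P \<rightarrow>\<^sub>M C"
  by (rule measurable_larger_source[OF _ past_sub_events space_past])

lemma cell_measurable: "f \<in> cell h i \<rightarrow>\<^sub>M C \<Longrightarrow> f \<in> P \<rightarrow>\<^sub>M C"
  by (rule measurable_larger_source[OF _ cell_sub_events space_cell])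

lemma past_mono: "f \<in> past h i \<rightarrow>\<^sub>M C \<Longrightarrow> i \<le> i' \<Longrightarrow> f \<in> past h i' \<rightarrow>\<^sub>M C"
  by (rule measurable_larger_source[of _ "past h i"])
    (auto simp: space_past sets_past intro!: sigma_sets_mono')

lemma past_cell_indep: "indep_set (sets (past h i)) (sets (cell h i))"
proof -
  let ?I = "\<lambda>b. if b then insert (0, 0) ({..<i} \<times> {1..k}) else {i} \<times> {1..k}"
  have "indep_sets (\<lambda>b. sigma_sets (space P) (\<Union>x\<in>?I b. cell_sets h x)) UNIV"
  proof (rule indep_sets_collect_sigma)
    show "indep_sets (cell_sets h) (\<Union>b\<in>UNIV. ?I b)"
      by (rule indep_sets_mono_index[OF _ cell_sets_indep[OF h0, of "Suc i"]]) (auto split: if_splits)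
    show "disjoint_family_on ?I UNIV"
      by (auto simp: disjoint_family_on_def)
    fix b x
    show "Int_stable (cell_sets h x)"
    proof (cases "snd x = 0")
      case True
      then show ?thesis by (auto simp: cell_sets_def intro!: Int_stableI sets.Int)
    next
      case False
      have "\<exists>C. (X -` A \<inter> space P) \<inter> (X -` B \<inter> space P) = X -` C \<inter> space P" for X :: "'a \<Rightarrow> nat" and A B
        by (intro exI[of _ "A \<inter> B"]) auto
      then show ?thesis using False unfolding cell_sets_def Int_stable_def by fastforce
    qed
  qed
  moreover have "(\<lambda>b. sigma_sets (space P) (\<Union>x\<in>?I b. cell_sets h x)) =
      case_bool (sets (past h i)) (sets (cell h i))"
    by (auto simp: fun_eq_iff sets_past sets_cell split: bool.split)
  ultimately show ?thesis by (simp add: indep_set_def)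
qed

lemma increment_cell_measurable:
  assumes "j \<in> {1..k}"
  shows "increment h i j \<in> cell h i \<rightarrow>\<^sub>M count_space UNIV"
proof (rule measurableI)
  fix A :: "nat set"
  have "increment h i j -` A \<inter> space P \<in> cell_sets h (i, j)"
    using assms by (auto simp: cell_sets_def)
  then have "increment h i j -` A \<inter> space P \<in> (\<Union>x\<in>{i} \<times> {1..k}. cell_sets h x)" using assms by blast
  then show "increment h i j -` A \<inter> space (cell h i) \<in> sets (cell h i)"
    unfolding space_cell sets_cell by (rule sigma_sets.Basic)
qed simp

lemma increment_past_measurable:
  assumes "j \<in> {1..k}" "l < i"
  shows "increment h l j \<in> past h i \<rightarrow>\<^sub>M count_space UNIV"
proof (rule measurableI)
  fix A :: "nat set"
  have "increment h l j -` A \<inter> space P \<in> cell_sets h (l, j)"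
    using assms by (auto simp: cell_sets_def)
  then have "increment h l j -` A \<inter> space P \<in> (\<Union>x\<in>insert (0, 0) ({..<i} \<times> {1..k}). cell_sets h x)"
    using assms by blast
  then show "increment h l j -` A \<inter> space (past h i) \<in> sets (past h i)"
    unfolding space_past sets_past by (rule sigma_sets.Basic)
qed simp

lemma start_mass_measurable:
  assumes "x \<in> {1..k}"
  shows "M x 0 \<in> borel_measurable (past h i)"
proof (rule measurable_larger_source)
  let ?V = "vimage_algebra (space P) (state k M 0) (state_space k)"
  have sp: "state k M 0 \<in> ?V \<rightarrow>\<^sub>M state_space k"
    by (rule measurable_vimage_algebra1) (auto simp: state_def space_PiM)
  have "(\<lambda>\<omega>. state k M 0 \<omega> x) \<in> borel_measurable ?V"
    by (rule measurable_compose[OF sp measurable_component_singleton[OF assms]])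
  then show "M x 0 \<in> borel_measurable ?V" using assms by (simp add: state_def)
  have "sets ?V = cell_sets h (0, 0)" by (simp add: cell_sets_def)
  then show "sets ?V \<subseteq> sets (past h i)" unfolding sets_past by (auto intro!: sigma_sets.Basic)
  show "space ?V = space (past h i)" by (simp add: space_past)
qed

lemma start_measurable: "x \<in> {1..k} \<Longrightarrow> (\<lambda>\<omega>. start \<omega> x) \<in> borel_measurable (past h i)"
proof -
  assume x: "x \<in> {1..k}"
  have [measurable]: "\<And>x. x \<in> {1..k} \<Longrightarrow> M x 0 \<in> borel_measurable (past h i)"
    by (rule start_mass_measurable)
  have [measurable]: "Measurable.pred (past h i) (\<lambda>\<omega>. (\<lambda>x. M x 0 \<omega>) \<in> mass_simplex k)"
    unfolding mass_simplex_def mem_Collect_eq by (intro pred_intros_logic pred_intros_finite) measurable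
  have "(\<lambda>\<omega>. start \<omega> x) = (\<lambda>\<omega>. if (\<lambda>x. M x 0 \<omega>) \<in> mass_simplex k then M x 0 \<omega> else 1)"
    by (auto simp: start_def)
  then show ?thesis using x by simp
qed

lemma single_cell_measurable: "Measurable.pred (cell h i) (single h i j)"
proof -
  have [measurable]: "\<And>x. x \<in> {1..k} \<Longrightarrow> increment h i x \<in> cell h i \<rightarrow>\<^sub>M count_space UNIV"
    by (rule increment_cell_measurable)
  show ?thesis unfolding single_def[abs_def] by (intro pred_intros_finite) measurable
qed

lemma single_past_measurable: "l < i \<Longrightarrow> Measurable.pred (past h i) (single h l j)"
proof -
  assume "l < i"
  then have [measurable]: "\<And>x. x \<in> {1..k} \<Longrightarrow> increment h l x \<in> past h i \<rightarrow>\<^sub>M count_space UNIV"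
    by (rule increment_past_measurable[rotated])
  show ?thesis unfolding single_def[abs_def] by (intro pred_intros_finite) measurable
qed

lemma chain_measurable: "x \<in> {1..k} \<Longrightarrow> (\<lambda>\<omega>. chain h i \<omega> x) \<in> borel_measurable (past h i)"
proof (induction i arbitrary: x)
  case 0
  then show ?case using start_measurable by simp
next
  case (Suc i)
  have [measurable]: "\<And>x. x \<in> {1..k} \<Longrightarrow> (\<lambda>\<omega>. chain h i \<omega> x) \<in> borel_measurable (past h (Suc i))"
    using past_mono[OF Suc.IH, of _ "Suc i"] by simp
  have [measurable]: "\<And>j. Measurable.pred (past h (Suc i)) (single h i j)"
    by (rule single_past_measurable) simp
  have "(\<lambda>\<omega>. chain h (Suc i) \<omega> x) = (\<lambda>\<omega>. chain h i \<omega> x +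
      (\<Sum>j=1..k. if single h i j \<omega> then (if x = j then 0 else chain h i \<omega> x + chain h i \<omega> j / (real k - 1)) - chain h i \<omega> x else 0))"
  proof
    fix \<omega>
    show "chain h (Suc i) \<omega> x = chain h i \<omega> x +
      (\<Sum>j=1..k. if single h i j \<omega> then (if x = j then 0 else chain h i \<omega> x + chain h i \<omega> j / (real k - 1)) - chain h i \<omega> x else 0)"
    proof -
      have "chain h (Suc i) \<omega> x = chain h i \<omega> x + (\<Sum>j=1..k. if single h i j \<omega>
          then meteor_jump k j (chain h i \<omega>) x - meteor_jump k 0 (chain h i \<omega>) x else 0)"
        using site_sum[of "\<lambda>j. meteor_jump k j (chain h i \<omega>) x" h i \<omega>]
        by (simp add: meteor_jump_def[of k 0])
      also have "(\<Sum>j=1..k. if single h i j \<omega>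
          then meteor_jump k j (chain h i \<omega>) x - meteor_jump k 0 (chain h i \<omega>) x else 0) =
        (\<Sum>j=1..k. if single h i j \<omega> then (if x = j then 0 else chain h i \<omega> x + chain h i \<omega> j / (real k - 1)) - chain h i \<omega> x else 0)"
        by (intro sum.cong refl) (auto simp: meteor_jump_def)
      finally show ?thesis .
    qed
  qed
  then show ?case using Suc.prems by simp
qed

lemma emission_sum:
  "emission h i \<omega> = (\<Sum>j=1..k. if single h i j \<omega> then chain h i \<omega> j / (real k - 1) else 0)"
proof -
  let ?G = "\<lambda>j. if j = 0 then 0 else chain h i \<omega> j / (real k - 1)"
  have "emission h i \<omega> = ?G (site h i \<omega>)" by (simp add: emission_def)
  also have "\<dots> = ?G 0 + (\<Sum>j=1..k. if single h i j \<omega> then ?G j - ?G 0 else 0)" by (rule site_sum)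
  also have "(\<Sum>j=1..k. if single h i j \<omega> then ?G j - ?G 0 else 0) =
      (\<Sum>j=1..k. if single h i j \<omega> then chain h i \<omega> j / (real k - 1) else 0)"
    by (intro sum.cong refl) auto
  finally show ?thesis by simp
qed

lemma emitted_measurable: "emitted h i \<in> borel_measurable (past h i)"
proof -
  have "emission h l \<in> borel_measurable (past h i)" if l: "l < i" for l
  proof -
    have [measurable]: "\<And>x. x \<in> {1..k} \<Longrightarrow> (\<lambda>\<omega>. chain h l \<omega> x) \<in> borel_measurable (past h i)"
      using past_mono[OF chain_measurable, of _ l i] l by simp
    have [measurable]: "\<And>j. Measurable.pred (past h i) (single h l j)"
      using l by (rule single_past_measurable)
    show ?thesis unfolding emission_sum[abs_def] by measurable
  qed
  then show ?thesis unfolding emitted_def[abs_def] by (intro borel_measurable_sum) auto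
qed

lemma prob_increments:
  "prob {\<omega> \<in> space P. \<forall>x\<in>{1..k}. increment h i x \<omega> = a x} =
    (\<Prod>x=1..k. h ^ a x / fact (a x) * exp (- h))"
proof -
  define A where "A x = {\<omega> \<in> space P. increment h i (snd x) \<omega> = a (snd x)}" for x :: "nat \<times> nat"
  have A: "A x \<in> cell_sets h x" if "x \<in> {i} \<times> {1..k}" for x
  proof -
    have "A x = increment h (fst x) (snd x) -` {a (snd x)} \<inter> space P"
      using that by (auto simp: A_def)
    moreover have "snd x \<noteq> 0" using that by auto
    ultimately show ?thesis unfolding cell_sets_def by auto
  qed
  have ne: "{i} \<times> {1..k} \<noteq> {}" using k by auto
  have "{\<omega> \<in> space P. \<forall>x\<in>{1..k}. increment h i x \<omega> = a x} = (\<Inter>x\<in>{i} \<times> {1..k}. A x)"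
  proof -
    have "1 \<in> {1..k}" using k by simp
    then show ?thesis unfolding A_def by force
  qed
  also have "prob \<dots> = (\<Prod>x\<in>{i} \<times> {1..k}. prob (A x))"
    by (rule indep_setsD[OF cell_sets_indep[OF h0, of "Suc i"]]) (use A ne in auto)
  also have "\<dots> = (\<Prod>y=1..k. prob (A (i, y)))"
    by (rule prod.reindex_bij_witness[of _ "\<lambda>y. (i, y)" snd]) auto
  also have "\<dots> = (\<Prod>y=1..k. h ^ a y / fact (a y) * exp (- h))"
  proof (rule prod.cong[OF refl])
    fix y assume y: "y \<in> {1..k}"
    have lt: "real i * h < real (Suc i) * h" using h by simp
    have d: "real (Suc i) * h - real i * h = h" by (simp add: algebra_simps)
    have "0 \<le> real i * h" using h by simp
    from poisson_increment_eq[OF clock[OF y] this lt, of "a y"]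
    show "prob (A (i, y)) = h ^ a y / fact (a y) * exp (- h)"
      unfolding A_def increment_def snd_conv d .
  qed
  finally show ?thesis .
qed

lemma exp_power_k: "exp (- h) ^ k = exp (- (real k * h))"
  by (simp add: exp_of_nat_mult[symmetric])

lemma prob_single:
  assumes j: "j \<in> {1..k}"
  shows "prob {\<omega> \<in> space P. single h i j \<omega>} = h * exp (- (real k * h))"
proof -
  have "(\<Prod>x=1..k. h ^ (if x = j then 1 else 0) / fact (if x = j then 1 else 0) * exp (- h)) =
      (\<Prod>x=1..k. (if x = j then h else 1) * exp (- h))"
    by (intro prod.cong) auto
  also have "\<dots> = h * exp (- h) ^ k" using j by (simp add: prod.distrib)
  finally show ?thesis
    using prob_increments[of i "\<lambda>x. if x = j then 1 else 0"] by (simp add: single_def exp_power_k)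
qed

lemma prob_silent:
  "prob {\<omega> \<in> space P. \<forall>j\<in>{1..k}. increment h i j \<omega> = 0} = exp (- (real k * h))"
  using prob_increments[of i "\<lambda>x. 0"] exp_power_k by simp

lemma expectation_single:
  assumes j: "j \<in> {1..k}" and f: "f \<in> borel_measurable (past h i)"
    and B: "\<And>\<omega>. \<omega> \<in> space P \<Longrightarrow> \<bar>f \<omega>\<bar> \<le> B"
  shows "expectation (\<lambda>\<omega>. if single h i j \<omega> then f \<omega> else 0) = h * exp (- (real k * h)) * expectation f"
    (is "_ = ?p * _")
proof -
  define g :: "'a \<Rightarrow> real" where "g \<omega> = of_bool (single h i j \<omega>)" for \<omega>
  have gc: "g \<in> borel_measurable (cell h i)"
    unfolding g_def[abs_def] using single_cell_measurable by measurable
  note fP = past_measurable[OF f] and gP = cell_measurable[OF gc]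
  have indep: "indep_var borel f borel g"
    unfolding indep_var_eq
  proof (intro conjI fP gP)
    have "{f -` A \<inter> space P |A. A \<in> sets borel} \<subseteq> sets (past h i)"
      using measurable_sets[OF f] by (auto simp: space_past)
    then have "sigma_sets (space P) {f -` A \<inter> space P |A. A \<in> sets borel} \<subseteq> sets (past h i)"
      using sets.sigma_sets_subset[of _ "past h i"] by (simp only: space_past)
    moreover have "{g -` A \<inter> space P |A. A \<in> sets borel} \<subseteq> sets (cell h i)"
      using measurable_sets[OF gc] by (auto simp: space_cell)
    then have "sigma_sets (space P) {g -` A \<inter> space P |A. A \<in> sets borel} \<subseteq> sets (cell h i)"
      using sets.sigma_sets_subset[of _ "cell h i"] by (simp only: space_cell)
    ultimately show "indep_set (sigma_sets (space P) {f -` A \<inter> space P |A. A \<in> sets borel})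
        (sigma_sets (space P) {g -` A \<inter> space P |A. A \<in> sets borel})"
      using past_cell_indep[of i] unfolding indep_sets2_eq by blast
  qed
  have "expectation (\<lambda>\<omega>. if single h i j \<omega> then f \<omega> else 0) = expectation (\<lambda>\<omega>. f \<omega> * g \<omega>)"
    by (intro Bochner_Integration.integral_cong) (auto simp: g_def)
  also have "\<dots> = expectation f * expectation g"
    by (rule indep_var_lebesgue_integral[OF indep])
      (use bounded_integrable[OF fP B] bounded_integrable[OF gP, of 1] in \<open>auto simp: g_def\<close>)
  also have "expectation g = prob {\<omega> \<in> space P. single h i j \<omega>}"
  proof -
    have "{\<omega> \<in> space P. single h i j \<omega>} \<in> events"
      using cell_measurable[OF single_cell_measurable, of i j] by measurable
    moreover have "expectation g = expectation (indicator {\<omega> \<in> space P. single h i j \<omega>})"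
      by (intro Bochner_Integration.integral_cong) (auto simp: g_def indicator_def)
    ultimately show ?thesis by simp
  qed
  finally show ?thesis using prob_single[OF j] by simp
qed

text \<open>The one-step identity behind both moment computations: a functional of the chain that changes by
  \<open>W j\<close> when vertex \<open>j\<close> is hit changes in expectation by \<open>h exp (- k h)\<close>, the probability of a hit
  at a given vertex, times the expected sum of the \<open>W j\<close>.\<close>

lemma expectation_step:
  assumes Z: "Z \<in> borel_measurable (past h i)" "\<And>\<omega>. \<omega> \<in> space P \<Longrightarrow> \<bar>Z \<omega>\<bar> \<le> B"
    and W: "\<And>j. j \<in> {1..k} \<Longrightarrow> W j \<in> borel_measurable (past h i)"
      "\<And>j \<omega>. j \<in> {1..k} \<Longrightarrow> \<omega> \<in> space P \<Longrightarrow> \<bar>W j \<omega>\<bar> \<le> B"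
  shows "expectation (\<lambda>\<omega>. Z \<omega> + (\<Sum>j=1..k. if single h i j \<omega> then W j \<omega> else 0)) =
    expectation Z + h * exp (- (real k * h)) * expectation (\<lambda>\<omega>. \<Sum>j=1..k. W j \<omega>)"
proof -
  have WP: "W j \<in> borel_measurable P" if "j \<in> {1..k}" for j using past_measurable[OF W(1)[OF that]] .
  have int_W: "integrable P (W j)" if "j \<in> {1..k}" for j
    by (rule bounded_integrable[OF WP[OF that] W(2)[OF that]])
  have int_Z: "integrable P Z" by (rule bounded_integrable[OF past_measurable[OF Z(1)] Z(2)])
  have int_S: "integrable P (\<lambda>\<omega>. if single h i j \<omega> then W j \<omega> else 0)" if j: "j \<in> {1..k}" for j
  proof (rule bounded_integrable)
    show "(\<lambda>\<omega>. if single h i j \<omega> then W j \<omega> else 0) \<in> borel_measurable P"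
      using cell_measurable[OF single_cell_measurable, of i j] WP[OF j] by measurable
    show "\<bar>if single h i j \<omega> then W j \<omega> else 0\<bar> \<le> B" if "\<omega> \<in> space P" for \<omega>
      using W(2)[OF j that] by auto
  qed
  have "expectation (\<lambda>\<omega>. Z \<omega> + (\<Sum>j=1..k. if single h i j \<omega> then W j \<omega> else 0)) =
      expectation Z + (\<Sum>j=1..k. expectation (\<lambda>\<omega>. if single h i j \<omega> then W j \<omega> else 0))"
    by (simp only: Bochner_Integration.integral_add[OF int_Z Bochner_Integration.integrable_sum[OF int_S]]
        Bochner_Integration.integral_sum[OF int_S])
  also have "(\<Sum>j=1..k. expectation (\<lambda>\<omega>. if single h i j \<omega> then W j \<omega> else 0)) =
      (\<Sum>j=1..k. h * exp (- (real k * h)) * expectation (W j))"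
    by (intro sum.cong refl expectation_single[where B = B] W)
  also have "\<dots> = h * exp (- (real k * h)) * expectation (\<lambda>\<omega>. \<Sum>j=1..k. W j \<omega>)"
    by (simp only: sum_distrib_left[symmetric] Bochner_Integration.integral_sum[OF int_W])
  finally show ?thesis .
qed

end

end

context stationary_meteor
begin

section \<open>The second moment of the stationary distribution\<close>

lemma meteor_jump_0: "meteor_jump k 0 m = m"
  by (simp add: meteor_jump_def fun_eq_iff)

text \<open>The affine equation for the generator turns into a linear recursion for the deviation of the
  expectation from its fixed point \<open>2 k\<close>.\<close>

lemma expectation_square_sum_Suc:
  assumes h: "0 < h"
  shows "expectation (\<lambda>\<omega>. square_sum k (chain h (Suc i) \<omega>)) - 2 * real k =
    (1 - h * exp (- (real k * h)) * (real k / (real k - 1))) *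
      (expectation (\<lambda>\<omega>. square_sum k (chain h i \<omega>)) - 2 * real k)"
proof -
  let ?p = "h * exp (- (real k * h))"
  let ?V = "\<lambda>\<omega>. square_sum k (chain h i \<omega>)"
  let ?W = "\<lambda>j \<omega>. square_sum k (meteor_jump k j (chain h i \<omega>)) - ?V \<omega>"
  note [measurable] = chain_measurable[OF h, where i = i]
  have V_meas: "?V \<in> borel_measurable (past h i)"
    unfolding square_sum_def by measurable
  have W_meas: "?W j \<in> borel_measurable (past h i)" if "j \<in> {1..k}" for j
  proof -
    have [measurable]: "(\<lambda>\<omega>. meteor_jump k j (chain h i \<omega>) x) \<in> borel_measurable (past h i)" if "x \<in> {1..k}" for x
      using \<open>j \<in> {1..k}\<close> that unfolding meteor_jump_def by measurable
    have "(\<lambda>\<omega>. square_sum k (meteor_jump k j (chain h i \<omega>))) \<in> borel_measurable (past h i)"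
      unfolding square_sum_def by measurable
    then show ?thesis using V_meas by measurable
  qed
  have V_bound: "\<bar>?V \<omega>\<bar> \<le> (real k)\<^sup>2" for \<omega>
    using square_sum_bounds[OF chain_simplex, of h i \<omega>] by simp
  have W_bound: "\<bar>?W j \<omega>\<bar> \<le> (real k)\<^sup>2" if "j \<in> {1..k}" for j \<omega>
    using square_sum_bounds[OF chain_simplex, of h i \<omega>]
      square_sum_bounds[OF meteor_jump_simplex[OF k chain_simplex that], of h i \<omega>] by simp
  have "square_sum k (chain h (Suc i) \<omega>) = ?V \<omega> + (\<Sum>j=1..k. if single h i j \<omega> then ?W j \<omega> else 0)" for \<omega>
    using site_sum[of "\<lambda>j. square_sum k (meteor_jump k j (chain h i \<omega>))" h i \<omega>]
    by (simp only: meteor_jump_0 chain.simps)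
  then have "expectation (\<lambda>\<omega>. square_sum k (chain h (Suc i) \<omega>)) =
      expectation (\<lambda>\<omega>. ?V \<omega> + (\<Sum>j=1..k. if single h i j \<omega> then ?W j \<omega> else 0))" by simp
  also have "\<dots> = expectation ?V + ?p * expectation (\<lambda>\<omega>. \<Sum>j=1..k. ?W j \<omega>)"
    by (rule expectation_step[OF h V_meas V_bound W_meas W_bound])
  also have "(\<lambda>\<omega>. \<Sum>j=1..k. ?W j \<omega>) =
      (\<lambda>\<omega>. 2 * (real k)\<^sup>2 / (real k - 1) - real k / (real k - 1) * ?V \<omega>)"
    by (rule ext) (rule square_sum_generator[OF k chain_simplex])
  also have "expectation (\<lambda>\<omega>. 2 * (real k)\<^sup>2 / (real k - 1) - real k / (real k - 1) * ?V \<omega>) =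
      2 * (real k)\<^sup>2 / (real k - 1) - real k / (real k - 1) * expectation ?V"
    using bounded_integrable[OF past_measurable[OF h V_meas] V_bound]
    by (simp add: prob_space)
  also have "\<dots> = real k / (real k - 1) * (2 * real k - expectation ?V)"
    by (simp add: right_diff_distrib power2_eq_square)
  finally show ?thesis by (simp add: algebra_simps)
qed

lemma expectation_square_sum_power:
  assumes h: "0 < h"
  shows "expectation (\<lambda>\<omega>. square_sum k (chain h i \<omega>)) - 2 * real k =
    (1 - h * exp (- (real k * h)) * (real k / (real k - 1))) ^ i *
      (expectation (\<lambda>\<omega>. square_sum k (start \<omega>)) - 2 * real k)"
proof (induction i)
  case (Suc i)
  show ?case unfolding expectation_square_sum_Suc[OF h] Suc.IH by (simp only: power_Suc mult.assoc)
qed simp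

definition good :: "real \<Rightarrow> nat \<Rightarrow> 'a set" where
  "good h n = {\<omega> \<in> space P. \<forall>i<n.
     (\<forall>j\<in>{1..k}. increment h i j \<omega> = 0) \<or> (\<exists>j\<in>{1..k}. single h i j \<omega>)}"

lemma good_event:
  assumes h: "0 < h"
  shows "good h n \<in> events"
proof -
  have [measurable]: "\<And>i j. j \<in> {1..k} \<Longrightarrow> increment h i j \<in> P \<rightarrow>\<^sub>M count_space UNIV"
    using h by (intro increment_measurable) auto
  have [measurable]: "\<And>i j. Measurable.pred P (single h i j)"
    by (rule cell_measurable[OF h single_cell_measurable[OF h]])
  have "Measurable.pred P (\<lambda>\<omega>. \<forall>i\<in>{..<n}.
     (\<forall>j\<in>{1..k}. increment h i j \<omega> = 0) \<or> (\<exists>j\<in>{1..k}. single h i j \<omega>))"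
    by (intro pred_intros_finite pred_intros_logic) measurable
  then show ?thesis unfolding good_def by (simp add: pred_def)
qed

text \<open>A cell has no ring at all or a single one with probability \<open>(1 + x) exp (- x) \<ge> 1 - x\<^sup>2\<close>, where
  \<open>x = k h\<close> is the rate of all clocks together times the length of the cell.\<close>

lemma prob_good:
  assumes h: "0 < h"
  shows "1 - real n * (real k * h)\<^sup>2 \<le> prob (good h n)"
proof -
  let ?x = "real k * h"
  define G where "G i = {\<omega> \<in> space P. \<forall>j\<in>{1..k}. increment h i j \<omega> = 0} \<union>
    (\<Union>j\<in>{1..k}. {\<omega> \<in> space P. single h i j \<omega>})" for i
  have [measurable]: "\<And>i j. j \<in> {1..k} \<Longrightarrow> increment h i j \<in> P \<rightarrow>\<^sub>M count_space UNIV"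
    using h by (intro increment_measurable) auto
  have ev1: "{\<omega> \<in> space P. \<forall>j\<in>{1..k}. increment h i j \<omega> = 0} \<in> events" for i
    by measurable
  have ev2: "{\<omega> \<in> space P. single h i j \<omega>} \<in> events" for i j
    using cell_measurable[OF h single_cell_measurable[OF h], of i j] by (simp add: pred_def)
  have Gev: "G i \<in> events" for i unfolding G_def using ev1 ev2 by (intro sets.Un sets.finite_UN) auto
  have Gp: "1 - ?x\<^sup>2 \<le> prob (G i)" for i
  proof -
    have "prob (G i) = prob {\<omega> \<in> space P. \<forall>j\<in>{1..k}. increment h i j \<omega> = 0} +
        prob (\<Union>j\<in>{1..k}. {\<omega> \<in> space P. single h i j \<omega>})"
      unfolding G_def
    proof (rule finite_measure_Union)
      show "{\<omega> \<in> space P. \<forall>j\<in>{1..k}. increment h i j \<omega> = 0} \<inter>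
          (\<Union>j\<in>{1..k}. {\<omega> \<in> space P. single h i j \<omega>}) = {}"
        by (auto simp: single_def)
    qed (use ev1 ev2 in auto)
    also have "prob (\<Union>j\<in>{1..k}. {\<omega> \<in> space P. single h i j \<omega>}) =
        (\<Sum>j=1..k. prob {\<omega> \<in> space P. single h i j \<omega>})"
    proof (rule finite_measure_finite_Union)
      show "disjoint_family_on (\<lambda>j. {\<omega> \<in> space P. single h i j \<omega>}) {1..k}"
        unfolding disjoint_family_on_def using single_unique by blast
    qed (use ev2 in auto)
    also have "\<dots> = (\<Sum>j=1..k. h * exp (- ?x))" by (intro sum.cong refl prob_single[OF h])
    also have "prob {\<omega> \<in> space P. \<forall>j\<in>{1..k}. increment h i j \<omega> = 0} = exp (- ?x)" by (rule prob_silent[OF h])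
    finally have "prob (G i) = (1 + ?x) * exp (- ?x)" by (simp add: algebra_simps)
    moreover have "(1 + ?x) * (1 - ?x) \<le> (1 + ?x) * exp (- ?x)"
      using exp_ge_add_one_self[of "- ?x"] h by (intro mult_left_mono) auto
    ultimately show ?thesis by (simp add: power2_eq_square algebra_simps)
  qed
  have "space P - good h n = (\<Union>i<n. space P - G i)"
    by (auto simp: good_def G_def)
  then have "prob (space P - good h n) \<le> (\<Sum>i<n. prob (space P - G i))"
    using Gev by (simp only:) (intro measure_UNION_le, auto)
  also have "\<dots> \<le> (\<Sum>i<n. ?x\<^sup>2)"
  proof (rule sum_mono)
    fix i show "prob (space P - G i) \<le> ?x\<^sup>2" using Gp[of i] prob_compl[OF Gev, of i] by linarith
  qed
  finally have "prob (space P - good h n) \<le> real n * ?x\<^sup>2" by simp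
  then show ?thesis using prob_compl[OF good_event[OF h, of n]] by simp
qed

lemma chain_eq_mass:
  assumes h: "0 < h" and \<omega>: "\<omega> \<in> good h n"
    and path: "meteor_path k (\<lambda>j t. N j t \<omega>) (\<lambda>j t. M j t \<omega>)"
    and st: "(\<lambda>x. M x 0 \<omega>) \<in> mass_simplex k"
    and i: "i \<le> n" and x: "x \<in> {1..k}"
  shows "M x (real i * h) \<omega> = chain h i \<omega> x"
  using i x
proof (induction i arbitrary: x)
  case 0
  then show ?case using st by (simp add: start_def)
next
  case (Suc i)
  have IH: "M y (real i * h) \<omega> = chain h i \<omega> y" if "y \<in> {1..k}" for y using Suc that by simp
  let ?s = "real i * h" and ?t = "real (Suc i) * h"
  have st: "0 \<le> ?s" "?s < ?t" using h by auto
  have mono: "N j ?s \<omega> \<le> N j ?t \<omega>" if "j \<in> {1..k}" for j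
    using counting_path_mono[OF meteor_path_counting[OF path that], of ?s ?t] st by simp
  consider "\<forall>j\<in>{1..k}. increment h i j \<omega> = 0" | j where "j \<in> {1..k}" "single h i j \<omega>"
  proof -
    have "(\<forall>j\<in>{1..k}. increment h i j \<omega> = 0) \<or> (\<exists>j\<in>{1..k}. single h i j \<omega>)"
      using \<omega> Suc.prems(1) unfolding good_def by simp
    then show thesis using that by blast
  qed
  then show ?case
  proof cases
    case 1
    have "site h i \<omega> = 0"
      by (rule site_none) (use 1 in \<open>auto simp: single_def\<close>)
    moreover have "M x ?t \<omega> = M x ?s \<omega>"
    proof (rule meteor_path_constant[OF path st(1) _ _ Suc.prems(2)])
      show "N j ?s \<omega> = N j ?t \<omega>" if "j \<in> {1..k}" for j
        using 1 that mono[OF that] unfolding increment_def by force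
    qed (use st in simp)
    ultimately show ?thesis using IH[OF Suc.prems(2)] by (simp add: meteor_jump_0)
  next
    case 2
    have inc: "increment h i y \<omega> = (if y = j then 1 else 0)" if "y \<in> {1..k}" for y
      using 2(2) that unfolding single_def by blast
    have "M x ?t \<omega> = meteor_jump k j (\<lambda>x. M x ?s \<omega>) x"
    proof (rule meteor_path_single_jump[OF path st 2(1) _ _ Suc.prems(2)])
      show "N j ?t \<omega> = Suc (N j ?s \<omega>)"
        using inc[OF 2(1)] mono[OF 2(1)] unfolding increment_def by simp
      show "N y ?s \<omega> = N y ?t \<omega>" if "y \<in> {1..k}" "y \<noteq> j" for y
        using inc[OF that(1)] mono[OF that(1)] that(2) unfolding increment_def by simp
    qed
    then show ?thesis
      using IH[OF Suc.prems(2)] IH[OF 2(1)] by (simp add: site_eq[OF 2] meteor_jump_def)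
  qed
qed

lemma square_sum_measurable: "square_sum k \<in> borel_measurable (state_space k)"
  unfolding square_sum_def[abs_def] by measurable

lemma square_sum_state: "square_sum k (state k M t \<omega>) = square_sum k (\<lambda>x. M x t \<omega>)"
  by (simp add: square_sum_def state_def)

text \<open>Conservation of mass is inherited from the initial law by stationarity.\<close>

lemma AE_mass_simplex:
  assumes t: "0 \<le> t"
  shows "AE \<omega> in P. (\<lambda>x. M x t \<omega>) \<in> mass_simplex k"
proof -
  have pred: "Measurable.pred (state_space k) (\<lambda>m. m \<in> mass_simplex k)"
    unfolding mass_simplex_def mem_Collect_eq by (intro pred_intros_logic pred_intros_finite) measurable
  have set: "{m \<in> space (state_space k). m \<in> mass_simplex k} \<in> sets (state_space k)"
    using pred by (simp add: pred_def)
  have eq: "state k M t \<omega> \<in> mass_simplex k \<longleftrightarrow> (\<lambda>x. M x t \<omega>) \<in> mass_simplex k" for t \<omega>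
    by (simp add: state_def mass_simplex_def)
  have "AE m in distr P (state_space k) (state k M 0). m \<in> mass_simplex k"
    using AE_start by (subst AE_distr_iff[OF state_measurable set]) (simp_all add: eq)
  then have "AE m in distr P (state_space k) (state k M t). m \<in> mass_simplex k"
    using stationary[OF t] by (simp only:)
  then show ?thesis
    using t by (subst (asm) AE_distr_iff[OF state_measurable set]) (simp_all add: eq)
qed

lemma expectation_stationary:
  fixes f :: "(nat \<Rightarrow> real) \<Rightarrow> real"
  assumes f: "f \<in> borel_measurable (state_space k)" and t: "0 \<le> t"
  shows "expectation (\<lambda>\<omega>. f (state k M t \<omega>)) = expectation (\<lambda>\<omega>. f (state k M 0 \<omega>))"
  using integral_distr[OF state_measurable[OF t] f] integral_distr[OF state_measurable[of 0] f]
    stationary[OF t] by simp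

text \<open>The stationary second moment. Over the unit time interval the chain contracts the deviation
  from \<open>2 k\<close>, and stationarity makes the deviation at both ends equal, up to the probability that
  two clocks ring in the same cell, which vanishes as the cells shrink.\<close>

lemma expectation_square_sum_start: "expectation (\<lambda>\<omega>. square_sum k (start \<omega>)) = 2 * real k"
proof -
  define e where "e = expectation (\<lambda>\<omega>. square_sum k (start \<omega>)) - 2 * real k"
  define \<rho> where "\<rho> = exp (- exp (- 1 :: real))"
  have \<rho>: "\<rho> < 1" by (simp add: \<rho>_def)
  have key: "\<bar>e\<bar> * (1 - \<rho>) \<le> (real k) ^ 4 / real n" if n: "k \<le> n" for n
  proof -
    have n0: "0 < n" using n k by simp
    define h where "h = 1 / real n"
    have h: "0 < h" using n0 by (simp add: h_def)
    let ?V1 = "\<lambda>\<omega>. square_sum k (state k M 1 \<omega>)" and ?V0 = "\<lambda>\<omega>. square_sum k (state k M 0 \<omega>)"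
    let ?C = "\<lambda>\<omega>. square_sum k (chain h n \<omega>)"
    have C_meas: "?C \<in> borel_measurable P"
    proof (rule past_measurable[OF h])
      note [measurable] = chain_measurable[OF h, where i = n]
      show "?C \<in> borel_measurable (past h n)" unfolding square_sum_def by measurable
    qed
    have C_bound: "\<bar>?C \<omega>\<bar> \<le> (real k)\<^sup>2" for \<omega>
      using square_sum_bounds[OF chain_simplex, of h n \<omega>] by simp
    have int_C: "integrable P ?C" by (rule bounded_integrable[OF C_meas C_bound])
    have V1_meas: "?V1 \<in> borel_measurable P"
      by (rule measurable_compose[OF state_measurable square_sum_measurable]) simp
    have V1_bound: "AE \<omega> in P. 0 \<le> ?V1 \<omega> \<and> ?V1 \<omega> \<le> (real k)\<^sup>2"
      using AE_mass_simplex[of 1, simplified] by eventually_elim (simp add: square_sum_state square_sum_bounds)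
    have int_V1: "integrable P ?V1"
      by (rule integrable_const_bound[where B = "(real k)\<^sup>2"]) (use V1_bound V1_meas in auto)
    have "AE \<omega> in P. ?V0 \<omega> = square_sum k (start \<omega>)"
      using AE_start by eventually_elim (simp add: square_sum_state start_def)
    then have "expectation ?V0 = expectation (\<lambda>\<omega>. square_sum k (start \<omega>))"
    proof (rule integral_cong_AE[rotated 2])
      show "?V0 \<in> borel_measurable P"
        by (rule measurable_compose[OF state_measurable square_sum_measurable]) simp
      show "(\<lambda>\<omega>. square_sum k (start \<omega>)) \<in> borel_measurable P"
      proof (rule past_measurable[OF h])
        note [measurable] = start_measurable[OF h, where i = n]
        show "(\<lambda>\<omega>. square_sum k (start \<omega>)) \<in> borel_measurable (past h n)"
          unfolding square_sum_def by measurable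
      qed
    qed
    then have eV1: "expectation ?V1 = e + 2 * real k"
      using expectation_stationary[OF square_sum_measurable, of 1] by (simp add: e_def)
    have "AE \<omega> in P. \<bar>?V1 \<omega> - ?C \<omega>\<bar> \<le> (real k)\<^sup>2 * indicator (space P - good h n) \<omega>"
      using AE_meteor_path AE_start V1_bound AE_space
    proof eventually_elim
      case (elim \<omega>)
      show ?case
      proof (cases "\<omega> \<in> good h n")
        case True
        have "M x 1 \<omega> = chain h n \<omega> x" if "x \<in> {1..k}" for x
          using chain_eq_mass[OF h True elim(1,2) order_refl that] n0 by (simp add: h_def)
        then have "?V1 \<omega> = ?C \<omega>" by (simp add: square_sum_def state_def)
        then show ?thesis by simp
      next
        case False
        have "\<bar>?V1 \<omega> - ?C \<omega>\<bar> \<le> (real k)\<^sup>2"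
          using elim(3) square_sum_bounds[OF chain_simplex, of h n \<omega>] by linarith
        then show ?thesis using False elim(4) by simp
      qed
    qed
    moreover have ind: "integrable P (\<lambda>\<omega>. (real k)\<^sup>2 * indicator (space P - good h n) \<omega>)"
    proof (intro integrable_mult_right integrable_real_indicator)
      show "space P - good h n \<in> events" using good_event[OF h, of n] by auto
    qed (simp add: emeasure_eq_measure)
    ultimately have "expectation (\<lambda>\<omega>. \<bar>?V1 \<omega> - ?C \<omega>\<bar>) \<le>
        expectation (\<lambda>\<omega>. (real k)\<^sup>2 * indicator (space P - good h n) \<omega>)"
      using int_V1 int_C by (intro integral_mono_AE) auto
    also have "\<dots> = (real k)\<^sup>2 * prob (space P - good h n)"
      using good_event[OF h, of n] by simp
    also have "\<dots> \<le> (real k)\<^sup>2 * (real n * (real k * h)\<^sup>2)"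
      using prob_good[OF h, of n] prob_compl[OF good_event[OF h, of n]] by (intro mult_left_mono) auto
    also have "\<dots> = (real k) ^ 4 / real n"
      using n0 by (simp add: h_def power2_eq_square power4_eq_xxxx field_simps)
    finally have "\<bar>expectation ?V1 - expectation ?C\<bar> \<le> (real k) ^ 4 / real n"
      using integral_abs_bound[of P "\<lambda>\<omega>. ?V1 \<omega> - ?C \<omega>"] int_V1 int_C by simp
    moreover define r where "r = 1 - h * exp (- (real k * h)) * (real k / (real k - 1))"
    moreover have "expectation ?C = 2 * real k + r ^ n * e"
      using expectation_square_sum_power[OF h, of n] by (simp add: r_def e_def)
    ultimately have est: "\<bar>e - r ^ n * e\<bar> \<le> (real k) ^ 4 / real n" using eV1 by simp
    \<comment> \<open>For \<open>n \<ge> k\<close> the contraction factor over the \<open>n\<close> steps is at most \<open>\<rho>\<close>, uniformly in \<open>n\<close>.\<close>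
    have kk: "1 \<le> real k / (real k - 1)" "real k / (real k - 1) \<le> 2" using k by (auto simp: field_simps)
    have kh: "real k * h \<le> 1" using n n0 by (simp add: h_def)
    have e1: "exp (- 1) \<le> exp (- (real k * h))" using kh by simp
    have "h * exp (- (real k * h)) * (real k / (real k - 1)) \<le> h * 1 * 2"
      using h kk k by (intro mult_mono) auto
    also have "\<dots> \<le> 1" using n k by (simp add: h_def)
    finally have r0: "0 \<le> r" by (simp add: r_def)
    have "h * exp (- 1) * 1 \<le> h * exp (- (real k * h)) * (real k / (real k - 1))"
      using h kk e1 by (intro mult_mono) auto
    then have "r \<le> 1 + (- (h * exp (- 1)))" by (simp add: r_def)
    also have "\<dots> \<le> exp (- (h * exp (- 1)))" by (rule exp_ge_add_one_self)
    finally have "r ^ n \<le> exp (- (h * exp (- 1))) ^ n" using r0 by (rule power_mono)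
    also have "\<dots> = \<rho>" using n0 by (simp add: exp_of_nat_mult[symmetric] \<rho>_def h_def)
    finally have rn: "r ^ n \<le> \<rho>" .
    have "\<bar>e\<bar> * (1 - \<rho>) \<le> \<bar>e\<bar> * (1 - r ^ n)" using rn by (intro mult_left_mono) auto
    also have "\<dots> = \<bar>e - r ^ n * e\<bar>"
      using rn \<rho> abs_mult[of e "1 - r ^ n"] by (simp add: algebra_simps)
    finally show ?thesis using est by simp
  qed
  have "e = 0"
  proof (rule ccontr)
    assume "e \<noteq> 0"
    then have pos: "0 < \<bar>e\<bar> * (1 - \<rho>)" using \<rho> by simp
    obtain n0 :: nat where n0: "(real k) ^ 4 / (\<bar>e\<bar> * (1 - \<rho>)) < real n0" using reals_Archimedean2 by blast
    define n where "n = max n0 k"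
    have "(real k) ^ 4 / (\<bar>e\<bar> * (1 - \<rho>)) < real n" "0 < n" using n0 k by (auto simp: n_def)
    then have "(real k) ^ 4 / real n < \<bar>e\<bar> * (1 - \<rho>)" using pos by (simp add: field_simps)
    then show False using key[of n] by (simp add: n_def)
  qed
  then show ?thesis by (simp add: e_def)
qed

section \<open>The total emitted mass grows almost linearly\<close>

lemma expectation_square_sum:
  "0 < h \<Longrightarrow> expectation (\<lambda>\<omega>. square_sum k (chain h i \<omega>)) = 2 * real k"
  using expectation_square_sum_power[of h i] expectation_square_sum_start by simp

text \<open>Up to the drift \<open>p k / (k - 1)\<close> per cell, which does not depend on the state because the total
  mass is \<open>k\<close>, the emitted mass is a martingale. A step contributes at most the expected squared
  emission \<open>p E (square_sum) / (k - 1)\<^sup>2\<close>, and \<open>E (square_sum) = 2 k\<close>. Over a time interval of length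
  \<open>T\<close> this gives at most \<open>2 k T / (k - 1)\<^sup>2\<close>, which vanishes as \<open>k\<close> grows: this is the law of large
  numbers on which the theorem rests.\<close>

lemma emitted_second_moment:
  assumes h: "0 < h"
  defines "p \<equiv> h * exp (- (real k * h))"
  shows "expectation (\<lambda>\<omega>. (emitted h i \<omega> - real i * (p * real k / (real k - 1)))\<^sup>2) \<le>
    real i * (2 * p * real k / (real k - 1)\<^sup>2)"
proof (induction i)
  case 0
  then show ?case by (simp add: emitted_def)
next
  case (Suc i)
  let ?d = "real k - 1"
  define c where "c = p * real k / ?d"
  let ?B = "\<lambda>\<omega>. emitted h i \<omega> - real i * c"
  let ?Z = "\<lambda>\<omega>. (?B \<omega> - c)\<^sup>2"
  let ?W = "\<lambda>j \<omega>. 2 * (?B \<omega> - c) * (chain h i \<omega> j / ?d) + (chain h i \<omega> j / ?d)\<^sup>2"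
  have d: "1 \<le> ?d" using k by simp
  note [measurable] = emitted_measurable[OF h, of i] chain_measurable[OF h, where i = i]
  define R where "R = real i * real k + real i * \<bar>c\<bar> + \<bar>c\<bar>"
  have Bc: "\<bar>?B \<omega> - c\<bar> \<le> R" for \<omega>
  proof -
    have "\<bar>?B \<omega> - c\<bar> \<le> \<bar>emitted h i \<omega>\<bar> + \<bar>real i * c\<bar> + \<bar>c\<bar>" by linarith
    then show ?thesis using emitted_bounds[of h i \<omega>] by (simp add: R_def abs_mult)
  qed
  have R: "0 \<le> R" by (simp add: R_def)
  have C1: "\<bar>chain h i \<omega> j / ?d\<bar> \<le> real k" if "j \<in> {1..k}" for j \<omega>
  proof -
    have "chain h i \<omega> j / ?d \<le> real k / 1"
      using mass_simplex_le[OF chain_simplex that, of h i \<omega>] d by (intro frac_le) auto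
    then show ?thesis using mass_simplex_le(1)[OF chain_simplex that, of h i \<omega>] d by simp
  qed
  define Bd where "Bd = R\<^sup>2 + 2 * R * real k + (real k)\<^sup>2"
  have Z_bound: "\<bar>?Z \<omega>\<bar> \<le> Bd" for \<omega>
  proof -
    have "(?B \<omega> - c)\<^sup>2 \<le> R\<^sup>2" using Bc[of \<omega>] R by (simp add: abs_le_square_iff[symmetric])
    moreover have "0 \<le> 2 * R * real k" using R by simp
    moreover have "0 \<le> (real k)\<^sup>2" by simp
    ultimately show ?thesis unfolding Bd_def abs_power2 by linarith
  qed
  have W_bound: "\<bar>?W j \<omega>\<bar> \<le> Bd" if "j \<in> {1..k}" for j \<omega>
  proof -
    have "\<bar>?W j \<omega>\<bar> \<le> 2 * (\<bar>?B \<omega> - c\<bar> * \<bar>chain h i \<omega> j / ?d\<bar>) + \<bar>chain h i \<omega> j / ?d\<bar>\<^sup>2"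
      using abs_triangle_ineq[of "2 * (?B \<omega> - c) * (chain h i \<omega> j / ?d)" "(chain h i \<omega> j / ?d)\<^sup>2"]
      by (simp only: abs_mult power2_abs abs_power2 abs_numeral mult.assoc)
    also have "\<dots> \<le> 2 * (R * real k) + (real k)\<^sup>2"
      using Bc[of \<omega>] C1[OF that, of \<omega>] R by (intro add_mono mult_left_mono mult_mono power_mono) auto
    also have "\<dots> \<le> Bd" using R by (simp add: Bd_def)
    finally show ?thesis .
  qed
  have "emitted h (Suc i) \<omega> - real (Suc i) * c = ?B \<omega> - c + emission h i \<omega>" for \<omega>
    by (simp add: emitted_def algebra_simps)
  moreover have "(?B \<omega> - c + emission h i \<omega>)\<^sup>2 = ?Z \<omega> + (\<Sum>j=1..k. if single h i j \<omega> then ?W j \<omega> else 0)" for \<omega>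
  proof -
    let ?G = "\<lambda>j. (?B \<omega> - c + (if j = 0 then 0 else chain h i \<omega> j / ?d))\<^sup>2"
    have "(?B \<omega> - c + emission h i \<omega>)\<^sup>2 = ?G (site h i \<omega>)" by (simp add: emission_def)
    also have "\<dots> = ?G 0 + (\<Sum>j=1..k. if single h i j \<omega> then ?G j - ?G 0 else 0)" by (rule site_sum)
    also have "(\<Sum>j=1..k. if single h i j \<omega> then ?G j - ?G 0 else 0) =
        (\<Sum>j=1..k. if single h i j \<omega> then ?W j \<omega> else 0)"
    proof (rule sum.cong[OF refl])
      fix j assume "j \<in> {1..k}"
      then have "?G j - ?G 0 = ?W j \<omega>" by (auto simp: power2_sum)
      then show "(if single h i j \<omega> then ?G j - ?G 0 else 0) = (if single h i j \<omega> then ?W j \<omega> else 0)"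
        by (simp only:)
    qed
    finally show ?thesis by simp
  qed
  ultimately have "expectation (\<lambda>\<omega>. (emitted h (Suc i) \<omega> - real (Suc i) * c)\<^sup>2) =
      expectation (\<lambda>\<omega>. ?Z \<omega> + (\<Sum>j=1..k. if single h i j \<omega> then ?W j \<omega> else 0))" by (simp only:)
  also have "\<dots> = expectation ?Z + p * expectation (\<lambda>\<omega>. \<Sum>j=1..k. ?W j \<omega>)"
    unfolding p_def by (rule expectation_step[OF h _ Z_bound _ W_bound]) measurable
  also have "(\<lambda>\<omega>. \<Sum>j=1..k. ?W j \<omega>) =
      (\<lambda>\<omega>. 2 * (?B \<omega> - c) * (real k / ?d) + square_sum k (chain h i \<omega>) / ?d\<^sup>2)"
  proof
    fix \<omega>
    have "(\<Sum>j=1..k. ?W j \<omega>) = (\<Sum>j=1..k. (2 * (?B \<omega> - c) / ?d) * chain h i \<omega> j + (chain h i \<omega> j)\<^sup>2 / ?d\<^sup>2)"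
      by (intro sum.cong) (auto simp: power_divide)
    also have "\<dots> = (2 * (?B \<omega> - c) / ?d) * (\<Sum>j=1..k. chain h i \<omega> j) + square_sum k (chain h i \<omega>) / ?d\<^sup>2"
      by (simp only: sum.distrib sum_distrib_left[symmetric] square_sum_def sum_divide_distrib)
    also have "(\<Sum>j=1..k. chain h i \<omega> j) = real k"
      using chain_simplex[of h i \<omega>] by (simp add: mass_simplex_def)
    finally show "(\<Sum>j=1..k. ?W j \<omega>) = 2 * (?B \<omega> - c) * (real k / ?d) + square_sum k (chain h i \<omega>) / ?d\<^sup>2"
      by simp
  qed
  finally have eq: "expectation (\<lambda>\<omega>. (emitted h (Suc i) \<omega> - real (Suc i) * c)\<^sup>2) =
      expectation ?Z + p * expectation (\<lambda>\<omega>. 2 * (?B \<omega> - c) * (real k / ?d) + square_sum k (chain h i \<omega>) / ?d\<^sup>2)" .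
  have V_meas: "(\<lambda>\<omega>. square_sum k (chain h i \<omega>)) \<in> borel_measurable (past h i)"
    unfolding square_sum_def by measurable
  have int_V: "integrable P (\<lambda>\<omega>. square_sum k (chain h i \<omega>))"
    by (rule bounded_integrable[OF past_measurable[OF h V_meas], where B = "(real k)\<^sup>2"])
      (use square_sum_bounds[OF chain_simplex] in simp)
  have B_meas: "(\<lambda>\<omega>. ?B \<omega> - c) \<in> borel_measurable P"
    by (rule past_measurable[OF h]) measurable
  have int_Bc: "integrable P (\<lambda>\<omega>. ?B \<omega> - c)"
    by (rule bounded_integrable[OF B_meas Bc])
  have int_B: "integrable P ?B"
    using Bochner_Integration.integrable_add[OF int_Bc integrable_const[of c]] by simp
  have int_B2: "integrable P (\<lambda>\<omega>. (?B \<omega>)\<^sup>2)"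
  proof (rule bounded_integrable)
    show "(\<lambda>\<omega>. (?B \<omega>)\<^sup>2) \<in> borel_measurable P" using borel_measurable_integrable[OF int_B] by measurable
    show "\<bar>(?B \<omega>)\<^sup>2\<bar> \<le> (R + \<bar>c\<bar>)\<^sup>2" for \<omega>
    proof -
      have "\<bar>?B \<omega>\<bar> \<le> R + \<bar>c\<bar>" using Bc[of \<omega>] by linarith
      then have "\<bar>?B \<omega>\<bar>\<^sup>2 \<le> (R + \<bar>c\<bar>)\<^sup>2" by (rule power_mono) simp
      then show ?thesis by simp
    qed
  qed
  define b1 where "b1 = expectation ?B"
  define b2 where "b2 = expectation (\<lambda>\<omega>. (?B \<omega>)\<^sup>2)"
  have "?Z = (\<lambda>\<omega>. (?B \<omega>)\<^sup>2 - 2 * c * ?B \<omega> + c\<^sup>2)" by (simp add: fun_eq_iff power2_eq_square algebra_simps)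
  then have eZ: "expectation ?Z = b2 - 2 * c * b1 + c\<^sup>2"
    using int_B int_B2 by (simp only: b1_def b2_def) (simp add: prob_space)
  have eBc: "expectation (\<lambda>\<omega>. ?B \<omega> - c) = b1 - c"
    using int_B by (simp add: b1_def prob_space)
  have "expectation (\<lambda>\<omega>. 2 * (?B \<omega> - c) * (real k / ?d) + square_sum k (chain h i \<omega>) / ?d\<^sup>2) =
      expectation (\<lambda>\<omega>. (2 * real k / ?d) * (?B \<omega> - c)) + expectation (\<lambda>\<omega>. square_sum k (chain h i \<omega>) / ?d\<^sup>2)"
  proof -
    have "2 * x * (real k / ?d) = (2 * real k / ?d) * x" for x :: real by simp
    then show ?thesis
      by (simp only: Bochner_Integration.integral_add[OF integrable_mult_right[OF int_Bc]
            integrable_divide_zero[OF int_V]])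
  qed
  also have "\<dots> = (2 * real k / ?d) * (b1 - c) + 2 * real k / ?d\<^sup>2"
    using eBc by (simp add: expectation_square_sum[OF h])
  finally have "expectation (\<lambda>\<omega>. (emitted h (Suc i) \<omega> - real (Suc i) * c)\<^sup>2) =
      b2 - 2 * c * b1 + c\<^sup>2 + p * ((2 * real k / ?d) * (b1 - c) + 2 * real k / ?d\<^sup>2)"
    using eq eZ by simp
  also have "\<dots> = b2 - c\<^sup>2 + 2 * p * real k / ?d\<^sup>2"
  proof -
    have "p * (2 * real k / ?d * (b1 - c)) = 2 * c * (b1 - c)" by (simp add: c_def)
    then show ?thesis by (simp add: distrib_left power2_eq_square algebra_simps)
  qed
  also have "\<dots> \<le> real i * (2 * p * real k / ?d\<^sup>2) + 2 * p * real k / ?d\<^sup>2"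
  proof -
    have "b2 \<le> real i * (2 * p * real k / ?d\<^sup>2)" using Suc.IH by (simp only: b2_def c_def)
    then show ?thesis using zero_le_power2[of c] by linarith
  qed
  also have "\<dots> = real (Suc i) * (2 * p * real k / ?d\<^sup>2)"
    by (simp only: of_nat_Suc distrib_right mult_1_left add.commute)
  finally show ?case unfolding c_def .
qed

end

context stationary_meteor
begin

lemma emitted_deviation_prob:
  fixes h \<delta> :: real and i :: nat
  assumes h: "0 < h" and \<delta>: "0 < \<delta>"
  defines "p \<equiv> h * exp (- (real k * h))"
  defines "D \<equiv> {\<omega> \<in> space P. \<delta> \<le> \<bar>emitted h i \<omega> - real i * (p * real k / (real k - 1))\<bar>}"
  shows "D \<in> events" "prob D \<le> real i * (2 * p * real k / (real k - 1)\<^sup>2) / \<delta>\<^sup>2"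
proof -
  let ?c = "p * real k / (real k - 1)"
  let ?B = "\<lambda>\<omega>. emitted h i \<omega> - real i * ?c"
  have [measurable]: "emitted h i \<in> borel_measurable P"
    by (rule past_measurable[OF h emitted_measurable[OF h]])
  show D: "D \<in> events" unfolding D_def by measurable
  have bound: "\<bar>?B \<omega>\<bar> \<le> real i * real k + \<bar>real i * ?c\<bar>" for \<omega>
    using emitted_bounds[of h i \<omega>] by linarith
  have int: "integrable P (\<lambda>\<omega>. (?B \<omega>)\<^sup>2)"
  proof (rule bounded_integrable)
    show "\<bar>(?B \<omega>)\<^sup>2\<bar> \<le> (real i * real k + \<bar>real i * ?c\<bar>)\<^sup>2" for \<omega>
      using power_mono[OF bound[of \<omega>] abs_ge_zero, of 2] by simp
  qed measurable
  have "\<delta>\<^sup>2 * prob D = expectation (\<lambda>\<omega>. \<delta>\<^sup>2 * indicator D \<omega>)" using D by simp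
  also have "\<dots> \<le> expectation (\<lambda>\<omega>. (?B \<omega>)\<^sup>2)"
  proof (rule integral_mono[OF _ int])
    show "integrable P (\<lambda>\<omega>. \<delta>\<^sup>2 * indicator D \<omega>)"
      using D by (intro integrable_mult_right integrable_real_indicator) (simp_all add: emeasure_eq_measure)
    show "\<delta>\<^sup>2 * indicator D \<omega> \<le> (?B \<omega>)\<^sup>2" for \<omega>
    proof (cases "\<omega> \<in> D")
      case True
      then have "\<delta> \<le> \<bar>?B \<omega>\<bar>" by (simp add: D_def)
      then have "\<delta>\<^sup>2 \<le> \<bar>?B \<omega>\<bar>\<^sup>2" using \<delta> by (intro power_mono) auto
      then show ?thesis using True by simp
    qed simp
  qed
  also have "\<dots> \<le> real i * (2 * p * real k / (real k - 1)\<^sup>2)"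
    unfolding p_def by (rule emitted_second_moment[OF h])
  finally show "prob D \<le> real i * (2 * p * real k / (real k - 1)\<^sup>2) / \<delta>\<^sup>2"
    using \<delta> by (subst pos_le_divide_eq) (simp_all only: mult.commute[of "\<delta>\<^sup>2"] zero_less_power)
qed

section \<open>Uniform approximation by renewal paths\<close>

text \<open>Here \<open>l\<close> is the end of the last cell with a hit at \<open>x\<close>, where both paths restart from
  \<open>c = 0\<close>, or \<open>l = 0\<close> and \<open>c\<close> is the initial mass. Since then the mass at \<open>x\<close> has grown by the
  increment of the emitted mass, and the renewal path by the elapsed time. The error \<open>h\<close> accounts
  for the position of the hit within its cell.\<close>

lemma chain_renewal:
  assumes h: "0 < h" and \<omega>: "\<omega> \<in> good h n"
    and path: "meteor_path k (\<lambda>j t. N j t \<omega>) (\<lambda>j t. M j t \<omega>)"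
    and x: "x \<in> {1..k}" and i: "i \<le> n"
  shows "\<exists>l\<le>i. \<exists>c. chain h i \<omega> x = c + (emitted h i \<omega> - emitted h l \<omega>) \<and>
    \<bar>renewal_path (start \<omega> x) (\<lambda>t. N x t \<omega>) (real i * h) - (c + (real i * h - real l * h))\<bar> \<le> h"
  using i
proof (induction i)
  case 0
  show ?case
    using h by (intro exI[of _ 0] conjI exI[of _ "start \<omega> x"]) (simp_all add: renewal_path_0)
next
  case (Suc i)
  let ?R = "renewal_path (start \<omega> x) (\<lambda>t. N x t \<omega>)"
  let ?s = "real i * h" and ?t = "real (Suc i) * h"
  have cp: "counting_path (\<lambda>t. N x t \<omega>)" by (rule meteor_path_counting[OF path x])
  have st: "0 \<le> ?s" "?s \<le> ?t" "?t - ?s = h" using h by (auto simp: algebra_simps)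
  have mono: "N x ?s \<omega> \<le> N x ?t \<omega>" using counting_path_mono[OF cp st(1,2)] .
  have cell: "(\<forall>j\<in>{1..k}. increment h i j \<omega> = 0) \<or> (\<exists>j\<in>{1..k}. single h i j \<omega>)"
    using \<omega> Suc.prems unfolding good_def by simp
  show ?case
  proof (cases "single h i x \<omega>")
    case True
    have "increment h i x \<omega> = 1" using True x unfolding single_def by simp
    then have "N x ?s \<omega> \<noteq> N x ?t \<omega>" unfolding increment_def by simp
    from renewal_path_after_jump[OF cp st(1,2) this, of "start \<omega> x"]
    have "\<bar>?R ?t\<bar> \<le> h" using st(3) by simp
    moreover have "chain h (Suc i) \<omega> x = 0"
      using site_eq[OF x True] x by (simp add: meteor_jump_def)
    ultimately show ?thesis by (intro exI[of _ "Suc i"] conjI exI[of _ 0]) simp_all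
  next
    case False
    have inc0: "increment h i x \<omega> = 0"
      using cell
    proof
      assume "\<exists>j\<in>{1..k}. single h i j \<omega>"
      then obtain j where j: "single h i j \<omega>" by blast
      then have "x \<noteq> j" using False by auto
      then show ?thesis using j x unfolding single_def by simp
    qed (use x in blast)
    then have "N x ?s \<omega> = N x ?t \<omega>" using mono unfolding increment_def by simp
    from renewal_path_shift[OF cp st(1,2) this, of "start \<omega> x"]
    have R: "?R ?t = ?R ?s + h" using st(3) by simp
    have sx: "site h i \<omega> \<noteq> x"
    proof
      assume s: "site h i \<omega> = x"
      obtain j where "j \<in> {1..k}" "single h i j \<omega>"
        using s x site_none[of h i \<omega>] by (metis atLeastAtMost_iff not_one_le_zero)
      then show False using site_eq s False by metis
    qed
    have C: "chain h (Suc i) \<omega> x = chain h i \<omega> x + emission h i \<omega>"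
      using sx by (simp add: meteor_jump_def emission_def)
    have E: "emitted h (Suc i) \<omega> = emitted h i \<omega> + emission h i \<omega>" by (simp add: emitted_def)
    obtain l c where lc: "l \<le> i" "chain h i \<omega> x = c + (emitted h i \<omega> - emitted h l \<omega>)"
        "\<bar>?R ?s - (c + (?s - real l * h))\<bar> \<le> h"
      using Suc by auto
    show ?thesis
    proof (intro exI[of _ l] conjI exI[of _ c])
      show "l \<le> Suc i" using lc by simp
      show "chain h (Suc i) \<omega> x = c + (emitted h (Suc i) \<omega> - emitted h l \<omega>)"
        using lc(2) C E by linarith
      show "\<bar>?R ?t - (c + (?t - real l * h))\<bar> \<le> h" using lc(3) R st(3) by linarith
    qed
  qed
qed

text \<open>Between two grid points there is at most one ring. Before it, masses and clocks are those of the
  left end of the cell, after it those of the right end.\<close>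

lemma mass_close_to_renewal:
  assumes h: "0 < h" and \<omega>: "\<omega> \<in> good h n"
    and path: "meteor_path k (\<lambda>j t. N j t \<omega>) (\<lambda>j t. M j t \<omega>)"
    and st: "(\<lambda>x. M x 0 \<omega>) \<in> mass_simplex k"
    and lin: "\<And>i. i \<le> n \<Longrightarrow> \<bar>emitted h i \<omega> - real i * h\<bar> \<le> e"
    and x: "x \<in> {1..k}" and t: "0 \<le> t" "t \<le> real n * h"
  shows "\<bar>M x t \<omega> - renewal_path (M x 0 \<omega>) (\<lambda>t. N x t \<omega>) t\<bar> \<le> 2 * e + 2 * h"
proof -
  let ?R = "renewal_path (M x 0 \<omega>) (\<lambda>t. N x t \<omega>)"
  have start: "start \<omega> x = M x 0 \<omega>" using st by (simp add: start_def)
  have cp: "counting_path (\<lambda>t. N x t \<omega>)" by (rule meteor_path_counting[OF path x])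
  have grid: "\<bar>M x (real i * h) \<omega> - ?R (real i * h)\<bar> \<le> 2 * e + h" if i: "i \<le> n" for i
  proof -
    obtain l c where lc: "l \<le> i" "chain h i \<omega> x = c + (emitted h i \<omega> - emitted h l \<omega>)"
        "\<bar>?R (real i * h) - (c + (real i * h - real l * h))\<bar> \<le> h"
      using chain_renewal[OF h \<omega> path x i] start by auto
    have "M x (real i * h) \<omega> = chain h i \<omega> x" by (rule chain_eq_mass[OF h \<omega> path st i x])
    then show ?thesis using lc(2,3) lin[OF i] lin[of l] lc(1) i by force
  qed
  show ?thesis
  proof (cases "t = real n * h")
    case True
    then show ?thesis using grid[of n] h by simp
  next
    case False
    define i where "i = nat \<lfloor>t / h\<rfloor>"
    have "real i \<le> t / h" "t / h < real i + 1" using t h unfolding i_def by simp_all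
    then have it: "real i * h \<le> t" "t < real (Suc i) * h" using h by (simp_all add: field_simps)
    have "real i * h < real n * h" using it t False by linarith
    then have i: "i < n" using h by simp
    let ?s = "real i * h" and ?u = "real (Suc i) * h"
    have s0: "0 \<le> ?s" and su: "?u - ?s = h" using h by (auto simp: algebra_simps)
    have mono: "N j ?s \<omega> \<le> N j t \<omega>" "N j t \<omega> \<le> N j ?u \<omega>" if "j \<in> {1..k}" for j
      using counting_path_mono[OF meteor_path_counting[OF path that]] s0 it t by auto
    have cell: "(\<forall>j\<in>{1..k}. increment h i j \<omega> = 0) \<or> (\<exists>j\<in>{1..k}. single h i j \<omega>)"
      using \<omega> i unfolding good_def by simp
    show ?thesis
    proof (cases "\<forall>j\<in>{1..k}. N j ?s \<omega> = N j t \<omega>")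
      case True
      have "M x t \<omega> = M x ?s \<omega>"
        by (rule meteor_path_constant[OF path s0 it(1) _ x]) (use True in simp)
      moreover have "?R t = ?R ?s + (t - ?s)"
        by (rule renewal_path_shift[OF cp s0 it(1)]) (use True x in simp)
      ultimately show ?thesis using grid[of i] i it su by (simp add: abs_le_iff)
    next
      case False
      then obtain j where j: "j \<in> {1..k}" "N j ?s \<omega> \<noteq> N j t \<omega>" by blast
      then have jl: "N j ?s \<omega> < N j t \<omega>" using mono[OF j(1)] by simp
      then have "increment h i j \<omega> \<noteq> 0" using mono[OF j(1)] unfolding increment_def by simp
      then have "\<exists>j\<in>{1..k}. single h i j \<omega>" using cell j(1) by metis
      then obtain j' where j': "j' \<in> {1..k}" "single h i j' \<omega>" by metis
      have inc: "increment h i y \<omega> = (if y = j' then 1 else 0)" if "y \<in> {1..k}" for y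
        using j'(2) that unfolding single_def by blast
      have "j = j'" using inc[OF j(1)] \<open>increment h i j \<omega> \<noteq> 0\<close> by (auto split: if_splits)
      have eq: "N y t \<omega> = N y ?u \<omega>" if y: "y \<in> {1..k}" for y
        using inc[OF y] mono[OF y] jl \<open>j = j'\<close> unfolding increment_def by (cases "y = j'") auto
      have "M x ?u \<omega> = M x t \<omega>"
        by (rule meteor_path_constant[OF path t(1) _ _ x]) (use it eq in auto)
      moreover have "?R ?u = ?R t + (?u - t)"
        by (rule renewal_path_shift[OF cp t(1)]) (use it eq x in auto)
      ultimately show ?thesis using grid[of "Suc i"] i it su by (simp add: abs_le_iff)
    qed
  qed
qed

text \<open>The emitted mass is monotone, so that control at multiples of \<open>q\<close> suffices.\<close>

lemma emitted_linear_from_checkpoints: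
  assumes h: "0 < h" and q: "0 < q"
    and check: "\<And>r. r \<le> m \<Longrightarrow> \<bar>emitted h (r * q) \<omega> - real (r * q) * c\<bar> \<le> \<delta>"
    and drift: "real (m * q) * \<bar>c - h\<bar> \<le> \<delta>" and mesh: "real q * h \<le> \<delta>"
    and i: "i \<le> m * q"
  shows "\<bar>emitted h i \<omega> - real i * h\<bar> \<le> 3 * \<delta>"
proof -
  have at: "\<bar>emitted h (r * q) \<omega> - real (r * q) * h\<bar> \<le> 2 * \<delta>" if r: "r \<le> m" for r
  proof -
    have "r * q \<le> m * q" using r by simp
    then have "real (r * q) * \<bar>c - h\<bar> \<le> real (m * q) * \<bar>c - h\<bar>"
      by (intro mult_right_mono) (simp_all only: of_nat_le_iff abs_ge_zero)
    then have "\<bar>real (r * q) * (c - h)\<bar> \<le> \<delta>" using drift by (simp only: abs_mult abs_of_nat)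
    then have "\<bar>real (r * q) * c - real (r * q) * h\<bar> \<le> \<delta>" by (simp only: right_diff_distrib)
    then show ?thesis using check[OF r] by linarith
  qed
  define r where "r = i div q"
  have ir: "r * q \<le> i" "i < (r + 1) * q"
    using q by (simp_all add: r_def dividend_less_div_times)
  have rm: "r \<le> m" using div_le_mono[OF i, of q] q by (simp add: r_def)
  have d0: "0 \<le> \<delta>" using drift by (rule order_trans[rotated]) simp
  have hr: "real (r * q) * h \<le> real i * h" using ir(1) h by (intro mult_right_mono iffD2[OF of_nat_le_iff]) auto
  have lo: "emitted h (r * q) \<omega> \<le> emitted h i \<omega>" by (rule emitted_mono[OF ir(1)])
  have "real i \<le> real (r * q) + real q" using ir(2) by (simp add: algebra_simps flip: of_nat_mult of_nat_add)
  then have "real i * h \<le> (real (r * q) + real q) * h" using h by (intro mult_right_mono) auto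
  then have hi': "real i * h \<le> real (r * q) * h + real q * h" by (simp only: distrib_right)
  show ?thesis
  proof (cases "i = m * q")
    case True then show ?thesis using at[of m] d0 by simp
  next
    case False
    then have "r < m"
      using ir i by (metis le_neq_implies_less less_mult_imp_div_less r_def)
    then have "Suc r \<le> m" by simp
    from at[OF this] have up: "emitted h (Suc r * q) \<omega> \<le> real (Suc r * q) * h + 2 * \<delta>" by linarith
    have "real (Suc r * q) * h = real (r * q) * h + real q * h" by (simp add: algebra_simps)
    moreover have "emitted h i \<omega> \<le> emitted h (Suc r * q) \<omega>" using ir by (intro emitted_mono) simp
    ultimately show ?thesis using at[OF rm] lo hi' hr up mesh by linarith
  qed
qed

text \<open>Chebyshev's inequality at the \<open>m + 1\<close> checkpoints. The total error is \<open>2 (3 \<delta>) + 2 h \<le> 8 \<delta>\<close>: the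
  emitted mass is within \<open>3 \<delta>\<close> of the elapsed time at both ends of the relevant interval, and \<open>h\<close> is
  at most \<open>\<delta>\<close>.\<close>

lemma AE_close_to_renewal:
  assumes T: "0 < T" and \<delta>: "0 < \<delta>" and m: "0 < m" and q: "0 < q"
  defines "h \<equiv> T / real (m * q)"
  assumes mesh: "T / real m \<le> \<delta>" and big_k: "T / (real k - 1) \<le> \<delta>" and big_q: "T * (real k * h) \<le> \<delta>"
  shows "\<exists>E\<in>events.
    1 - (real (m * q) * (real k * h)\<^sup>2 + real (m + 1) * (4 * T / (real k - 1)) / \<delta>\<^sup>2) \<le> prob E \<and>
    (AE \<omega> in P. \<omega> \<in> E \<longrightarrow> (\<forall>x\<in>{1..k}. \<forall>t. 0 \<le> t \<and> t \<le> T \<longrightarrow>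
      \<bar>M x t \<omega> - renewal_path (M x 0 \<omega>) (\<lambda>t. N x t \<omega>) t\<bar> \<le> 8 * \<delta>))"
proof -
  define n where "n = m * q"
  have n: "0 < n" "0 < real n" using m q by (simp_all add: n_def)
  have h: "0 < h" using T m q by (simp add: h_def)
  have nh: "real n * h = T" using n by (simp add: h_def n_def)
  have k1: "1 \<le> real k - 1" using k by simp
  define p where "p = h * exp (- (real k * h))"
  define c where "c = p * real k / (real k - 1)"
  have p: "0 < p" "p \<le> h" using h by (auto simp: p_def)
  have drift: "real n * \<bar>c - h\<bar> \<le> \<delta>"
  proof -
    define a where "a = exp (- (real k * h)) * (real k / (real k - 1)) - 1"
    have ch: "c - h = h * a" by (simp add: c_def p_def a_def algebra_simps)
    have kk: "real k / (real k - 1) = 1 + 1 / (real k - 1)" using k1 by (simp add: field_simps)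
    have "exp (- (real k * h)) * (real k / (real k - 1)) \<le> 1 * (real k / (real k - 1))"
      using h k1 by (intro mult_right_mono) auto
    then have up: "a \<le> 1 / (real k - 1)" using kk by (simp add: a_def)
    have "exp (- (real k * h)) * 1 \<le> exp (- (real k * h)) * (real k / (real k - 1))"
      using kk k1 by (intro mult_left_mono) auto
    then have lo: "- (real k * h) \<le> a"
      using exp_ge_add_one_self[of "- (real k * h)"] by (simp add: a_def)
    have "T * a \<le> T * (1 / (real k - 1))" using up T by (intro mult_left_mono) auto
    then have 1: "T * a \<le> \<delta>" using big_k by simp
    have "T * (- (real k * h)) \<le> T * a" using lo T by (intro mult_left_mono) auto
    then have 2: "- (T * a) \<le> \<delta>" using big_q by simp
    have "real n * \<bar>c - h\<bar> = \<bar>T * a\<bar>" using n by (simp add: ch abs_mult nh[symmetric])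
    then show ?thesis using 1 2 by simp
  qed
  have qh: "real q * h \<le> \<delta>" using mesh q m by (simp add: h_def)
  have hd: "h \<le> \<delta>"
  proof -
    have "1 * h \<le> real q * h" using q h by (intro mult_right_mono) auto
    then show ?thesis using qh by simp
  qed
  define D where "D r = {\<omega> \<in> space P. \<delta> \<le> \<bar>emitted h (r * q) \<omega> - real (r * q) * c\<bar>}" for r
  have Dev: "D r \<in> events" for r
    unfolding D_def c_def p_def by (rule emitted_deviation_prob(1)[OF h \<delta>])
  have Dp: "prob (D r) \<le> (4 * T / (real k - 1)) / \<delta>\<^sup>2" if r: "r \<le> m" for r
  proof -
    have "prob (D r) \<le> real (r * q) * (2 * p * real k / (real k - 1)\<^sup>2) / \<delta>\<^sup>2"
      unfolding D_def c_def p_def by (rule emitted_deviation_prob(2)[OF h \<delta>])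
    also have "\<dots> \<le> (4 * T / (real k - 1)) / \<delta>\<^sup>2"
    proof (rule divide_right_mono)
      have kk: "real k / (real k - 1) \<le> 2" using k by (simp add: field_simps)
      have "real (r * q) * p \<le> real n * h"
        using p r n_def by (intro mult_mono) (auto intro: mult_right_mono)
      then have rp: "real (r * q) * p \<le> T" using nh by simp
      have "real (r * q) * (2 * p * real k / (real k - 1)\<^sup>2) =
          2 * ((real (r * q) * p) * (real k / (real k - 1))) / (real k - 1)"
        by (simp add: power2_eq_square)
      also have "\<dots> \<le> 2 * (T * 2) / (real k - 1)"
        using rp kk p k1 T by (intro divide_right_mono mult_left_mono mult_mono) auto
      finally show "real (r * q) * (2 * p * real k / (real k - 1)\<^sup>2) \<le> 4 * T / (real k - 1)" by simp
    qed simp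
    finally show ?thesis .
  qed
  define E where "E = good h n - (\<Union>r\<in>{..m}. D r)"
  have bad: "(space P - good h n) \<union> (\<Union>r\<in>{..m}. D r) \<in> events"
    using good_event[OF h, of n] Dev by (intro sets.Un sets.Diff sets.finite_UN) auto
  have E_eq: "E = space P - ((space P - good h n) \<union> (\<Union>r\<in>{..m}. D r))"
    unfolding E_def by (auto simp: good_def)
  have E: "E \<in> events" unfolding E_eq using bad by auto
  have "prob ((space P - good h n) \<union> (\<Union>r\<in>{..m}. D r)) \<le> prob (space P - good h n) + prob (\<Union>r\<in>{..m}. D r)"
    using good_event[OF h, of n] Dev by (intro measure_Un_le sets.Diff sets.finite_UN) auto
  also have "\<dots> \<le> real n * (real k * h)\<^sup>2 + (\<Sum>r\<in>{..m}. prob (D r))"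
  proof (rule add_mono)
    show "prob (space P - good h n) \<le> real n * (real k * h)\<^sup>2"
      using prob_good[OF h, of n] prob_compl[OF good_event[OF h, of n]] by linarith
    show "prob (\<Union>r\<in>{..m}. D r) \<le> (\<Sum>r\<in>{..m}. prob (D r))"
      using Dev by (intro measure_UNION_le) auto
  qed
  also have "(\<Sum>r\<in>{..m}. prob (D r)) \<le> (\<Sum>r\<in>{..m}. (4 * T / (real k - 1)) / \<delta>\<^sup>2)"
    using Dp by (intro sum_mono) auto
  also have "\<dots> = real (m + 1) * (4 * T / (real k - 1)) / \<delta>\<^sup>2" by simp
  finally have "1 - (real n * (real k * h)\<^sup>2 + real (m + 1) * (4 * T / (real k - 1)) / \<delta>\<^sup>2) \<le> prob E"
    unfolding E_eq using prob_compl[OF bad] by linarith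
  moreover have "AE \<omega> in P. \<omega> \<in> E \<longrightarrow> (\<forall>x\<in>{1..k}. \<forall>t. 0 \<le> t \<and> t \<le> T \<longrightarrow>
      \<bar>M x t \<omega> - renewal_path (M x 0 \<omega>) (\<lambda>t. N x t \<omega>) t\<bar> \<le> 8 * \<delta>)"
    using AE_meteor_path AE_start
  proof (eventually_elim, intro impI ballI allI, elim conjE)
    fix \<omega> x t
    assume path: "meteor_path k (\<lambda>j t. N j t \<omega>) (\<lambda>j t. M j t \<omega>)"
      and st: "(\<lambda>x. M x 0 \<omega>) \<in> mass_simplex k"
      and \<omega>: "\<omega> \<in> E" and x: "x \<in> {1..k}" and t: "0 \<le> t" "t \<le> T"
    have good: "\<omega> \<in> good h n" using \<omega> by (simp add: E_def)
    have check: "\<bar>emitted h (r * q) \<omega> - real (r * q) * c\<bar> \<le> \<delta>" if "r \<le> m" for r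
    proof -
      have "\<omega> \<notin> D r" using \<omega> that by (auto simp: E_def)
      moreover have "\<omega> \<in> space P" using good by (simp add: good_def)
      ultimately show ?thesis unfolding D_def by simp
    qed
    have "\<bar>emitted h i \<omega> - real i * h\<bar> \<le> 3 * \<delta>" if "i \<le> n" for i
      using emitted_linear_from_checkpoints[OF h q check drift[unfolded n_def] qh] that by (simp add: n_def)
    from mass_close_to_renewal[OF h good path st this x t(1)]
    have "\<bar>M x t \<omega> - renewal_path (M x 0 \<omega>) (\<lambda>t. N x t \<omega>) t\<bar> \<le> 2 * (3 * \<delta>) + 2 * h"
      using t nh by simp
    then show "\<bar>M x t \<omega> - renewal_path (M x 0 \<omega>) (\<lambda>t. N x t \<omega>) t\<bar> \<le> 8 * \<delta>"
      using hd by linarith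
  qed
  ultimately show ?thesis using E unfolding n_def by blast
qed

end

text \<open>The bounds depend on the vertex number only, so the approximation is uniform over all
  realizations of the process with a given large number of vertices.\<close>

lemma masses_close_to_renewal:
  assumes T: "0 < T" and e: "0 < e" and \<eta>: "0 < \<eta>"
  shows "\<exists>k0. \<forall>k\<ge>k0. \<forall>(P :: 'a measure) N M. stationary_meteor P k N M \<longrightarrow>
    (\<exists>E\<in>sets P. 1 - \<eta> \<le> measure P E \<and>
      (AE \<omega> in P. \<omega> \<in> E \<longrightarrow> (\<forall>x\<in>{1..k}. \<forall>t. 0 \<le> t \<and> t \<le> T \<longrightarrow>
        \<bar>M x t \<omega> - renewal_path (M x 0 \<omega>) (\<lambda>t. N x t \<omega>) t\<bar> \<le> e)))"
proof -
  define \<delta> where "\<delta> = e / 8"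
  have \<delta>: "0 < \<delta>" using e by (simp add: \<delta>_def)
  obtain m0 :: nat where m0: "T / \<delta> < real m0" using reals_Archimedean2 by blast
  define m where "m = Suc m0"
  have m: "0 < m" "T / \<delta> < real m" using m0 by (auto simp: m_def)
  then have mesh: "T / real m \<le> \<delta>" using \<delta> by (simp add: field_simps)
  obtain k0 :: nat where k0: "max (T / \<delta>) (8 * real (m + 1) * T / (\<eta> * \<delta>\<^sup>2)) + 2 < real k0"
    using reals_Archimedean2 by blast
  have "\<exists>E\<in>sets P. 1 - \<eta> \<le> measure P E \<and>
      (AE \<omega> in P. \<omega> \<in> E \<longrightarrow> (\<forall>x\<in>{1..k}. \<forall>t. 0 \<le> t \<and> t \<le> T \<longrightarrow>
        \<bar>M x t \<omega> - renewal_path (M x 0 \<omega>) (\<lambda>t. N x t \<omega>) t\<bar> \<le> e))"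
    if large: "k0 \<le> k" and sm: "stationary_meteor P k N M" for k and P :: "'a measure" and N M
  proof -
    interpret stationary_meteor P k N M by (rule sm)
    have kk: "max (T / \<delta>) (8 * real (m + 1) * T / (\<eta> * \<delta>\<^sup>2)) < real k - 1" "0 < real k - 1"
    proof -
      have "real k0 \<le> real k" using large by simp
      then show "max (T / \<delta>) (8 * real (m + 1) * T / (\<eta> * \<delta>\<^sup>2)) < real k - 1" using k0 by linarith
      show "0 < real k - 1" using stationary_meteor.k[OF sm] by simp
    qed
    have big_k: "T / (real k - 1) \<le> \<delta>"
    proof -
      have "T / \<delta> < real k - 1" using kk(1) by simp
      then show ?thesis using \<delta> kk(2) by (simp add: field_simps)
    qed
    have term2: "real (m + 1) * (4 * T / (real k - 1)) / \<delta>\<^sup>2 \<le> \<eta> / 2"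
    proof -
      have "8 * real (m + 1) * T / (\<eta> * \<delta>\<^sup>2) < real k - 1" using kk(1) by simp
      then have "8 * real (m + 1) * T < (real k - 1) * (\<eta> * \<delta>\<^sup>2)"
        using \<eta> \<delta> by (subst (asm) pos_divide_less_eq) simp_all
      then have "4 * real (m + 1) * T \<le> \<eta> / 2 * ((real k - 1) * \<delta>\<^sup>2)" by (simp add: algebra_simps)
      then have "(4 * real (m + 1) * T) / ((real k - 1) * \<delta>\<^sup>2) \<le> \<eta> / 2"
        using \<delta> kk(2) by (subst pos_divide_le_eq) auto
      moreover have "real (m + 1) * (4 * T / (real k - 1)) / \<delta>\<^sup>2 = (4 * real (m + 1) * T) / ((real k - 1) * \<delta>\<^sup>2)"
        by (simp add: mult_ac)
      ultimately show ?thesis by (simp only:)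
    qed
    \<comment> \<open>The mesh of the grid may depend on \<open>k\<close>; only the number \<open>m\<close> of checkpoints may not.\<close>
    obtain q0 :: nat where q0: "max (T * T * real k / \<delta>) (2 * (real k)\<^sup>2 * T\<^sup>2 / \<eta>) < real q0"
      using reals_Archimedean2 by blast
    define q where "q = Suc q0"
    have q: "0 < q" "T * T * real k / \<delta> < real q" "2 * (real k)\<^sup>2 * T\<^sup>2 / \<eta> < real q"
      using q0 by (auto simp: q_def)
    define h where "h = T / real (m * q)"
    have "q \<le> m * q" using m(1) by simp
    then have qmq: "real q \<le> real (m * q)" by (rule iffD2[OF of_nat_le_iff])
    have mq: "0 < real (m * q)" using m q by simp
    have big_q: "T * (real k * h) \<le> \<delta>"
    proof -
      have "T * T * real k < real q * \<delta>" using q(2) \<delta> by (simp add: pos_divide_less_eq)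
      also have "\<dots> \<le> real (m * q) * \<delta>" using qmq \<delta> by (intro mult_right_mono) auto
      finally have "T * T * real k / real (m * q) \<le> \<delta>" using mq by (simp only: pos_divide_le_eq mult.commute less_imp_le)
      then show ?thesis by (simp add: h_def mult_ac)
    qed
    have term1: "real (m * q) * (real k * h)\<^sup>2 \<le> \<eta> / 2"
    proof -
      have "2 * (real k)\<^sup>2 * T\<^sup>2 < real q * \<eta>" using q(3) \<eta> by (simp add: pos_divide_less_eq)
      also have "\<dots> \<le> real (m * q) * \<eta>" using qmq \<eta> by (intro mult_right_mono) auto
      finally have a: "(real k)\<^sup>2 * T\<^sup>2 \<le> \<eta> / 2 * real (m * q)" by (simp add: mult_ac)
      have "real (m * q) * (real k * h)\<^sup>2 = (real k)\<^sup>2 * T\<^sup>2 / real (m * q)"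
        using mq by (simp add: h_def power_mult_distrib power_divide power2_eq_square)
      also have "\<dots> \<le> \<eta> / 2" using a mq by (subst pos_divide_le_eq) auto
      finally show ?thesis .
    qed
    obtain E where E: "E \<in> events"
      "1 - (real (m * q) * (real k * h)\<^sup>2 + real (m + 1) * (4 * T / (real k - 1)) / \<delta>\<^sup>2) \<le> prob E"
      "AE \<omega> in P. \<omega> \<in> E \<longrightarrow> (\<forall>x\<in>{1..k}. \<forall>t. 0 \<le> t \<and> t \<le> T \<longrightarrow>
        \<bar>M x t \<omega> - renewal_path (M x 0 \<omega>) (\<lambda>t. N x t \<omega>) t\<bar> \<le> 8 * \<delta>)"
      using AE_close_to_renewal[OF T \<delta> m(1) q(1) mesh big_k big_q[unfolded h_def]]
      unfolding h_def by blast
    have "1 - \<eta> \<le> prob E" using E(2) term1 term2 by linarith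
    moreover have "8 * \<delta> = e" by (simp add: \<delta>_def)
    ultimately show ?thesis using E(1,3) by auto
  qed
  then show ?thesis by blast
qed

section \<open>The limit of the one-vertex marginals\<close>

lemma cdf_exponential:
  "cdf (density lborel (exponential_density 1)) x = (if 0 \<le> x then 1 - exp (- x) else 0)"
proof -
  have "emeasure (density lborel (exponential_density 1)) {..x} = erlang_CDF 0 1 x"
    by (rule emeasure_erlang_density) simp
  then have "cdf (density lborel (exponential_density 1)) x = enn2real (ennreal (erlang_CDF 0 1 x))"
    by (simp add: cdf_def measure_def)
  also have "\<dots> = (if 0 \<le> x then 1 - exp (- x) else 0)" by (simp add: erlang_CDF_0)
  finally show ?thesis .
qed

lemma exp_neg_Lipschitz:
  fixes x y :: real
  assumes "0 \<le> x" "x \<le> y"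
  shows "exp (- x) - exp (- y) \<le> y - x"
proof -
  have "exp (- x) - exp (- y) = exp (- x) * (1 - exp (- (y - x)))"
    by (simp add: right_diff_distrib flip: exp_add)
  also have "\<dots> \<le> 1 * (y - x)"
  proof (rule mult_mono)
    show "1 - exp (- (y - x)) \<le> y - x" using exp_ge_add_one_self[of "- (y - x)"] by linarith
  qed (use assms in auto)
  finally show ?thesis by simp
qed

context stationary_meteor
begin

definition close_event :: "real \<Rightarrow> real \<Rightarrow> real \<Rightarrow> 'a set \<Rightarrow> bool" where
  "close_event T e \<eta> E \<longleftrightarrow> E \<in> events \<and> 1 - \<eta> \<le> prob E \<and>
    (AE \<omega> in P. \<omega> \<in> E \<longrightarrow> (\<forall>x\<in>{1..k}. \<forall>t. 0 \<le> t \<and> t \<le> T \<longrightarrow>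
      \<bar>M x t \<omega> - renewal_path (M x 0 \<omega>) (\<lambda>t. N x t \<omega>) t\<bar> \<le> e))"

lemma prob_add_bad:
  assumes E: "E \<in> events" "1 - \<eta> \<le> prob E" and AB: "A \<in> events" "B \<in> events"
    and sub: "AE \<omega> in P. \<omega> \<in> A \<and> \<omega> \<in> E \<longrightarrow> \<omega> \<in> B"
  shows "prob A \<le> prob B + \<eta>"
proof -
  have "prob A \<le> prob (B \<union> (space P - E))"
  proof (rule finite_measure_mono_AE)
    show "AE \<omega> in P. \<omega> \<in> A \<longrightarrow> \<omega> \<in> B \<union> (space P - E)"
      using sub AE_space by eventually_elim auto
    show "B \<union> (space P - E) \<in> events" using E AB by auto
  qed
  also have "\<dots> \<le> prob B + prob (space P - E)" using E AB by (intro measure_Un_le) auto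
  also have "prob (space P - E) \<le> \<eta>" using prob_compl[OF E(1)] E(2) by linarith
  finally show ?thesis by simp
qed

lemma mass_event: "x \<in> {1..k} \<Longrightarrow> 0 \<le> t \<Longrightarrow> {\<omega> \<in> space P. M x t \<omega> \<le> a} \<in> events"
  using mass_measurable[of x t] by measurable

lemma clock_event: "x \<in> {1..k} \<Longrightarrow> 0 \<le> s \<Longrightarrow> 0 \<le> t \<Longrightarrow> {\<omega> \<in> space P. 1 \<le> N x t \<omega> - N x s \<omega>} \<in> events"
  using poisson_increment_event[OF clock, of x s t "{1..}"] by simp

lemma prob_clock_rings:
  assumes x: "x \<in> {1..k}" and st: "0 \<le> s" "s \<le> t"
  shows "prob {\<omega> \<in> space P. 1 \<le> N x t \<omega> - N x s \<omega>} = 1 - exp (- (t - s))"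
proof (cases "s = t")
  case False
  then have lt: "s < t" using st by simp
  have "{\<omega> \<in> space P. N x t \<omega> - N x s \<omega> = 0} \<in> events"
    using poisson_increment_event[OF clock[OF x], of s t "{0}"] st by simp
  then have "prob (space P - {\<omega> \<in> space P. N x t \<omega> - N x s \<omega> = 0}) = 1 - exp (- (t - s))"
    using poisson_increment_eq[OF clock[OF x] st(1) lt, of 0] by (subst prob_compl) auto
  moreover have "space P - {\<omega> \<in> space P. N x t \<omega> - N x s \<omega> = 0} = {\<omega> \<in> space P. 1 \<le> N x t \<omega> - N x s \<omega>}"
    by auto
  ultimately show ?thesis by (simp only:)
qed simp

lemma prob_mass_stationary:
  assumes x: "x \<in> {1..k}" and t: "0 \<le> t"
  shows "prob {\<omega> \<in> space P. M x t \<omega> \<le> a} = prob {\<omega> \<in> space P. M x 0 \<omega> \<le> a}"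
proof -
  let ?A = "{m \<in> space (state_space k). m x \<le> a}"
  have A: "?A \<in> sets (state_space k)" using x by measurable
  have eq: "state k M s -` ?A \<inter> space P = {\<omega> \<in> space P. M x s \<omega> \<le> a}" if "0 \<le> s" for s
    using measurable_space[OF state_measurable[OF that]] x by (auto simp: state_def)
  have "measure (distr P (state_space k) (state k M t)) ?A = measure (distr P (state_space k) (state k M 0)) ?A"
    using stationary[OF t] by simp
  then show ?thesis
    using measure_distr[OF state_measurable[OF t] A] measure_distr[OF state_measurable[of 0] A] eq[OF t] eq[of 0]
    by simp
qed

text \<open>The renewal path is below \<open>a\<close> at time \<open>T\<close> exactly if the clock has rung during the last
  \<open>a\<close> time units, which has probability \<open>1 - exp (- a)\<close>.\<close>

lemma marginal_close_to_exponential: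
  assumes E: "close_event (y + 1) e \<eta> E" and e: "0 < e" "2 * e \<le> 1" and y: "0 \<le> y" and x: "x \<in> {1..k}"
  shows "\<bar>prob {\<omega> \<in> space P. M x 0 \<omega> \<le> y} - (1 - exp (- y))\<bar> \<le> 2 * e + \<eta>"
proof -
  define T where "T = y + 1"
  have T: "0 \<le> T" using y by (simp add: T_def)
  have Eev: "E \<in> events" "1 - \<eta> \<le> prob E" using E by (simp_all add: close_event_def)
  have Eclose: "AE \<omega> in P. \<omega> \<in> E \<longrightarrow> \<bar>M x T \<omega> - renewal_path (M x 0 \<omega>) (\<lambda>t. N x t \<omega>) T\<bar> \<le> e"
    using E T x unfolding close_event_def T_def by (auto elim: eventually_mono)
  let ?R = "\<lambda>a. {\<omega> \<in> space P. 1 \<le> N x T \<omega> - N x (T - a) \<omega>}"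
  let ?S = "{\<omega> \<in> space P. M x T \<omega> \<le> y}"
  have S: "?S \<in> events" by (rule mass_event[OF x T])
  have "prob ?S \<le> prob (?R (y + 2 * e)) + \<eta>"
  proof (rule prob_add_bad[OF Eev S])
    show "?R (y + 2 * e) \<in> events" using clock_event[OF x _ T, of "T - (y + 2 * e)"] e by (simp add: T_def)
    show "AE \<omega> in P. \<omega> \<in> ?S \<and> \<omega> \<in> E \<longrightarrow> \<omega> \<in> ?R (y + 2 * e)"
      using Eclose AE_meteor_path AE_start
    proof (eventually_elim, intro impI)
      fix \<omega> assume close: "\<omega> \<in> E \<longrightarrow> \<bar>M x T \<omega> - renewal_path (M x 0 \<omega>) (\<lambda>t. N x t \<omega>) T\<bar> \<le> e"
        and path: "meteor_path k (\<lambda>j t. N j t \<omega>) (\<lambda>j t. M j t \<omega>)"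
        and st: "(\<lambda>x. M x 0 \<omega>) \<in> mass_simplex k" and \<omega>: "\<omega> \<in> ?S \<and> \<omega> \<in> E"
      let ?s = "T - (y + 2 * e)"
      have s: "0 \<le> ?s" "?s \<le> T" using e y by (auto simp: T_def)
      have cp: "counting_path (\<lambda>t. N x t \<omega>)" by (rule meteor_path_counting[OF path x])
      have "N x ?s \<omega> \<noteq> N x T \<omega>"
      proof
        assume "N x ?s \<omega> = N x T \<omega>"
        from renewal_path_shift[OF cp s this, of "M x 0 \<omega>"]
        have "renewal_path (M x 0 \<omega>) (\<lambda>t. N x t \<omega>) T \<ge> y + 2 * e"
          using age_nonneg[OF s(1), of "\<lambda>t. N x t \<omega>"] mass_simplex_le(1)[OF st x] by (simp add: renewal_path_def)
        then show False using close \<omega> e by force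
      qed
      then show "\<omega> \<in> ?R (y + 2 * e)" using counting_path_mono[OF cp s] \<omega> by simp
    qed
  qed
  also have "prob (?R (y + 2 * e)) = 1 - exp (- (y + 2 * e))"
    using prob_clock_rings[OF x, of "T - (y + 2 * e)" T] e y by (simp add: T_def)
  finally have up: "prob ?S \<le> 1 - exp (- (y + 2 * e)) + \<eta>" .
  have lo: "1 - exp (- (y - e)) \<le> prob ?S + \<eta>" if ye: "e \<le> y"
  proof -
    have "prob (?R (y - e)) \<le> prob ?S + \<eta>"
    proof (rule prob_add_bad[OF Eev _ S])
      show "?R (y - e) \<in> events" using clock_event[OF x _ T, of "T - (y - e)"] e by (simp add: T_def)
      show "AE \<omega> in P. \<omega> \<in> ?R (y - e) \<and> \<omega> \<in> E \<longrightarrow> \<omega> \<in> ?S"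
        using Eclose AE_meteor_path
      proof (eventually_elim, intro impI)
        fix \<omega> assume close: "\<omega> \<in> E \<longrightarrow> \<bar>M x T \<omega> - renewal_path (M x 0 \<omega>) (\<lambda>t. N x t \<omega>) T\<bar> \<le> e"
          and path: "meteor_path k (\<lambda>j t. N j t \<omega>) (\<lambda>j t. M j t \<omega>)" and \<omega>: "\<omega> \<in> ?R (y - e) \<and> \<omega> \<in> E"
        have cp: "counting_path (\<lambda>t. N x t \<omega>)" by (rule meteor_path_counting[OF path x])
        have s: "0 \<le> T - (y - e)" "T - (y - e) \<le> T" using e ye by (auto simp: T_def)
        have "N x (T - (y - e)) \<omega> \<noteq> N x T \<omega>" using \<omega> by auto
        from renewal_path_after_jump(2)[OF cp s this, of "M x 0 \<omega>"]
        have "renewal_path (M x 0 \<omega>) (\<lambda>t. N x t \<omega>) T \<le> y - e" by simp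
        then show "\<omega> \<in> ?S" using close \<omega> by force
      qed
    qed
    moreover have "prob (?R (y - e)) = 1 - exp (- (y - e))"
      using prob_clock_rings[OF x, of "T - (y - e)" T] e ye by (simp add: T_def)
    ultimately show ?thesis by simp
  qed
  have "1 - exp (- y) \<le> prob ?S + \<eta> + e"
  proof (cases "e \<le> y")
    case True
    then show ?thesis using lo[OF True] exp_neg_Lipschitz[of "y - e" y] e by simp
  next
    case False
    have "1 - exp (- y) \<le> y" using exp_ge_add_one_self[of "- y"] by simp
    moreover have "0 \<le> \<eta>" using Eev(2) prob_le_1[of E] by linarith
    ultimately show ?thesis using False measure_nonneg[of P ?S] by linarith
  qed
  moreover have "prob ?S \<le> 1 - exp (- y) + \<eta> + 2 * e"
    using up exp_neg_Lipschitz[of y "y + 2 * e"] e y by simp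
  ultimately have "\<bar>prob ?S - (1 - exp (- y))\<bar> \<le> 2 * e + \<eta>" using e by linarith
  then show ?thesis using prob_mass_stationary[OF x T, of y] by simp
qed

end

section \<open>Independence of the initial state and the clocks\<close>

abbreviation path_space :: "(real \<Rightarrow> real) measure" where
  "path_space \<equiv> \<Pi>\<^sub>M t\<in>{0..}. borel"

context stationary_meteor
begin

text \<open>The independent data of the process: coordinate \<open>0\<close> carries the initial masses and coordinate
  \<open>j \<ge> 1\<close> the path of clock \<open>j\<close>. Both kinds are encoded as real functions on the half-line, the
  mass of vertex \<open>x\<close> sitting at the argument \<open>x\<close>, so that they form one family of random variables
  with values in the same space.\<close>

definition coord :: "nat \<Rightarrow> 'a \<Rightarrow> real \<Rightarrow> real" where
  "coord i \<omega> = (if i = 0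
     then (\<lambda>t\<in>{0..}. if nat \<lfloor>t\<rfloor> \<in> {1..k} then M (nat \<lfloor>t\<rfloor>) 0 \<omega> else 0)
     else (\<lambda>t\<in>{0..}. real (N i t \<omega>)))"

lemma coord_mass: "x \<in> {1..k} \<Longrightarrow> coord 0 \<omega> (real x) = M x 0 \<omega>"
  by (simp add: coord_def)

lemma coord_indep: "indep_vars (\<lambda>_. path_space) coord {0..k}"
  unfolding indep_vars_def2
proof (intro conjI ballI)
  let ?G = "\<lambda>i. if i = 0
      then vimage_algebra (space P) (state k M 0) (state_space k)
      else vimage_algebra (space P) (sample_path (N i)) (\<Pi>\<^sub>M t\<in>{0..}. count_space UNIV)"
  have G: "coord i \<in> ?G i \<rightarrow>\<^sub>M path_space" if i: "i \<in> {0..k}" for i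
  proof (cases "i = 0")
    case True
    let ?V = "vimage_algebra (space P) (state k M 0) (state_space k)"
    have sp: "state k M 0 \<in> ?V \<rightarrow>\<^sub>M state_space k"
      by (rule measurable_vimage_algebra1) (auto simp: state_def space_PiM)
    have m: "M x 0 \<in> borel_measurable ?V" if "x \<in> {1..k}" for x
    proof -
      have "(\<lambda>\<omega>. state k M 0 \<omega> x) \<in> borel_measurable ?V"
        by (rule measurable_compose[OF sp measurable_component_singleton[OF that]])
      then show ?thesis using that by (simp add: state_def)
    qed
    have "(\<lambda>\<omega>. \<lambda>t\<in>{0..}. if nat \<lfloor>t\<rfloor> \<in> {1..k} then M (nat \<lfloor>t\<rfloor>) 0 \<omega> else 0) \<in> ?V \<rightarrow>\<^sub>M path_space"
    proof (rule measurable_restrict)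
      fix t :: real
      show "(\<lambda>\<omega>. if nat \<lfloor>t\<rfloor> \<in> {1..k} then M (nat \<lfloor>t\<rfloor>) 0 \<omega> else 0) \<in> borel_measurable ?V"
        using m by (cases "nat \<lfloor>t\<rfloor> \<in> {1..k}") (simp_all only: if_True if_False borel_measurable_const)
    qed
    then show ?thesis using True by (simp add: coord_def[abs_def])
  next
    case False
    let ?V = "vimage_algebra (space P) (sample_path (N i)) (\<Pi>\<^sub>M t\<in>{0..}. count_space (UNIV :: nat set))"
    have sp: "sample_path (N i) \<in> ?V \<rightarrow>\<^sub>M (\<Pi>\<^sub>M t\<in>{0..}. count_space UNIV)"
      by (rule measurable_vimage_algebra1) (auto simp: sample_path_def space_PiM)
    have "(\<lambda>\<omega>. \<lambda>t\<in>{0..}. real (N i t \<omega>)) \<in> ?V \<rightarrow>\<^sub>M path_space"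
    proof (rule measurable_restrict)
      fix t :: real assume t: "t \<in> {0..}"
      have "(\<lambda>\<omega>. sample_path (N i) \<omega> t) \<in> ?V \<rightarrow>\<^sub>M count_space UNIV"
        by (rule measurable_compose[OF sp measurable_component_singleton[OF t]])
      then have "N i t \<in> ?V \<rightarrow>\<^sub>M count_space UNIV" using t by (simp add: sample_path_def)
      then show "(\<lambda>\<omega>. real (N i t \<omega>)) \<in> borel_measurable ?V" by measurable
    qed
    then show ?thesis using False by (simp add: coord_def[abs_def])
  qed
  have spG: "space (?G i) = space P" for i by simp
  have sets: "coord i -` A \<inter> space P \<in> sets (?G i)" if "i \<in> {0..k}" "A \<in> sets path_space" for i A
    using measurable_sets[OF G[OF that(1)] that(2)] by (simp only: spG)
  show "indep_sets (\<lambda>i. {coord i -` A \<inter> space P |A. A \<in> sets path_space}) {0..k}"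
  proof (rule indep_sets_mono_sets[OF independence])
    fix i assume i: "i \<in> {0..k}"
    show "{coord i -` A \<inter> space P |A. A \<in> sets path_space} \<subseteq>
      (if i = 0 then sets (vimage_algebra (space P) (state k M 0) (state_space k))
       else sets (vimage_algebra (space P) (sample_path (N i)) (\<Pi>\<^sub>M t\<in>{0..}. count_space UNIV)))"
      using sets[OF i] by (cases "i = 0") (auto simp only: if_True if_False simp_thms)
  qed
  fix i assume i: "i \<in> {0..k}"
  show "coord i \<in> P \<rightarrow>\<^sub>M path_space"
  proof (rule measurable_larger_source[OF G[OF i] _ spG])
    have "(if i = 0 then sets (vimage_algebra (space P) (state k M 0) (state_space k))
       else sets (vimage_algebra (space P) (sample_path (N i)) (\<Pi>\<^sub>M t\<in>{0..}. count_space UNIV))) \<subseteq> events"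
      using independence i unfolding indep_sets_def by blast
    then show "sets (?G i) \<subseteq> events" by (cases "i = 0") (simp_all only: if_True if_False simp_thms)
  qed
qed

lemma coord_measurable: "i \<in> {0..k} \<Longrightarrow> coord i \<in> P \<rightarrow>\<^sub>M path_space"
  using coord_indep unfolding indep_vars_def2 by blast

end

definition renewal_sample :: "real \<Rightarrow> (real \<Rightarrow> real) \<Rightarrow> real \<Rightarrow> real" where
  "renewal_sample m w = (\<lambda>t\<in>{0..}. renewal_path m w t)"

lemma age_measurable:
  assumes t: "0 \<le> t"
  shows "(\<lambda>w. age w t) \<in> borel_measurable path_space"
  unfolding age_def
proof (rule borel_measurable_cSUP)
  show "countable {q \<in> \<rat>. 0 \<le> q \<and> q \<le> t}" using countable_rat by (rule countable_subset[rotated]) auto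
  show "bdd_above ((\<lambda>q. if w (t - q) = w t then q else 0) ` {q \<in> \<rat>. 0 \<le> q \<and> q \<le> t})" for w :: "real \<Rightarrow> real"
    by (rule age_bdd)
  fix q assume "q \<in> {q \<in> \<rat>. 0 \<le> q \<and> q \<le> t}"
  then have "t - q \<in> {0..}" "t \<in> {0..}" using t by auto
  then have [measurable]: "(\<lambda>w. w (t - q)) \<in> borel_measurable path_space" "(\<lambda>w. w t) \<in> borel_measurable path_space"
    by (auto intro: measurable_component_singleton)
  show "(\<lambda>w. if w (t - q) = w t then q else 0) \<in> borel_measurable path_space" by measurable
qed

lemma renewal_sample_measurable:
  "(\<lambda>(m, w). renewal_sample m w) \<in> borel \<Otimes>\<^sub>M path_space \<rightarrow>\<^sub>M path_space"
  unfolding renewal_sample_def split_beta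
proof (rule measurable_restrict)
  fix t :: real assume t: "t \<in> {0..}"
  then have [measurable]: "(\<lambda>w. age w t) \<in> borel_measurable path_space"
      "(\<lambda>w. w t) \<in> borel_measurable path_space" "(\<lambda>w. w 0) \<in> borel_measurable path_space"
    using age_measurable[of t] by (auto intro: measurable_component_singleton)
  show "(\<lambda>x. renewal_path (fst x) (snd x) t) \<in> borel_measurable (borel \<Otimes>\<^sub>M path_space)"
    unfolding renewal_path_def by measurable
qed

context stationary_meteor
begin

lemma age_coord:
  assumes "0 < j" "0 \<le> t"
  shows "age (coord j \<omega>) t = age (\<lambda>t. N j t \<omega>) t"
proof -
  have "(if coord j \<omega> (t - q) = coord j \<omega> t then q else 0) = (if N j (t - q) \<omega> = N j t \<omega> then q else 0)"
    if "q \<in> {q \<in> \<rat>. 0 \<le> q \<and> q \<le> t}" for q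
    using that assms by (simp add: coord_def)
  then show ?thesis unfolding age_def by (intro SUP_cong) auto
qed

lemma renewal_sample_coord:
  assumes "0 < j"
  shows "renewal_sample m (coord j \<omega>) = restrict (renewal_path m (\<lambda>t. N j t \<omega>)) {0..}"
proof -
  have "renewal_path m (coord j \<omega>) t = renewal_path m (\<lambda>t. N j t \<omega>) t" if "0 \<le> t" for t
    using age_coord[OF assms that, of \<omega>] that assms by (simp add: renewal_path_def coord_def)
  then show ?thesis unfolding renewal_sample_def by (intro restrict_ext) auto
qed

text \<open>The clocks are integrated out first: given the initial masses, the renewal paths are
  independent.\<close>

lemma expectation_prod_renewal:
  fixes F :: "nat \<Rightarrow> (real \<Rightarrow> real) \<Rightarrow> real"
  assumes J: "J \<subseteq> {1..k}"
    and F: "\<And>j. j \<in> J \<Longrightarrow> F j \<in> borel_measurable path_space" "\<And>j w. j \<in> J \<Longrightarrow> \<bar>F j w\<bar> \<le> 1"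
  shows "expectation (\<lambda>\<omega>. \<Prod>j\<in>J. F j (renewal_sample (M j 0 \<omega>) (coord j \<omega>))) =
    expectation (\<lambda>\<omega>. \<Prod>j\<in>J. expectation (\<lambda>\<omega>'. F j (renewal_sample (M j 0 \<omega>) (coord j \<omega>'))))"
proof -
  have fin: "finite J" using J by (rule finite_subset) simp
  let ?X = "\<lambda>\<omega>. restrict (\<lambda>i. coord i \<omega>) {0}" and ?Y = "\<lambda>\<omega>. restrict (\<lambda>i. coord i \<omega>) J"
  let ?S = "PiM {0::nat} (\<lambda>_. path_space)" and ?T = "PiM J (\<lambda>_. path_space)"
  have ind: "indep_var ?S ?X ?T ?Y"
    by (rule indep_var_restrict[OF coord_indep]) (use J in auto)
  have rvX: "?X \<in> P \<rightarrow>\<^sub>M ?S" and rvY: "?Y \<in> P \<rightarrow>\<^sub>M ?T"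
    using ind by (simp_all only: indep_var_distribution_eq)
  interpret X: prob_space "distr P ?S ?X" by (rule prob_space_distr[OF rvX])
  interpret Y: prob_space "distr P ?T ?Y" by (rule prob_space_distr[OF rvY])
  interpret XY: pair_prob_space "distr P ?S ?X" "distr P ?T ?Y" ..
  define f where "f z = (\<Prod>j\<in>J. F j (renewal_sample (fst z 0 (real j)) (snd z j)))"
    for z :: "(nat \<Rightarrow> real \<Rightarrow> real) \<times> (nat \<Rightarrow> real \<Rightarrow> real)"
  have f_meas: "f \<in> borel_measurable (?S \<Otimes>\<^sub>M ?T)"
    unfolding f_def[abs_def]
  proof (rule borel_measurable_prod)
    fix j assume j: "j \<in> J"
    have a: "(\<lambda>z. fst z 0 (real j)) \<in> borel_measurable (?S \<Otimes>\<^sub>M ?T)"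
    proof -
      have "(\<lambda>z. fst z 0) \<in> ?S \<Otimes>\<^sub>M ?T \<rightarrow>\<^sub>M path_space"
        by (rule measurable_compose[OF measurable_fst measurable_component_singleton]) simp
      then show ?thesis
        by (rule measurable_compose[OF _ measurable_component_singleton]) simp
    qed
    have b: "(\<lambda>z. snd z j) \<in> ?S \<Otimes>\<^sub>M ?T \<rightarrow>\<^sub>M path_space"
      by (rule measurable_compose[OF measurable_snd measurable_component_singleton[OF j]])
    have "(\<lambda>z. (fst z 0 (real j), snd z j)) \<in> ?S \<Otimes>\<^sub>M ?T \<rightarrow>\<^sub>M borel \<Otimes>\<^sub>M path_space"
      using a b by (rule measurable_Pair)
    from measurable_compose[OF measurable_compose[OF this renewal_sample_measurable] F(1)[OF j]]
    show "(\<lambda>z. F j (renewal_sample (fst z 0 (real j)) (snd z j))) \<in> borel_measurable (?S \<Otimes>\<^sub>M ?T)"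
      by simp
  qed
  have f_bound: "\<bar>f z\<bar> \<le> 1" for z
    unfolding f_def using F(2) by (simp only: abs_prod) (intro prod_le_1, auto)
  have distr_eq: "distr P (?S \<Otimes>\<^sub>M ?T) (\<lambda>\<omega>. (?X \<omega>, ?Y \<omega>)) = distr P ?S ?X \<Otimes>\<^sub>M distr P ?T ?Y"
    using ind by (simp only: indep_var_distribution_eq)
  have f_int: "integrable (distr P ?S ?X \<Otimes>\<^sub>M distr P ?T ?Y) f"
    by (rule XY.integrable_const_bound[where B = 1])
      (use f_meas f_bound in \<open>simp_all cong: measurable_cong_sets\<close>)
  have rvXY: "(\<lambda>\<omega>. (?X \<omega>, ?Y \<omega>)) \<in> P \<rightarrow>\<^sub>M ?S \<Otimes>\<^sub>M ?T" using rvX rvY by (rule measurable_Pair)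
  have "expectation (\<lambda>\<omega>. \<Prod>j\<in>J. F j (renewal_sample (M j 0 \<omega>) (coord j \<omega>))) = expectation (\<lambda>\<omega>. f (?X \<omega>, ?Y \<omega>))"
    using J by (intro Bochner_Integration.integral_cong refl) (auto simp: f_def coord_mass subset_iff intro!: prod.cong)
  also have "\<dots> = integral\<^sup>L (distr P (?S \<Otimes>\<^sub>M ?T) (\<lambda>\<omega>. (?X \<omega>, ?Y \<omega>))) f"
    by (rule integral_distr[symmetric, OF rvXY f_meas])
  also have "\<dots> = (\<integral>a. (\<integral>b. f (a, b) \<partial>distr P ?T ?Y) \<partial>distr P ?S ?X)"
    unfolding distr_eq by (rule XY.integral_fst'[symmetric, OF f_int])
  also have "\<dots> = (\<integral>\<omega>. (\<integral>b. f (?X \<omega>, b) \<partial>distr P ?T ?Y) \<partial>P)"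
  proof (rule integral_distr[OF rvX])
    show "(\<lambda>a. \<integral>b. f (a, b) \<partial>distr P ?T ?Y) \<in> borel_measurable ?S"
      by (rule Y.borel_measurable_lebesgue_integral) (use f_meas in \<open>simp cong: measurable_cong_sets\<close>)
  qed
  also have "\<dots> = (\<integral>\<omega>. (\<Prod>j\<in>J. expectation (\<lambda>\<omega>'. F j (renewal_sample (M j 0 \<omega>) (coord j \<omega>')))) \<partial>P)"
  proof (rule Bochner_Integration.integral_cong[OF refl])
    fix \<omega> assume \<omega>: "\<omega> \<in> space P"
    have meas_j: "(\<lambda>w. F j (renewal_sample m w)) \<in> borel_measurable path_space" if "j \<in> J" for j m
      using measurable_compose[OF measurable_compose[OF measurable_Pair[OF measurable_const measurable_ident_sets[OF refl]] renewal_sample_measurable] F(1)[OF that], of m]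
      by simp
    have fm: "(\<lambda>b. f (?X \<omega>, b)) \<in> borel_measurable ?T"
      using measurable_compose[OF measurable_Pair1'[OF measurable_space[OF rvX \<omega>]] f_meas] .
    have "(\<integral>b. f (?X \<omega>, b) \<partial>distr P ?T ?Y) = expectation (\<lambda>\<omega>'. f (?X \<omega>, ?Y \<omega>'))"
      by (rule integral_distr[OF rvY fm])
    also have "\<dots> = expectation (\<lambda>\<omega>'. \<Prod>j\<in>J. F j (renewal_sample (M j 0 \<omega>) (coord j \<omega>')))"
      using J by (intro Bochner_Integration.integral_cong refl) (auto simp: f_def coord_mass subset_iff intro!: prod.cong)
    also have "\<dots> = (\<Prod>j\<in>J. expectation (\<lambda>\<omega>'. F j (renewal_sample (M j 0 \<omega>) (coord j \<omega>'))))"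
    proof (rule indep_vars_lebesgue_integral[OF fin])
      have "indep_vars (\<lambda>_. path_space) coord J" using J by (intro indep_vars_subset[OF coord_indep]) auto
      then show "indep_vars (\<lambda>_. borel) (\<lambda>j \<omega>'. F j (renewal_sample (M j 0 \<omega>) (coord j \<omega>'))) J"
        by (rule indep_vars_compose2) (rule meas_j)
      show "integrable P (\<lambda>\<omega>'. F j (renewal_sample (M j 0 \<omega>) (coord j \<omega>')))" if j: "j \<in> J" for j
        by (rule bounded_integrable[where B = 1])
          (use measurable_compose[OF coord_measurable meas_j[OF j]] j J F(2)[OF j] in auto)
    qed
    finally show "(\<integral>b. f (?X \<omega>, b) \<partial>distr P ?T ?Y) =
      (\<Prod>j\<in>J. expectation (\<lambda>\<omega>'. F j (renewal_sample (M j 0 \<omega>) (coord j \<omega>'))))" .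
  qed
  finally show ?thesis .
qed

end

section \<open>Propagation of chaos\<close>

context prob_space
begin

text \<open>Two functions with values in \<open>[- 1, 1]\<close> differ by at most two on the exceptional set.\<close>

lemma expectation_close:
  fixes f g :: "'a \<Rightarrow> real"
  assumes f: "f \<in> borel_measurable M" "\<And>\<omega>. \<bar>f \<omega>\<bar> \<le> 1"
    and g: "g \<in> borel_measurable M" "\<And>\<omega>. \<bar>g \<omega>\<bar> \<le> 1"
    and A: "A \<in> events" "1 - \<zeta> \<le> prob A" and e: "0 \<le> e"
    and close: "AE \<omega> in M. \<omega> \<in> A \<longrightarrow> \<bar>f \<omega> - g \<omega>\<bar> \<le> e"
  shows "expectation (\<lambda>\<omega>. \<bar>f \<omega> - g \<omega>\<bar>) \<le> e + 2 * \<zeta>"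
proof -
  have int: "integrable M f" "integrable M g"
    by (rule integrable_const_bound[where B = 1]; use f g in auto)+
  have bad: "space M - A \<in> events" using A by auto
  have ind: "integrable M (\<lambda>\<omega>. e + 2 * indicator (space M - A) \<omega>)"
    using bad by (intro Bochner_Integration.integrable_add integrable_mult_right integrable_real_indicator)
      (simp_all add: emeasure_eq_measure)
  have "expectation (\<lambda>\<omega>. \<bar>f \<omega> - g \<omega>\<bar>) \<le> expectation (\<lambda>\<omega>. e + 2 * indicator (space M - A) \<omega>)"
  proof (rule integral_mono_AE)
    show "integrable M (\<lambda>\<omega>. \<bar>f \<omega> - g \<omega>\<bar>)" using int by auto
    show "AE \<omega> in M. \<bar>f \<omega> - g \<omega>\<bar> \<le> e + 2 * indicator (space M - A) \<omega>"
      using close AE_space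
    proof eventually_elim
      case (elim \<omega>)
      have "\<bar>f \<omega> - g \<omega>\<bar> \<le> 2" using f(2)[of \<omega>] g(2)[of \<omega>] by linarith
      then show ?case using elim e by (cases "\<omega> \<in> A") auto
    qed
  qed (rule ind)
  also have "\<dots> = e + 2 * prob (space M - A)"
    using bad by (subst Bochner_Integration.integral_add) (auto simp: prob_space emeasure_eq_measure)
  also have "\<dots> \<le> e + 2 * \<zeta>" using prob_compl[OF A(1)] A(2) by linarith
  finally show ?thesis .
qed

lemma expectation_prod_close:
  fixes f g :: "'i \<Rightarrow> 'a \<Rightarrow> real"
  assumes J: "finite J"
    and f: "\<And>j. j \<in> J \<Longrightarrow> f j \<in> borel_measurable M" "\<And>j \<omega>. j \<in> J \<Longrightarrow> \<bar>f j \<omega>\<bar> \<le> 1"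
    and g: "\<And>j. j \<in> J \<Longrightarrow> g j \<in> borel_measurable M" "\<And>j \<omega>. j \<in> J \<Longrightarrow> \<bar>g j \<omega>\<bar> \<le> 1"
    and close: "\<And>j. j \<in> J \<Longrightarrow> expectation (\<lambda>\<omega>. \<bar>f j \<omega> - g j \<omega>\<bar>) \<le> \<beta>"
  shows "\<bar>expectation (\<lambda>\<omega>. \<Prod>j\<in>J. f j \<omega>) - expectation (\<lambda>\<omega>. \<Prod>j\<in>J. g j \<omega>)\<bar> \<le> real (card J) * \<beta>"
proof -
  have int_f: "integrable M (f j)" and int_g: "integrable M (g j)" if "j \<in> J" for j
    by (rule integrable_const_bound[where B = 1]; use f g that in auto)+
  have prod_int: "integrable M (\<lambda>\<omega>. \<Prod>j\<in>J. u j \<omega>)"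
    if u: "\<And>j. j \<in> J \<Longrightarrow> u j \<in> borel_measurable M" "\<And>j \<omega>. j \<in> J \<Longrightarrow> \<bar>u j \<omega>\<bar> \<le> 1" for u :: "'i \<Rightarrow> 'a \<Rightarrow> real"
  proof (rule integrable_const_bound[where B = 1])
    show "(\<lambda>\<omega>. \<Prod>j\<in>J. u j \<omega>) \<in> borel_measurable M" using u(1) by (rule borel_measurable_prod)
    show "AE \<omega> in M. norm (\<Prod>j\<in>J. u j \<omega>) \<le> 1"
      using u(2) by (intro AE_I2) (simp add: abs_prod prod_le_1)
  qed
  have "\<bar>expectation (\<lambda>\<omega>. \<Prod>j\<in>J. f j \<omega>) - expectation (\<lambda>\<omega>. \<Prod>j\<in>J. g j \<omega>)\<bar> =
      \<bar>expectation (\<lambda>\<omega>. (\<Prod>j\<in>J. f j \<omega>) - (\<Prod>j\<in>J. g j \<omega>))\<bar>"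
    by (simp only: Bochner_Integration.integral_diff[OF prod_int[OF f] prod_int[OF g]])
  also have "\<dots> \<le> expectation (\<lambda>\<omega>. \<bar>(\<Prod>j\<in>J. f j \<omega>) - (\<Prod>j\<in>J. g j \<omega>)\<bar>)"
    by (rule integral_abs_bound)
  also have "\<dots> \<le> expectation (\<lambda>\<omega>. \<Sum>j\<in>J. \<bar>f j \<omega> - g j \<omega>\<bar>)"
  proof (rule integral_mono)
    show "integrable M (\<lambda>\<omega>. \<bar>(\<Prod>j\<in>J. f j \<omega>) - (\<Prod>j\<in>J. g j \<omega>)\<bar>)"
      by (intro integrable_abs Bochner_Integration.integrable_diff prod_int f g)
    show "integrable M (\<lambda>\<omega>. \<Sum>j\<in>J. \<bar>f j \<omega> - g j \<omega>\<bar>)"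
      by (intro Bochner_Integration.integrable_sum integrable_abs Bochner_Integration.integrable_diff int_f int_g)
    show "\<bar>(\<Prod>j\<in>J. f j \<omega>) - (\<Prod>j\<in>J. g j \<omega>)\<bar> \<le> (\<Sum>j\<in>J. \<bar>f j \<omega> - g j \<omega>\<bar>)" for \<omega>
      using norm_prod_diff[of J "\<lambda>j. f j \<omega>" "\<lambda>j. g j \<omega>"] f(2) g(2) by simp
  qed
  also have "\<dots> = (\<Sum>j\<in>J. expectation (\<lambda>\<omega>. \<bar>f j \<omega> - g j \<omega>\<bar>))"
    by (intro Bochner_Integration.integral_sum integrable_abs Bochner_Integration.integrable_diff int_f int_g)
  also have "\<dots> \<le> real (card J) * \<beta>" by (rule sum_bounded_above) (rule close)
  finally show ?thesis .
qed

end

context stationary_meteor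
begin

lemma sample_path_measurable:
  assumes "j \<in> {1..k}"
  shows "sample_path (M j) \<in> P \<rightarrow>\<^sub>M path_space"
  unfolding sample_path_def[abs_def] by (intro measurable_restrict mass_measurable assms) auto

lemma renewal_sample_rv:
  assumes j: "j \<in> {1..k}" and m: "m \<in> borel_measurable P"
  shows "(\<lambda>\<omega>. renewal_sample (m \<omega>) (coord j \<omega>)) \<in> P \<rightarrow>\<^sub>M path_space"
proof -
  have "(\<lambda>\<omega>. (m \<omega>, coord j \<omega>)) \<in> P \<rightarrow>\<^sub>M borel \<Otimes>\<^sub>M path_space"
    by (rule measurable_Pair[OF m coord_measurable]) (use j in auto)
  from measurable_compose[OF this renewal_sample_measurable] show ?thesis by simp
qed

definition mean_functional :: "((real \<Rightarrow> real) \<Rightarrow> real) \<Rightarrow> nat \<Rightarrow> real \<Rightarrow> real" where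
  "mean_functional F j m = expectation (\<lambda>\<omega>. F (renewal_sample m (coord j \<omega>)))"

lemma mean_functional_bound:
  assumes "\<And>w. \<bar>F w\<bar> \<le> 1"
  shows "\<bar>mean_functional F j m\<bar> \<le> 1"
proof (cases "integrable P (\<lambda>\<omega>. F (renewal_sample m (coord j \<omega>)))")
  case True
  have "\<bar>mean_functional F j m\<bar> \<le> expectation (\<lambda>\<omega>. \<bar>F (renewal_sample m (coord j \<omega>))\<bar>)"
    unfolding mean_functional_def by (rule integral_abs_bound)
  also have "\<dots> \<le> expectation (\<lambda>\<omega>. 1)"
    using True assms by (intro integral_mono) auto
  finally show ?thesis by (simp add: prob_space)
qed (simp add: mean_functional_def not_integrable_integral_eq)

lemma mean_functional_measurable:
  assumes j: "j \<in> {1..k}" and F: "F \<in> borel_measurable path_space"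
  shows "mean_functional F j \<in> borel_measurable borel"
  unfolding mean_functional_def[abs_def]
proof (rule borel_measurable_lebesgue_integral)
  have "(\<lambda>z. (fst z, coord j (snd z))) \<in> borel \<Otimes>\<^sub>M P \<rightarrow>\<^sub>M borel \<Otimes>\<^sub>M path_space"
    by (intro measurable_Pair measurable_fst measurable_compose[OF measurable_snd coord_measurable]) (use j in auto)
  from measurable_compose[OF measurable_compose[OF this renewal_sample_measurable] F]
  show "(\<lambda>(m, \<omega>). F (renewal_sample m (coord j \<omega>))) \<in> borel_measurable (borel \<Otimes>\<^sub>M P)"
    by (simp add: split_beta)
qed

text \<open>Moving the start value by \<open>\<delta>\<close> moves the whole renewal path by at most \<open>\<delta>\<close>, so that the modulus of
  continuity of the functional on a compact set of paths passes to its expectation.\<close>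

lemma mean_functional_continuous:
  assumes j: "j \<in> {1..k}" and F: "F \<in> borel_measurable path_space" "\<And>w. \<bar>F w\<bar> \<le> 1"
    and D: "D \<in> events" "1 - \<eta> \<le> prob D" "AE \<omega> in P. \<omega> \<in> D \<longrightarrow> (\<lambda>t. N j t \<omega>) \<in> tight_paths b q"
    and q: "\<And>T. 0 < q T"
    and mod: "uniform_modulus F (tight_paths b q) K \<delta> T \<epsilon>" and \<epsilon>: "0 \<le> \<epsilon>"
    and m: "m \<in> {0..K}" and m': "\<bar>m' - m\<bar> \<le> \<delta>"
  shows "\<bar>mean_functional F j m' - mean_functional F j m\<bar> \<le> \<epsilon> + 2 * \<eta>"
proof -
  let ?f = "\<lambda>m \<omega>. F (renewal_sample m (coord j \<omega>))"
  have f: "?f m \<in> borel_measurable P" for m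
    by (rule measurable_compose[OF renewal_sample_rv[OF j borel_measurable_const] F(1)])
  have "AE \<omega> in P. \<omega> \<in> D \<longrightarrow> \<bar>?f m' \<omega> - ?f m \<omega>\<bar> \<le> \<epsilon>"
    using D(3)
  proof (eventually_elim, intro impI)
    fix \<omega> assume "\<omega> \<in> D \<longrightarrow> (\<lambda>t. N j t \<omega>) \<in> tight_paths b q" "\<omega> \<in> D"
    then have c: "(\<lambda>t. N j t \<omega>) \<in> tight_paths b q" by simp
    have "\<bar>restrict (renewal_path m' (\<lambda>t. N j t \<omega>)) {0..} t - renewal_path m (\<lambda>t. N j t \<omega>) t\<bar> \<le> \<delta>"
      if "0 \<le> t" for t
      using renewal_path_start[of m' "\<lambda>t. N j t \<omega>" t m] m' that by simp
    then have "\<bar>F (restrict (renewal_path m' (\<lambda>t. N j t \<omega>)) {0..}) -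
        F (restrict (renewal_path m (\<lambda>t. N j t \<omega>)) {0..})\<bar> \<le> \<epsilon>"
      using mod c m renewal_path_cadlag[OF c q] unfolding uniform_modulus_def by blast
    then show "\<bar>?f m' \<omega> - ?f m \<omega>\<bar> \<le> \<epsilon>"
      using j by (simp add: renewal_sample_coord)
  qed
  then have "expectation (\<lambda>\<omega>. \<bar>?f m' \<omega> - ?f m \<omega>\<bar>) \<le> \<epsilon> + 2 * \<eta>"
    by (intro expectation_close[OF f F(2) f F(2) D(1,2) \<epsilon>])
  moreover have int: "integrable P (?f m)" for m
    by (rule bounded_integrable[OF f, where B = 1]) (use F in auto)
  have "\<bar>mean_functional F j m' - mean_functional F j m\<bar> \<le> expectation (\<lambda>\<omega>. \<bar>?f m' \<omega> - ?f m \<omega>\<bar>)"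
    unfolding mean_functional_def Bochner_Integration.integral_diff[OF int int, symmetric]
    by (rule integral_abs_bound)
  ultimately show ?thesis by simp
qed

lemma expectation_prod_stationary:
  assumes J: "J \<subseteq> {1..k}" and g: "\<And>j. j \<in> J \<Longrightarrow> g j \<in> borel_measurable borel" and t: "0 \<le> t"
  shows "expectation (\<lambda>\<omega>. \<Prod>j\<in>J. g j (M j 0 \<omega>)) = expectation (\<lambda>\<omega>. \<Prod>j\<in>J. (g j (M j t \<omega>) :: real))"
proof -
  have "(\<lambda>m. \<Prod>j\<in>J. g j (m j)) \<in> borel_measurable (state_space k)"
  proof (rule borel_measurable_prod)
    fix j assume j: "j \<in> J"
    then have "j \<in> {1..k}" using J by blast
    then show "(\<lambda>m. g j (m j)) \<in> borel_measurable (state_space k)"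
      by (rule measurable_compose[OF measurable_component_singleton[of j "{1..k}" "\<lambda>_. borel"] g[OF j]])
  qed
  from expectation_stationary[OF this t]
  have "expectation (\<lambda>\<omega>. \<Prod>j\<in>J. g j (state k M t \<omega> j)) = expectation (\<lambda>\<omega>. \<Prod>j\<in>J. g j (state k M 0 \<omega> j))" .
  moreover have "(\<Prod>j\<in>J. g j (state k M s \<omega> j)) = (\<Prod>j\<in>J. g j (M j s \<omega>))" for s \<omega>
    using J by (intro prod.cong refl) (auto simp: state_def)
  ultimately show ?thesis by simp
qed

text \<open>The key estimate. The masses are replaced by renewal paths, the clocks are integrated out,
  the initial state is exchanged for the state at time \<open>T\<close> by stationarity, and this state is
  replaced by the vector of ages, which is a function of the independent clocks.\<close>

lemma expectation_prod_factorizes: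
  fixes F :: "nat \<Rightarrow> (real \<Rightarrow> real) \<Rightarrow> real"
  assumes J: "J \<subseteq> {1..k}"
    and F: "\<And>j. j \<in> J \<Longrightarrow> F j \<in> borel_measurable path_space" "\<And>j w. j \<in> J \<Longrightarrow> \<bar>F j w\<bar> \<le> 1"
    and mod: "\<And>j. j \<in> J \<Longrightarrow> uniform_modulus (F j) (tight_paths b q) (T + 1) \<delta> T1 \<epsilon>"
    and T: "0 \<le> T" "exp (- T) \<le> \<eta>" "T \<le> T1" and \<delta>: "0 < \<delta>" "\<delta> \<le> 1" and \<epsilon>: "0 \<le> \<epsilon>"
    and E: "close_event T1 \<delta> \<eta> E" and q: "\<And>T. 0 < q T"
    and D: "\<And>j. j \<in> J \<Longrightarrow> D j \<in> events" "\<And>j. j \<in> J \<Longrightarrow> 1 - \<eta> \<le> prob (D j)"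
      "\<And>j. j \<in> J \<Longrightarrow> AE \<omega> in P. \<omega> \<in> D j \<longrightarrow> (\<lambda>t. N j t \<omega>) \<in> tight_paths b q"
  shows "\<bar>expectation (\<lambda>\<omega>. \<Prod>j\<in>J. F j (sample_path (M j) \<omega>)) -
      (\<Prod>j\<in>J. expectation (\<lambda>\<omega>. mean_functional (F j) j (age (coord j \<omega>) T)))\<bar>
    \<le> real (card J) * (2 * \<epsilon> + 14 * \<eta>)"
proof -
  have fin: "finite J" using J by (rule finite_subset) simp
  have Jk: "j \<in> {1..k}" if "j \<in> J" for j using J that by blast
  have Eev: "E \<in> events" "1 - \<eta> \<le> prob E" using E by (simp_all add: close_event_def)
  have Eclose: "AE \<omega> in P. \<omega> \<in> E \<longrightarrow> (\<forall>x\<in>{1..k}. \<forall>t. 0 \<le> t \<and> t \<le> T1 \<longrightarrow>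
      \<bar>M x t \<omega> - renewal_path (M x 0 \<omega>) (\<lambda>t. N x t \<omega>) t\<bar> \<le> \<delta>)"
    using E by (simp add: close_event_def)
  have T1: "0 \<le> T1" using T by simp
  let ?rung = "\<lambda>j. {\<omega> \<in> space P. 1 \<le> N j T \<omega> - N j 0 \<omega>}"
  have rung: "?rung j \<in> events" "1 - \<eta> \<le> prob (?rung j)" if "j \<in> {1..k}" for j
    using clock_event[OF that order_refl T(1)] prob_clock_rings[OF that order_refl T(1)] T(2) by auto
  have inter: "1 - (a + b) \<le> prob (A \<inter> B)"
    if A: "A \<in> events" "1 - a \<le> prob A" and B: "B \<in> events" "1 - b \<le> prob B" for A B a b
  proof -
    have "prob A \<le> prob (A \<inter> B) + b"
      by (rule prob_add_bad[OF B A(1)]) (use A B in auto)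
    then show ?thesis using A by simp
  qed
  \<comment> \<open>Once its clock has rung, a vertex has a mass close to its age.\<close>
  have at_T: "AE \<omega> in P. \<omega> \<in> E \<inter> ?rung j \<longrightarrow>
      \<bar>M j T \<omega> - age (coord j \<omega>) T\<bar> \<le> \<delta> \<and> age (coord j \<omega>) T \<in> {0..T}" if j: "j \<in> {1..k}" for j
    using Eclose
  proof (eventually_elim, intro impI)
    fix \<omega> assume cl: "\<omega> \<in> E \<longrightarrow> (\<forall>x\<in>{1..k}. \<forall>t. 0 \<le> t \<and> t \<le> T1 \<longrightarrow>
        \<bar>M x t \<omega> - renewal_path (M x 0 \<omega>) (\<lambda>t. N x t \<omega>) t\<bar> \<le> \<delta>)"
      and \<omega>: "\<omega> \<in> E \<inter> ?rung j"
    have "\<bar>M j T \<omega> - renewal_path (M j 0 \<omega>) (\<lambda>t. N j t \<omega>) T\<bar> \<le> \<delta>"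
      using cl \<omega> j T by blast
    moreover have "N j T \<omega> \<noteq> N j 0 \<omega>" using \<omega> by auto
    ultimately show "\<bar>M j T \<omega> - age (coord j \<omega>) T\<bar> \<le> \<delta> \<and> age (coord j \<omega>) T \<in> {0..T}"
      using age_coord[of j T \<omega>] age_nonneg[OF T(1), of "\<lambda>t. N j t \<omega>"]
        age_le[OF T(1), of "\<lambda>t. N j t \<omega>"] j T(1) by (simp add: renewal_path_def)
  qed
  let ?low = "\<lambda>j. {\<omega> \<in> space P. M j 0 \<omega> \<le> T + 1}"
  have low: "?low j \<in> events" "1 - (\<eta> + \<eta>) \<le> prob (?low j)" if j: "j \<in> {1..k}" for j
  proof -
    show "?low j \<in> events" by (rule mass_event[OF j]) simp
    have ER: "E \<inter> ?rung j \<in> events" using Eev rung[OF j] by auto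
    have ev: "{\<omega> \<in> space P. M j T \<omega> \<le> T + 1} \<in> events" by (rule mass_event[OF j T(1)])
    have "1 - (\<eta> + \<eta>) \<le> prob (E \<inter> ?rung j)" by (rule inter[OF Eev rung[OF j]])
    also have "\<dots> \<le> prob {\<omega> \<in> space P. M j T \<omega> \<le> T + 1}"
    proof (rule finite_measure_mono_AE[OF _ ev])
      show "AE \<omega> in P. \<omega> \<in> E \<inter> ?rung j \<longrightarrow> \<omega> \<in> {\<omega> \<in> space P. M j T \<omega> \<le> T + 1}"
        using at_T[OF j] AE_space by eventually_elim (use \<delta> in force)
    qed
    finally show "1 - (\<eta> + \<eta>) \<le> prob (?low j)" using prob_mass_stationary[OF j T(1)] by simp
  qed
  let ?f = "\<lambda>j \<omega>. F j (sample_path (M j) \<omega>)"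
  let ?r = "\<lambda>j \<omega>. F j (renewal_sample (M j 0 \<omega>) (coord j \<omega>))"
  have f: "?f j \<in> borel_measurable P" if "j \<in> J" for j
    by (rule measurable_compose[OF sample_path_measurable[OF Jk[OF that]] F(1)[OF that]])
  have r: "?r j \<in> borel_measurable P" if "j \<in> J" for j
    by (rule measurable_compose[OF renewal_sample_rv[OF Jk[OF that] mass_measurable[OF Jk[OF that] order_refl]] F(1)[OF that]])
  \<comment> \<open>The exceptional probability is \<open>4 \<eta>\<close>: once \<open>\<eta>\<close> for the masses not being close to renewal paths,
    once for the clock leaving the compact set, and twice for an initial mass above \<open>T + 1\<close>, which
    by stationarity is as unlikely as such a mass at time \<open>T\<close>.\<close>
  have step1: "expectation (\<lambda>\<omega>. \<bar>?f j \<omega> - ?r j \<omega>\<bar>) \<le> \<epsilon> + 2 * (\<eta> + \<eta> + (\<eta> + \<eta>))" if j: "j \<in> J" for j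
  proof (rule expectation_close[OF f[OF j] F(2)[OF j] r[OF j] F(2)[OF j] _ _ \<epsilon>])
    show "E \<inter> D j \<inter> ?low j \<in> events" using Eev D(1)[OF j] low(1)[OF Jk[OF j]] by auto
    show "1 - (\<eta> + \<eta> + (\<eta> + \<eta>)) \<le> prob (E \<inter> D j \<inter> ?low j)"
      by (rule inter[OF _ inter[OF Eev D(1,2)[OF j]] low[OF Jk[OF j]]]) (use Eev D(1)[OF j] in auto)
    show "AE \<omega> in P. \<omega> \<in> E \<inter> D j \<inter> ?low j \<longrightarrow> \<bar>?f j \<omega> - ?r j \<omega>\<bar> \<le> \<epsilon>"
      using Eclose D(3)[OF j] AE_meteor_path AE_start
    proof (eventually_elim, intro impI)
      fix \<omega>
      assume cl: "\<omega> \<in> E \<longrightarrow> (\<forall>x\<in>{1..k}. \<forall>t. 0 \<le> t \<and> t \<le> T1 \<longrightarrow>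
          \<bar>M x t \<omega> - renewal_path (M x 0 \<omega>) (\<lambda>t. N x t \<omega>) t\<bar> \<le> \<delta>)"
        and tp: "\<omega> \<in> D j \<longrightarrow> (\<lambda>t. N j t \<omega>) \<in> tight_paths b q"
        and path: "meteor_path k (\<lambda>j t. N j t \<omega>) (\<lambda>j t. M j t \<omega>)"
        and st: "(\<lambda>x. M x 0 \<omega>) \<in> mass_simplex k"
        and \<omega>: "\<omega> \<in> E \<inter> D j \<inter> ?low j"
      have cad: "sample_path (M j) \<omega> \<in> cadlag"
        using meteor_path_cadlag[OF path Jk[OF j]] by (simp add: sample_path_def)
      have m: "M j 0 \<omega> \<in> {0..T + 1}" using \<omega> mass_simplex_le(1)[OF st Jk[OF j]] by simp
      have "\<forall>t. 0 \<le> t \<and> t \<le> T1 \<longrightarrow>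
          \<bar>sample_path (M j) \<omega> t - renewal_path (M j 0 \<omega>) (\<lambda>t. N j t \<omega>) t\<bar> \<le> \<delta>"
        using cl \<omega> Jk[OF j] by (simp add: sample_path_def)
      then have "\<bar>F j (sample_path (M j) \<omega>) - F j (restrict (renewal_path (M j 0 \<omega>) (\<lambda>t. N j t \<omega>)) {0..})\<bar> \<le> \<epsilon>"
        using mod[OF j] tp \<omega> cad m unfolding uniform_modulus_def by blast
      then show "\<bar>?f j \<omega> - ?r j \<omega>\<bar> \<le> \<epsilon>" using Jk[OF j] by (simp add: renewal_sample_coord)
    qed
  qed
  let ?g = "\<lambda>j. mean_functional (F j) j"
  have gb: "\<bar>?g j m\<bar> \<le> 1" if "j \<in> J" for j m by (rule mean_functional_bound[OF F(2)[OF that]])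
  have gm: "?g j \<in> borel_measurable borel" if "j \<in> J" for j
    by (rule mean_functional_measurable[OF Jk[OF that] F(1)[OF that]])
  have am: "(\<lambda>\<omega>. ?g j (age (coord j \<omega>) T)) \<in> borel_measurable P" if "j \<in> J" for j
    by (rule measurable_compose[OF measurable_compose[OF coord_measurable age_measurable[OF T(1)]] gm[OF that]])
      (use Jk[OF that] in auto)
  have Mm: "(\<lambda>\<omega>. ?g j (M j T \<omega>)) \<in> borel_measurable P" if "j \<in> J" for j
    by (rule measurable_compose[OF mass_measurable[OF Jk[OF that] T(1)] gm[OF that]])
  \<comment> \<open>Here \<open>\<epsilon> + 2 \<eta>\<close> is the modulus of continuity of the mean functionals, and two exceptional sets
    remain: the approximation fails at time \<open>T\<close>, or the clock has not rung.\<close>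
  have step2: "expectation (\<lambda>\<omega>. \<bar>?g j (M j T \<omega>) - ?g j (age (coord j \<omega>) T)\<bar>) \<le> (\<epsilon> + 2 * \<eta>) + 2 * (\<eta> + \<eta>)"
    if j: "j \<in> J" for j
  proof (rule expectation_close[OF Mm[OF j] gb[OF j] am[OF j] gb[OF j]])
    show "E \<inter> ?rung j \<in> events" using Eev rung(1)[OF Jk[OF j]] by auto
    show "1 - (\<eta> + \<eta>) \<le> prob (E \<inter> ?rung j)" by (rule inter[OF Eev rung[OF Jk[OF j]]])
    show "0 \<le> \<epsilon> + 2 * \<eta>" using \<epsilon> T(2) exp_gt_zero[of "- T"] by linarith
    show "AE \<omega> in P. \<omega> \<in> E \<inter> ?rung j \<longrightarrow> \<bar>?g j (M j T \<omega>) - ?g j (age (coord j \<omega>) T)\<bar> \<le> \<epsilon> + 2 * \<eta>"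
      using at_T[OF Jk[OF j]]
    proof (eventually_elim, intro impI)
      fix \<omega> assume "\<omega> \<in> E \<inter> ?rung j \<longrightarrow>
          \<bar>M j T \<omega> - age (coord j \<omega>) T\<bar> \<le> \<delta> \<and> age (coord j \<omega>) T \<in> {0..T}" "\<omega> \<in> E \<inter> ?rung j"
      then have "\<bar>M j T \<omega> - age (coord j \<omega>) T\<bar> \<le> \<delta>" "age (coord j \<omega>) T \<in> {0..T + 1}" by auto
      then show "\<bar>?g j (M j T \<omega>) - ?g j (age (coord j \<omega>) T)\<bar> \<le> \<epsilon> + 2 * \<eta>"
        by (intro mean_functional_continuous[OF Jk[OF j] F[OF j] D[OF j] q mod[OF j] \<epsilon>])
    qed
  qed
  have "expectation (\<lambda>\<omega>. \<Prod>j\<in>J. ?r j \<omega>) = expectation (\<lambda>\<omega>. \<Prod>j\<in>J. ?g j (M j 0 \<omega>))"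
    unfolding mean_functional_def by (rule expectation_prod_renewal[OF J F])
  also have "\<dots> = expectation (\<lambda>\<omega>. \<Prod>j\<in>J. ?g j (M j T \<omega>))"
    by (rule expectation_prod_stationary[OF J gm T(1)])
  finally have eq1: "expectation (\<lambda>\<omega>. \<Prod>j\<in>J. ?r j \<omega>) = expectation (\<lambda>\<omega>. \<Prod>j\<in>J. ?g j (M j T \<omega>))" .
  have eq2: "expectation (\<lambda>\<omega>. \<Prod>j\<in>J. ?g j (age (coord j \<omega>) T)) =
      (\<Prod>j\<in>J. expectation (\<lambda>\<omega>. ?g j (age (coord j \<omega>) T)))"
  proof (rule indep_vars_lebesgue_integral[OF fin])
    have "indep_vars (\<lambda>_. path_space) coord J" using J by (intro indep_vars_subset[OF coord_indep]) auto
    then show "indep_vars (\<lambda>_. borel) (\<lambda>j \<omega>. ?g j (age (coord j \<omega>) T)) J"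
      by (rule indep_vars_compose2) (rule measurable_compose[OF age_measurable[OF T(1)] gm])
    show "integrable P (\<lambda>\<omega>. ?g j (age (coord j \<omega>) T))" if "j \<in> J" for j
      by (rule bounded_integrable[OF am[OF that] gb[OF that]])
  qed
  have "\<bar>expectation (\<lambda>\<omega>. \<Prod>j\<in>J. ?f j \<omega>) - expectation (\<lambda>\<omega>. \<Prod>j\<in>J. ?r j \<omega>)\<bar> \<le>
      real (card J) * (\<epsilon> + 2 * (\<eta> + \<eta> + (\<eta> + \<eta>)))"
    by (rule expectation_prod_close[OF fin f F(2) r F(2) step1])
  moreover have "\<bar>expectation (\<lambda>\<omega>. \<Prod>j\<in>J. ?g j (M j T \<omega>)) - expectation (\<lambda>\<omega>. \<Prod>j\<in>J. ?g j (age (coord j \<omega>) T))\<bar> \<le>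
      real (card J) * ((\<epsilon> + 2 * \<eta>) + 2 * (\<eta> + \<eta>))"
    by (rule expectation_prod_close[OF fin Mm gb am gb step2])
  moreover have "real (card J) * (\<epsilon> + 2 * (\<eta> + \<eta> + (\<eta> + \<eta>))) + real (card J) * ((\<epsilon> + 2 * \<eta>) + 2 * (\<eta> + \<eta>)) =
      real (card J) * (2 * \<epsilon> + 14 * \<eta>)"
    by (simp add: algebra_simps)
  ultimately show ?thesis unfolding eq1 eq2 by linarith
qed

text \<open>The product of the constants to which the joint expectation is close consists of the constants for
  the single vertices, so the factorization follows from the cases \<open>J = {1..n}\<close> and \<open>J = {j}\<close>.\<close>

lemma propagation_of_chaos_estimate:
  fixes F :: "nat \<Rightarrow> (real \<Rightarrow> real) \<Rightarrow> real"
  assumes n: "n \<le> k"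
    and F: "\<And>j. j \<in> {1..n} \<Longrightarrow> F j \<in> borel_measurable path_space" "\<And>j w. j \<in> {1..n} \<Longrightarrow> \<bar>F j w\<bar> \<le> 1"
    and mod: "\<And>j. j \<in> {1..n} \<Longrightarrow> uniform_modulus (F j) (tight_paths b q) (T + 1) \<delta> T1 \<epsilon>"
    and T: "0 \<le> T" "exp (- T) \<le> \<eta>" "T \<le> T1" and \<delta>: "0 < \<delta>" "\<delta> \<le> 1" and \<epsilon>: "0 \<le> \<epsilon>"
    and E: "close_event T1 \<delta> \<eta> E" and q: "\<And>T. 0 < q T"
    and D: "\<And>j. j \<in> {1..n} \<Longrightarrow> D j \<in> events" "\<And>j. j \<in> {1..n} \<Longrightarrow> 1 - \<eta> \<le> prob (D j)"
      "\<And>j. j \<in> {1..n} \<Longrightarrow> AE \<omega> in P. \<omega> \<in> D j \<longrightarrow> (\<lambda>t. N j t \<omega>) \<in> tight_paths b q"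
  shows "\<bar>expectation (\<lambda>\<omega>. \<Prod>j\<in>{1..n}. F j (sample_path (M j) \<omega>)) -
      (\<Prod>j\<in>{1..n}. expectation (\<lambda>\<omega>. F j (sample_path (M j) \<omega>)))\<bar> \<le> 2 * real n * (2 * \<epsilon> + 14 * \<eta>)"
proof -
  let ?a = "\<lambda>j. expectation (\<lambda>\<omega>. mean_functional (F j) j (age (coord j \<omega>) T))"
  let ?b = "\<lambda>j. expectation (\<lambda>\<omega>. F j (sample_path (M j) \<omega>))"
  have all: "\<bar>expectation (\<lambda>\<omega>. \<Prod>j\<in>{1..n}. F j (sample_path (M j) \<omega>)) - (\<Prod>j\<in>{1..n}. ?a j)\<bar>
      \<le> real (card {1..n}) * (2 * \<epsilon> + 14 * \<eta>)"
    by (rule expectation_prod_factorizes[OF _ F mod T \<delta> \<epsilon> E q D]) (use n in auto)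
  have single: "\<bar>?b j - ?a j\<bar> \<le> 2 * \<epsilon> + 14 * \<eta>" if j: "j \<in> {1..n}" for j
  proof -
    have "{j} \<subseteq> {1..k}" using j n by auto
    from expectation_prod_factorizes[OF this F mod T \<delta> \<epsilon> E q D] j show ?thesis by simp
  qed
  have abs1: "\<bar>expectation f\<bar> \<le> 1" if "\<And>\<omega>. \<bar>f \<omega>\<bar> \<le> 1" for f :: "'a \<Rightarrow> real"
  proof (cases "integrable P f")
    case True
    have "\<bar>expectation f\<bar> \<le> expectation (\<lambda>\<omega>. \<bar>f \<omega>\<bar>)" by (rule integral_abs_bound)
    also have "\<dots> \<le> expectation (\<lambda>\<omega>. 1)" using True that by (intro integral_mono) auto
    finally show ?thesis by (simp add: prob_space)
  qed (simp add: not_integrable_integral_eq)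
  have "\<bar>(\<Prod>j\<in>{1..n}. ?a j) - (\<Prod>j\<in>{1..n}. ?b j)\<bar> \<le> (\<Sum>j\<in>{1..n}. \<bar>?a j - ?b j\<bar>)"
    using norm_prod_diff[of "{1..n}" ?a ?b] abs1 F(2) mean_functional_bound[OF F(2)] by simp
  also have "\<dots> \<le> real (card {1..n}) * (2 * \<epsilon> + 14 * \<eta>)"
    by (rule sum_bounded_above) (use single in \<open>simp add: abs_minus_commute\<close>)
  finally show ?thesis using all by (simp add: algebra_simps abs_le_iff)
qed

end

text \<open>After scaling, clipping changes a test function only outside the cadlag paths, where no bound on it is
  known.\<close>

lemma test_function_normalized:
  assumes F: "skorokhod_test_function F"
  shows "\<exists>G B. skorokhod_test_function G \<and> (\<forall>w. \<bar>G w\<bar> \<le> 1) \<and> (\<forall>w\<in>cadlag. F w = B * G w)"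
proof -
  have meas: "F \<in> borel_measurable path_space" and bnd: "bounded (F ` cadlag)"
    and cont: "\<And>x y. (\<forall>i. x i \<in> cadlag) \<Longrightarrow> y \<in> cadlag \<Longrightarrow> skorokhod_converges x y \<Longrightarrow>
       (\<lambda>i. F (x i)) \<longlonglongrightarrow> F y"
    using F unfolding skorokhod_test_function_def by blast+
  obtain B where B: "0 < B" "\<And>w. w \<in> cadlag \<Longrightarrow> \<bar>F w\<bar> \<le> B"
    using bnd unfolding bounded_pos by auto
  define G where "G w = max (- 1) (min 1 (F w / B))" for w
  have G_eq: "G w = F w / B" if "w \<in> cadlag" for w
  proof -
    have "\<bar>F w / B\<bar> \<le> 1" using B(1) B(2)[OF that] by simp
    then show ?thesis unfolding G_def by linarith
  qed
  have "skorokhod_test_function G"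
    unfolding skorokhod_test_function_def
  proof (intro conjI allI impI)
    show "G \<in> borel_measurable path_space" unfolding G_def using meas by measurable
    show "bounded (G ` cadlag)" by (rule boundedI[of _ 1]) (auto simp: G_def)
    fix x y assume xy: "(\<forall>i. x i \<in> cadlag) \<and> y \<in> cadlag \<and> skorokhod_converges x y"
    then have "(\<lambda>i. F (x i) / B) \<longlonglongrightarrow> F y / B" using cont B(1) by (intro tendsto_divide tendsto_const) auto
    then show "(\<lambda>i. G (x i)) \<longlonglongrightarrow> G y" using xy G_eq by simp
  qed
  moreover have "\<bar>G w\<bar> \<le> 1" for w by (auto simp: G_def)
  moreover have "F w = B * G w" if "w \<in> cadlag" for w using G_eq[OF that] B(1) by simp
  ultimately show ?thesis by blast
qed

theorem corollary6p3:
  fixes P :: "nat \<Rightarrow> 'a measure"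
    and N :: "nat \<Rightarrow> nat \<Rightarrow> real \<Rightarrow> 'a \<Rightarrow> nat"
    and M :: "nat \<Rightarrow> nat \<Rightarrow> real \<Rightarrow> 'a \<Rightarrow> real"
    and Q :: "nat \<Rightarrow> (nat \<Rightarrow> real) measure"
  assumes stationary: "\<And>k. k \<ge> 2 \<Longrightarrow> stationary_distribution TYPE('a) k (Q k)"
    and mass: "\<And>k. k \<ge> 2 \<Longrightarrow> total_mass k (Q k) (real k)"
    and process: "\<And>k. k \<ge> 2 \<Longrightarrow> meteor_process k (P k) (N k) (M k)"
    and initial: "\<And>k. k \<ge> 2 \<Longrightarrow> distr (P k) (state_space k) (state k (M k) 0) = Q k"
  shows "weak_conv_m (\<lambda>k. distr (P k) borel (M k 1 0)) (density lborel (exponential_density 1)) \<and>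
    (\<forall>n\<ge>2. asymptotically_independent P M {1..n})"
proof -
  have sm: "stationary_meteor (P k) k (N k) (M k)" if k: "2 \<le> k" for k
  proof -
    interpret prob_space "P k" using process[OF k] unfolding meteor_process_def by blast
    have meas: "state k (M k) 0 \<in> P k \<rightarrow>\<^sub>M state_space k"
      unfolding state_def[abs_def]
      using process[OF k] unfolding meteor_process_def by (intro measurable_restrict) auto
    show ?thesis
    proof
      show "2 \<le> k" by fact
      show "meteor_process k (P k) (N k) (M k)" by (rule process[OF k])
      have "AE m in distr (P k) (state_space k) (state k (M k) 0). (\<Sum>j=1..k. m j) = real k"
        using mass[OF k] unfolding total_mass_def initial[OF k] .
      then have "AE \<omega> in P k. (\<Sum>j=1..k. state k (M k) 0 \<omega> j) = real k" by (rule AE_distrD[OF meas])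
      then show "AE \<omega> in P k. (\<Sum>j=1..k. M k j 0 \<omega>) = real k" by (simp add: state_def)
      show "distr (P k) (state_space k) (state k (M k) t) = distr (P k) (state_space k) (state k (M k) 0)"
        if "0 \<le> t" for t
        using stationary[OF k] process[OF k] initial[OF k] that unfolding stationary_distribution_def by metis
    qed
  qed
  have eventually_close: "\<exists>k0. \<forall>k\<ge>k0. 2 \<le> k \<and> (\<exists>E. stationary_meteor.close_event (P k) k (N k) (M k) T e \<eta> E)"
    if pos: "0 < T" "0 < e" "0 < \<eta>" for T e \<eta>
  proof -
    obtain k0 where k0: "\<And>k (P :: 'a measure) N M. k0 \<le> k \<Longrightarrow> stationary_meteor P k N M \<Longrightarrow>
      (\<exists>E\<in>sets P. 1 - \<eta> \<le> measure P E \<and>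
      (AE \<omega> in P. \<omega> \<in> E \<longrightarrow> (\<forall>x\<in>{1..k}. \<forall>t. 0 \<le> t \<and> t \<le> T \<longrightarrow>
        \<bar>M x t \<omega> - renewal_path (M x 0 \<omega>) (\<lambda>t. N x t \<omega>) t\<bar> \<le> e)))"
      using masses_close_to_renewal[OF pos] by blast
    show ?thesis
    proof (intro exI[of _ "max k0 2"] allI impI conjI)
      fix k assume k: "max k0 2 \<le> k"
      then show "2 \<le> k" by simp
      have sk: "stationary_meteor (P k) k (N k) (M k)" using k by (intro sm) simp
      then show "\<exists>E. stationary_meteor.close_event (P k) k (N k) (M k) T e \<eta> E"
        using k0[OF _ sk] k unfolding stationary_meteor.close_event_def[OF sk] by auto
    qed
  qed
  have "weak_conv_m (\<lambda>k. distr (P k) borel (M k 1 0)) (density lborel (exponential_density 1))"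
    unfolding weak_conv_m_def weak_conv_def
  proof (intro allI impI)
    fix x :: real
    have cdf_eq: "cdf (distr (P k) borel (M k 1 0)) x = measure (P k) {\<omega> \<in> space (P k). M k 1 0 \<omega> \<le> x}"
      if "2 \<le> k" for k
    proof -
      interpret stationary_meteor "P k" k "N k" "M k" by (rule sm[OF that])
      show ?thesis unfolding cdf_def
        using measure_distr[OF mass_measurable[of 1 0], of "{..x}"] k
        by (simp add: vimage_def Int_def conj_commute)
    qed
    show "(\<lambda>k. cdf (distr (P k) borel (M k 1 0)) x) \<longlonglongrightarrow> cdf (density lborel (exponential_density 1)) x"
    proof (cases "0 \<le> x")
      case True
      show ?thesis
      proof (rule LIMSEQ_I)
        fix r :: real assume r: "0 < r"
        define e where "e = min (r / 8) (1 / 2)"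
        have e: "0 < e" "2 * e \<le> 1" "e \<le> r / 8" using r by (auto simp: e_def)
        obtain k0 where k0: "\<And>k. k0 \<le> k \<Longrightarrow> 2 \<le> k \<and>
            (\<exists>E. stationary_meteor.close_event (P k) k (N k) (M k) (x + 1) e e E)"
          using eventually_close[of "x + 1" e e] True e by auto
        have "norm (cdf (distr (P k) borel (M k 1 0)) x - cdf (density lborel (exponential_density 1)) x) < r"
          if large: "k0 \<le> k" for k
        proof -
          have k2: "2 \<le> k" using k0[OF large] by simp
          interpret stationary_meteor "P k" k "N k" "M k" by (rule sm[OF k2])
          obtain E where "close_event (x + 1) e e E" using k0[OF large] by blast
          from marginal_close_to_exponential[OF this e(1,2) True, of 1] k2
          show ?thesis using cdf_eq[OF k2] True e r by (simp add: cdf_exponential)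
        qed
        then show "\<exists>no. \<forall>n\<ge>no. norm (cdf (distr (P n) borel (M n 1 0)) x -
            cdf (density lborel (exponential_density 1)) x) < r" by blast
      qed
    next
      case False
      have "cdf (distr (P k) borel (M k 1 0)) x = 0" if k2: "2 \<le> k" for k
      proof -
        interpret stationary_meteor "P k" k "N k" "M k" by (rule sm[OF k2])
        have "AE \<omega> in P k. \<omega> \<notin> {\<omega> \<in> space (P k). M k 1 0 \<omega> \<le> x}"
          using AE_start by eventually_elim (use False k mass_simplex_le(1)[of _ k 1] in force)
        then have "prob {\<omega> \<in> space (P k). M k 1 0 \<omega> \<le> x} = 0"
          using mass_event[of 1 0 x] k by (subst prob_eq_0) auto
        then show ?thesis using cdf_eq[OF k2] by simp
      qed
      then have "\<forall>\<^sub>F k in sequentially. cdf (distr (P k) borel (M k 1 0)) x = 0"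
        unfolding eventually_sequentially by blast
      then show ?thesis using False by (simp add: cdf_exponential tendsto_eventually)
    qed
  qed
  moreover have "asymptotically_independent P M {1..n}" for n :: nat
    unfolding asymptotically_independent_def
  proof (intro allI impI)
    fix F0 :: "nat \<Rightarrow> (real \<Rightarrow> real) \<Rightarrow> real"
    assume F0: "\<forall>j\<in>{1..n}. skorokhod_test_function (F0 j)"
    have "\<forall>j\<in>{1..n}. \<exists>G. \<exists>B. skorokhod_test_function G \<and> (\<forall>w. \<bar>G w\<bar> \<le> 1) \<and> (\<forall>w\<in>cadlag. F0 j w = B * G w)"
      using F0 test_function_normalized by blast
    from bchoice[OF this] obtain F where "\<forall>j\<in>{1..n}. \<exists>B. skorokhod_test_function (F j) \<and>
        (\<forall>w. \<bar>F j w\<bar> \<le> 1) \<and> (\<forall>w\<in>cadlag. F0 j w = B * F j w)" by blast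
    from bchoice[OF this] obtain B where FB: "\<And>j. j \<in> {1..n} \<Longrightarrow> skorokhod_test_function (F j)"
        "\<And>j w. j \<in> {1..n} \<Longrightarrow> \<bar>F j w\<bar> \<le> 1"
        "\<And>j w. j \<in> {1..n} \<Longrightarrow> w \<in> cadlag \<Longrightarrow> F0 j w = B j * F j w" by blast
    have F_meas: "F j \<in> borel_measurable path_space" if "j \<in> {1..n}" for j
      using FB(1)[OF that] unfolding skorokhod_test_function_def by blast
    let ?d = "\<lambda>F k. (\<integral>\<omega>. (\<Prod>j\<in>{1..n}. F j (sample_path (M k j) \<omega>)) \<partial>P k) -
           (\<Prod>j\<in>{1..n}. \<integral>\<omega>. F j (sample_path (M k j) \<omega>) \<partial>P k)"
    have scale: "?d F0 k = (\<Prod>j\<in>{1..n}. B j) * ?d F k" if k2: "2 \<le> k" "n \<le> k" for k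
    proof -
      interpret stationary_meteor "P k" k "N k" "M k" by (rule sm[OF k2(1)])
      have cad: "AE \<omega> in P k. \<forall>j\<in>{1..k}. sample_path (M k j) \<omega> \<in> cadlag"
        using AE_meteor_path by eventually_elim (auto simp: sample_path_def intro: meteor_path_cadlag)
      have F0_meas: "F0 j \<in> borel_measurable path_space" if "j \<in> {1..n}" for j
        using F0 that unfolding skorokhod_test_function_def by blast
      have m: "(\<lambda>\<omega>. H j (sample_path (M k j) \<omega>)) \<in> borel_measurable (P k)"
        if "j \<in> {1..n}" "\<And>j. j \<in> {1..n} \<Longrightarrow> H j \<in> borel_measurable path_space" for H :: "nat \<Rightarrow> (real \<Rightarrow> real) \<Rightarrow> real" and j
        by (rule measurable_compose[OF sample_path_measurable that(2)[OF that(1)]]) (use that(1) k2 in auto)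
      have "expectation (\<lambda>\<omega>. F0 j (sample_path (M k j) \<omega>)) = B j * expectation (\<lambda>\<omega>. F j (sample_path (M k j) \<omega>))"
        if j: "j \<in> {1..n}" for j
      proof -
        have "expectation (\<lambda>\<omega>. F0 j (sample_path (M k j) \<omega>)) = expectation (\<lambda>\<omega>. B j * F j (sample_path (M k j) \<omega>))"
        proof (rule integral_cong_AE)
          show "AE \<omega> in P k. F0 j (sample_path (M k j) \<omega>) = B j * F j (sample_path (M k j) \<omega>)"
            using cad by eventually_elim (use FB(3)[OF j] j k2 in auto)
        qed (use m[OF j F0_meas] m[OF j F_meas] in \<open>auto intro: borel_measurable_times\<close>)
        then show ?thesis by simp
      qed
      moreover have "expectation (\<lambda>\<omega>. \<Prod>j\<in>{1..n}. F0 j (sample_path (M k j) \<omega>)) =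
          (\<Prod>j\<in>{1..n}. B j) * expectation (\<lambda>\<omega>. \<Prod>j\<in>{1..n}. F j (sample_path (M k j) \<omega>))"
      proof -
        have "expectation (\<lambda>\<omega>. \<Prod>j\<in>{1..n}. F0 j (sample_path (M k j) \<omega>)) =
            expectation (\<lambda>\<omega>. (\<Prod>j\<in>{1..n}. B j) * (\<Prod>j\<in>{1..n}. F j (sample_path (M k j) \<omega>)))"
        proof (rule integral_cong_AE)
          show "(\<lambda>\<omega>. \<Prod>j\<in>{1..n}. F0 j (sample_path (M k j) \<omega>)) \<in> borel_measurable (P k)"
            by (intro borel_measurable_prod m F0_meas)
          show "(\<lambda>\<omega>. (\<Prod>j\<in>{1..n}. B j) * (\<Prod>j\<in>{1..n}. F j (sample_path (M k j) \<omega>))) \<in> borel_measurable (P k)"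
            by (intro borel_measurable_times borel_measurable_const borel_measurable_prod m F_meas)
          show "AE \<omega> in P k. (\<Prod>j\<in>{1..n}. F0 j (sample_path (M k j) \<omega>)) =
              (\<Prod>j\<in>{1..n}. B j) * (\<Prod>j\<in>{1..n}. F j (sample_path (M k j) \<omega>))"
            using cad
          proof eventually_elim
            case (elim \<omega>)
            show ?case
              unfolding prod.distrib[symmetric]
              by (intro prod.cong refl FB(3)) (use elim k2 in auto)
          qed
        qed
        then show ?thesis by simp
      qed
      ultimately show ?thesis by (simp add: prod.distrib right_diff_distrib)
    qed
    have "?d F \<longlonglongrightarrow> 0"
    proof (rule LIMSEQ_I)
      fix r :: real assume r: "0 < r"
      \<comment> \<open>With both tolerances equal to \<open>\<epsilon>\<close>, the estimate is \<open>2 n (2 \<epsilon> + 14 \<epsilon>) = 32 n \<epsilon>\<close>.\<close>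
      define \<epsilon> where "\<epsilon> = r / (64 * (real n + 1))"
      have \<epsilon>: "0 < \<epsilon>" using r by (simp add: \<epsilon>_def)
      have small: "2 * real n * (2 * \<epsilon> + 14 * \<epsilon>) < r"
      proof -
        have "2 * real n * (2 * \<epsilon> + 14 * \<epsilon>) = 32 * real n * \<epsilon>" by simp
        also have "\<dots> \<le> 32 * (real n + 1) * \<epsilon>" using \<epsilon> by (intro mult_right_mono) auto
        also have "\<dots> = r / 2" by (simp add: \<epsilon>_def field_simps)
        finally show ?thesis using r by simp
      qed
      obtain b q where q: "\<And>T. 0 < q T"
        and tight: "\<And>(P :: 'a measure) X. prob_space P \<Longrightarrow> unit_poisson_process P X \<Longrightarrow>
          \<exists>E\<in>sets P. 1 - \<epsilon> \<le> measure P E \<and> (AE \<omega> in P. \<omega> \<in> E \<longrightarrow> (\<lambda>t. X t \<omega>) \<in> tight_paths b q)"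
        using poisson_tight[OF \<epsilon>, where 'a = 'a] by blast
      define T where "T = max 0 (- ln \<epsilon>)"
      have T: "0 \<le> T" "exp (- T) \<le> \<epsilon>"
      proof -
        show "0 \<le> T" by (simp add: T_def)
        have "exp (- T) \<le> exp (ln \<epsilon>)" by (simp add: T_def)
        then show "exp (- T) \<le> \<epsilon>" using \<epsilon> by simp
      qed
      have "\<forall>j\<in>{1..n}. \<exists>\<delta>. \<exists>T1. 0 < \<delta> \<and> 0 \<le> T1 \<and> uniform_modulus (F j) (tight_paths b q) (T + 1) \<delta> T1 \<epsilon>"
      proof
        fix j assume "j \<in> {1..n}"
        from test_function_uniformly_continuous[where b = b and q = q and K = "T + 1", OF FB(1)[OF this] q \<epsilon>]
        show "\<exists>\<delta>. \<exists>T1. 0 < \<delta> \<and> 0 \<le> T1 \<and> uniform_modulus (F j) (tight_paths b q) (T + 1) \<delta> T1 \<epsilon>"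
          by blast
      qed
      from bchoice[OF this] obtain \<delta>0 where "\<forall>j\<in>{1..n}. \<exists>T1. 0 < \<delta>0 j \<and> 0 \<le> T1 \<and>
          uniform_modulus (F j) (tight_paths b q) (T + 1) (\<delta>0 j) T1 \<epsilon>" by blast
      from bchoice[OF this] obtain T0 where mod0: "\<And>j. j \<in> {1..n} \<Longrightarrow> 0 < \<delta>0 j"
          "\<And>j. j \<in> {1..n} \<Longrightarrow> uniform_modulus (F j) (tight_paths b q) (T + 1) (\<delta>0 j) (T0 j) \<epsilon>" by blast
      define \<delta> where "\<delta> = Min (insert 1 (\<delta>0 ` {1..n}))"
      have \<delta>: "0 < \<delta>" "\<delta> \<le> 1" "\<And>j. j \<in> {1..n} \<Longrightarrow> \<delta> \<le> \<delta>0 j"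
      proof -
        show "0 < \<delta>" using mod0(1) unfolding \<delta>_def by (subst Min_gr_iff) auto
        show "\<delta> \<le> 1" unfolding \<delta>_def by (rule Min_le) auto
        show "\<delta> \<le> \<delta>0 j" if "j \<in> {1..n}" for j
          unfolding \<delta>_def by (rule Min_le) (use that in auto)
      qed
      define T1 where "T1 = Max (insert (T + 1) (T0 ` {1..n}))"
      have T1: "T + 1 \<le> T1" "\<And>j. j \<in> {1..n} \<Longrightarrow> T0 j \<le> T1"
      proof -
        show "T + 1 \<le> T1" unfolding T1_def by (rule Max_ge) auto
        show "T0 j \<le> T1" if "j \<in> {1..n}" for j
          unfolding T1_def by (rule Max_ge) (use that in auto)
      qed
      have mod: "uniform_modulus (F j) (tight_paths b q) (T + 1) \<delta> T1 \<epsilon>" if j: "j \<in> {1..n}" for j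
        unfolding uniform_modulus_def
      proof (intro ballI impI)
        fix c m y
        assume c: "c \<in> tight_paths b q" and m: "m \<in> {0..T + 1}" and y: "y \<in> cadlag"
          and cl: "\<forall>t. 0 \<le> t \<and> t \<le> T1 \<longrightarrow> \<bar>y t - renewal_path m c t\<bar> \<le> \<delta>"
        have "\<forall>t. 0 \<le> t \<and> t \<le> T0 j \<longrightarrow> \<bar>y t - renewal_path m c t\<bar> \<le> \<delta>0 j"
          using cl \<delta>(3)[OF j] T1(2)[OF j] by force
        then show "\<bar>F j y - F j (restrict (renewal_path m c) {0..})\<bar> \<le> \<epsilon>"
          using mod0(2)[OF j] c m y unfolding uniform_modulus_def by blast
      qed
      obtain k0 where k0: "\<And>k. k0 \<le> k \<Longrightarrow> 2 \<le> k \<and>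
          (\<exists>E. stationary_meteor.close_event (P k) k (N k) (M k) T1 \<delta> \<epsilon> E)"
        using eventually_close[of T1 \<delta> \<epsilon>] T T1(1) \<delta>(1) \<epsilon> by auto
      have "norm (?d F k - 0) < r" if large: "max k0 n \<le> k" for k
      proof -
        have k2: "2 \<le> k" using k0[of k] large by simp
        interpret stationary_meteor "P k" k "N k" "M k" by (rule sm[OF k2])
        obtain E where E: "close_event T1 \<delta> \<epsilon> E" using k0[of k] large by auto
        have "\<forall>j\<in>{1..n}. \<exists>D. D \<in> events \<and> 1 - \<epsilon> \<le> prob D \<and>
            (AE \<omega> in P k. \<omega> \<in> D \<longrightarrow> (\<lambda>t. N k j t \<omega>) \<in> tight_paths b q)"
        proof
          fix j assume "j \<in> {1..n}"
          then have "j \<in> {1..k}" using large by simp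
          from tight[OF prob_space_axioms clock[OF this]]
          show "\<exists>D. D \<in> events \<and> 1 - \<epsilon> \<le> prob D \<and>
            (AE \<omega> in P k. \<omega> \<in> D \<longrightarrow> (\<lambda>t. N k j t \<omega>) \<in> tight_paths b q)" by blast
        qed
        from bchoice[OF this] obtain D where D: "\<And>j. j \<in> {1..n} \<Longrightarrow> D j \<in> events"
          "\<And>j. j \<in> {1..n} \<Longrightarrow> 1 - \<epsilon> \<le> prob (D j)"
          "\<And>j. j \<in> {1..n} \<Longrightarrow> AE \<omega> in P k. \<omega> \<in> D j \<longrightarrow> (\<lambda>t. N k j t \<omega>) \<in> tight_paths b q" by blast
        have "\<bar>?d F k\<bar> \<le> 2 * real n * (2 * \<epsilon> + 14 * \<epsilon>)"
          by (rule propagation_of_chaos_estimate[OF _ F_meas FB(2) mod T _ \<delta>(1,2) _ E q D])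
            (use large T1(1) \<epsilon> in auto)
        then show ?thesis using small by simp
      qed
      then show "\<exists>no. \<forall>k\<ge>no. norm (?d F k - 0) < r" by blast
    qed
    then have "(\<lambda>k. (\<Prod>j\<in>{1..n}. B j) * ?d F k) \<longlonglongrightarrow> (\<Prod>j\<in>{1..n}. B j) * 0"
      by (intro tendsto_mult tendsto_const)
    moreover have "\<forall>\<^sub>F k in sequentially. (\<Prod>j\<in>{1..n}. B j) * ?d F k = ?d F0 k"
      using eventually_ge_at_top[of "max 2 n"] by eventually_elim (use scale in simp)
    ultimately show "?d F0 \<longlonglongrightarrow> 0"
      by (simp only: mult_zero_right) (rule Lim_transform_eventually)
  qed
  ultimately show ?thesis by blast
qed

end
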